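(* Let $\varphi\colon X\to\mathbb{CP}^3$ be a transverse $J$-holomorphic curve in nearly Kähler $\mathbb{CP}^3$ such that the induced metric $g_{\mathcal H}$ on $X$ is flat, and such that $X$ is equal to $\mathbb{T}^2$ or $\mathbb{C}$ as a complex manifold. Then $\varphi$ parametrises a Clifford torus if $X=\mathbb{T}^2$, and the universal cover of a Clifford torus if $X=\mathbb{C}$.
   Context: Nearly Kähler $\mathbb{CP}^3$: identify $\mathbb{H}=\mathbb{C}\oplus j\mathbb{C}$ and $\mathbb{H}^2\cong\mathbb{C}^4$ via $(z_0+jz_1,z_2+jz_3)\leftrightarrow(z_0,z_1,z_2,z_3)$. $\mathrm{Sp}(2)$ acts transitively on $\mathbb{CP}^3$ with stabiliser $S^1\times S^3=\{\mathrm{diag}(z,q): z\in S^1\subset\mathbb{C},\ q\in S^3\subset\mathbb{H}\}$ of $[1,0,0,0]$. Write the left-invariant Maurer–Cartan form as $$\Omega_{MC}=\begin{pmatrix} i\rho_1+j\overline{\omega_3} & -\frac{\overline{\omega_1}}{\sqrt2}+j\frac{\omega_2}{\sqrt2}\\ \frac{\omega_1}{\sqrt2}+j\frac{\omega_2}{\sqrt2} & i\rho_2+j\tau\end{pmatrix}$$ with $\omega_1,\omega_2,\omega_3,\tau$ complex-valued and $\rho_1,\rho_2$ real. $J$ and $g$ on $\mathbb{CP}^3$ are determined by requiring that $s^*\omega_1,s^*\omega_2,s^*\omega_3$ be unitary $(1,0)$-forms for every local section $s$ of $\mathrm{Sp}(2)\to\mathbb{CP}^3$. The twistor fibration is $\mathbb{CP}^3\to\mathbb{HP}^1\cong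 S^4$, $[z_0,z_1,z_2,z_3]\mapsto[z_0+jz_1:z_2+jz_3]$, with vertical bundle $\mathcal V$ (where $\omega_1=\omega_2=0$) and horizontal bundle $\mathcal H=\mathcal V^\perp$ (where $\omega_3=0$); $g_{\mathcal H}=|\omega_1|^2+|\omega_2|^2$, and its pullback to a curve is denoted the same way. The isometries of nearly Kähler $\mathbb{CP}^3$ are given by the action of $\mathrm{Sp}(2)$. For a nowhere vertical $J$-holomorphic curve $\varphi$, $\varphi^*\mathrm{Sp}(2)$ reduces to the $S^1\times S^1$-bundle cut out by $\omega_2=0$, on which $\tau$ is of type $(1,0)$. The curve is called transverse if it is nowhere tangent to $\mathcal H$, nowhere tangent to $\mathcal V$, and this $\tau$ vanishes at no point. $\mathbb{CP}^3$ is the (negative) twistor space of $S^4$: a point over $y\in S^4$ is an orthogonal, orientation-reversing almost complex structure on $T_yS^4$, and an oriented minimal surface $f\colon\Sigma\to S^4$ has a $J$-holomorphic twistor lift $\Sigma\to\mathbb{CP}^3$ determined by its oriented tangent planes. A Clifford torus in $\mathbb{CP}^3$ is any $J$-holomorphic curve isometric (via an isometry of $\mathbb{CP}^3$) to the twistor lift of the minimal Clifford torus $T_{1,1}=\{(z,w)\in S^3\subset\mathbb{C}^2:\mathrm{Im}(z\bar w)=0\}\subset S^3\subset S^4$, where $S^3\subset S^4$ is totally geodesic.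
   Formalization: For X = C, φ is shown to be the universal cover of a Clifford torus if g_H is complete; without completeness (where F∘exp is a counterexample, F being the universal cover) φ maps onto a Clifford torus and equals F∘h with h entire and h' nowhere zero. *)

theory Defs
  imports "HOL-Analysis.Analysis"
begin

section \<open>Smooth maps\<close>

primrec Ck_on :: "nat \<Rightarrow> 'a::real_normed_vector set \<Rightarrow> ('a \<Rightarrow> 'b::real_normed_vector) \<Rightarrow> bool" where
  "Ck_on 0 U f \<longleftrightarrow> continuous_on U f"
| "Ck_on (Suc k) U f \<longleftrightarrow>
     f differentiable_on U \<and> (\<forall>v. Ck_on k U (\<lambda>x. frechet_derivative f (at x) v))"

definition smooth_on :: "'a::real_normed_vector set \<Rightarrow> ('a \<Rightarrow> 'b::real_normed_vector) \<Rightarrow> bool" where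
  "smooth_on U f \<longleftrightarrow> (\<forall>k. Ck_on k U f)"

section \<open>The complex projective space\<close>

typedef cp3 = "{range (\<lambda>c. c *s v) | v :: complex^4. v \<noteq> 0}"
  by (auto intro!: exI[of _ "axis 1 1"] simp: axis_eq_0_iff)

definition line :: "complex^4 \<Rightarrow> cp3" where
  "line v = Abs_cp3 (range (\<lambda>c. c *s v))"

(* the quotient topology of the space of nonzero vectors *)
instantiation cp3 :: topological_space
begin

definition open_cp3 :: "cp3 set \<Rightarrow> bool" where
  "open_cp3 U \<longleftrightarrow> open {v. v \<noteq> 0 \<and> line v \<in> U}"

instance
proof
  have "{v :: complex^4. v \<noteq> 0 \<and> line v \<in> UNIV} = - {0}" by auto
  then show "open (UNIV :: cp3 set)" unfolding open_cp3_def by (metis open_delete open_UNIV Compl_eq_Diff_UNIV)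
next
  fix S T :: "cp3 set"
  assume "open S" "open T"
  moreover have "{v. v \<noteq> 0 \<and> line v \<in> S \<inter> T} =
      {v. v \<noteq> 0 \<and> line v \<in> S} \<inter> {v. v \<noteq> 0 \<and> line v \<in> T}" by auto
  ultimately show "open (S \<inter> T)" by (simp add: open_cp3_def open_Int)
next
  fix K :: "cp3 set set"
  assume "\<forall>S\<in>K. open S"
  moreover have "{v. v \<noteq> 0 \<and> line v \<in> \<Union>K} = (\<Union>S\<in>K. {v. v \<noteq> 0 \<and> line v \<in> S})" by auto
  ultimately show "open (\<Union>K)" by (simp add: open_cp3_def open_UN)
qed

end

definition smooth_curve :: "(complex \<Rightarrow> cp3) \<Rightarrow> bool" where
  "smooth_curve \<phi> \<longleftrightarrow> (\<forall>z. \<exists>U F. open U \<and> z \<in> U \<and> smooth_on U F \<and>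
     (\<forall>w\<in>U. F w \<noteq> 0 \<and> line (F w) = \<phi> w))"

section \<open>The group Sp(2) and its Maurer-Cartan form\<close>

text \<open>
  A vector \<open>(z\<^sub>0, z\<^sub>1, z\<^sub>2, z\<^sub>3)\<close> of \<open>\<complex>\<^sup>4\<close> (with components \<open>$1, $2, $3, $4\<close>) stands for
  \<open>(z\<^sub>0 + j z\<^sub>1, z\<^sub>2 + j z\<^sub>3)\<close> in \<open>\<bbbH>\<^sup>2\<close>; scalars act from the right and matrices from the left.
  A quaternionic 2 by 2 matrix thus becomes a complex 4 by 4 matrix commuting with the right
  multiplication by \<open>j\<close>: left multiplication by \<open>a + j b\<close> on \<open>\<bbbH> = \<complex> \<oplus> j\<complex>\<close> is the complex matrix with
  rows \<open>(a, -cnj b)\<close> and \<open>(b, cnj a)\<close>. In particular the parts \<open>a\<close> and \<open>b\<close> of each quaternionic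
  entry can be read off the first column of the corresponding 2 by 2 block.
\<close>

definition right_j :: "complex^4 \<Rightarrow> complex^4" where
  "right_j v = vector [- cnj (v$2), cnj (v$1), - cnj (v$4), cnj (v$3)]"

definition adj :: "complex^4^4 \<Rightarrow> complex^4^4" where
  "adj A = (\<chi> r c. cnj (A$c$r))"

definition Sp2 :: "(complex^4^4) set" where
  "Sp2 = {g. adj g ** g = mat 1 \<and> (\<forall>v. g *v right_j v = right_j (g *v v))}"

definition lie_sp2 :: "(complex^4^4) set" where
  "lie_sp2 = {A. adj A = - A \<and> (\<forall>v. A *v right_j v = right_j (A *v v))}"

definition base_point :: "complex^4^4 \<Rightarrow> cp3" where
  "base_point g = line (g *v axis 1 1)"

definition act :: "complex^4^4 \<Rightarrow> cp3 \<Rightarrow> cp3" where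
  "act g p = Abs_cp3 ((\<lambda>v. g *v v) ` Rep_cp3 p)"

text \<open>
  The components of the Maurer-Cartan form, as functions of its value in the Lie algebra. The quaternionic
  entries are \<open>i \<rho>\<^sub>1 + j cnj \<omega>\<^sub>3\<close> in position (1,1), \<open>(\<omega>\<^sub>1 + j \<omega>\<^sub>2) / sqrt 2\<close> in position (2,1)
  and \<open>i \<rho>\<^sub>2 + j \<tau>\<close> in position (2,2).
\<close>

definition \<omega>1 :: "complex^4^4 \<Rightarrow> complex" where "\<omega>1 A = complex_of_real (sqrt 2) * A$3$1"
definition \<omega>2 :: "complex^4^4 \<Rightarrow> complex" where "\<omega>2 A = complex_of_real (sqrt 2) * A$4$1"
definition \<omega>3 :: "complex^4^4 \<Rightarrow> complex" where "\<omega>3 A = cnj (A$2$1)"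
definition \<tau> :: "complex^4^4 \<Rightarrow> complex" where "\<tau> A = A$4$3"

text \<open>
  For \<open>g\<close> in \<open>Sp2\<close>, an element \<open>A\<close> of \<open>lie_sp2\<close> represents the tangent vector of projective space at
  \<open>base_point g\<close> that is the image of the tangent vector \<open>g A\<close> of the group, and this vector is
  determined by \<open>\<omega>\<^sub>1, \<omega>\<^sub>2, \<omega>\<^sub>3\<close> of \<open>A\<close>. As \<open>\<omega>\<^sub>1, \<omega>\<^sub>2, \<omega>\<^sub>3\<close> are (1,0)-forms, \<open>B\<close> represents \<open>J\<close> of the
  vector represented by \<open>A\<close> in the following situation. Changing \<open>g\<close> by an element of the stabiliser
  acts on \<open>\<omega>\<^sub>1, \<omega>\<^sub>2, \<omega>\<^sub>3\<close> by a unitary matrix, so that the choice of \<open>g\<close> is irrelevant.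
\<close>

definition is_J :: "complex^4^4 \<Rightarrow> complex^4^4 \<Rightarrow> bool" where
  "is_J A B \<longleftrightarrow> \<omega>1 B = \<i> * \<omega>1 A \<and> \<omega>2 B = \<i> * \<omega>2 A \<and> \<omega>3 B = \<i> * \<omega>3 A"

section \<open>Holomorphic and transverse curves\<close>

text \<open>
  Curves are given in a global (or universal covering) holomorphic coordinate, as maps on \<open>\<complex>\<close>.
  A frame is a local section over \<open>U\<close> of the pullback of the bundle \<open>Sp2\<close> by the curve. The pullback of
  the Maurer-Cartan form by a frame \<open>g\<close> is \<open>g\<^sup>-\<^sup>1 dg\<close>, where the inverse is \<open>adj g\<close>.
\<close>

definition frame :: "(complex \<Rightarrow> cp3) \<Rightarrow> complex set \<Rightarrow> (complex \<Rightarrow> complex^4^4) \<Rightarrow> bool" where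
  "frame \<phi> U g \<longleftrightarrow> open U \<and> smooth_on U g \<and> (\<forall>z\<in>U. g z \<in> Sp2 \<and> base_point (g z) = \<phi> z)"

definition mc :: "(complex \<Rightarrow> complex^4^4) \<Rightarrow> complex \<Rightarrow> complex \<Rightarrow> complex^4^4" where
  "mc g z v = adj (g z) ** frechet_derivative g (at z) v"

definition J_holomorphic :: "(complex \<Rightarrow> cp3) \<Rightarrow> bool" where
  "J_holomorphic \<phi> \<longleftrightarrow> smooth_curve \<phi> \<and>
     (\<forall>U g z v. frame \<phi> U g \<longrightarrow> z \<in> U \<longrightarrow> is_J (mc g z v) (mc g z (\<i> * v)))"

definition tangent_vertical :: "(complex \<Rightarrow> cp3) \<Rightarrow> complex \<Rightarrow> bool" where
  "tangent_vertical \<phi> z \<longleftrightarrow>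
     (\<exists>U g. frame \<phi> U g \<and> z \<in> U \<and> (\<forall>v. \<omega>1 (mc g z v) = 0 \<and> \<omega>2 (mc g z v) = 0))"

definition tangent_horizontal :: "(complex \<Rightarrow> cp3) \<Rightarrow> complex \<Rightarrow> bool" where
  "tangent_horizontal \<phi> z \<longleftrightarrow> (\<exists>U g. frame \<phi> U g \<and> z \<in> U \<and> (\<forall>v. \<omega>3 (mc g z v) = 0))"

(* sections of the reduction of the pullback bundle cut out by \<omega>2 = 0 *)
definition adapted_frame :: "(complex \<Rightarrow> cp3) \<Rightarrow> complex set \<Rightarrow> (complex \<Rightarrow> complex^4^4) \<Rightarrow> bool" where
  "adapted_frame \<phi> U g \<longleftrightarrow> frame \<phi> U g \<and> (\<forall>z\<in>U. \<forall>v. \<omega>2 (mc g z v) = 0)"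

definition transverse :: "(complex \<Rightarrow> cp3) \<Rightarrow> bool" where
  "transverse \<phi> \<longleftrightarrow>
     (\<forall>z. \<not> tangent_horizontal \<phi> z) \<and> (\<forall>z. \<not> tangent_vertical \<phi> z) \<and>
     (\<forall>U g z. adapted_frame \<phi> U g \<longrightarrow> z \<in> U \<longrightarrow> (\<exists>v. \<tau> (mc g z v) \<noteq> 0))"

section \<open>The induced metric\<close>

(* A Riemannian metric on the complex plane is represented by its quadratic forms v \<mapsto> G z v. *)

definition g_H :: "(complex \<Rightarrow> cp3) \<Rightarrow> complex \<Rightarrow> complex \<Rightarrow> real" where
  "g_H \<phi> z v = (THE r. \<exists>U g. frame \<phi> U g \<and> z \<in> U \<and>
      r = (cmod (\<omega>1 (mc g z v)))\<^sup>2 + (cmod (\<omega>2 (mc g z v)))\<^sup>2)"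

(* locally isometric to the Euclidean plane *)
definition flat_metric :: "(complex \<Rightarrow> complex \<Rightarrow> real) \<Rightarrow> bool" where
  "flat_metric G \<longleftrightarrow> (\<forall>z. \<exists>U. \<exists>h :: complex \<Rightarrow> complex. open U \<and> z \<in> U \<and> smooth_on U h \<and>
     (\<forall>w\<in>U. \<forall>v. G w v = (norm (frechet_derivative h (at w) v))\<^sup>2))"

definition riem_length :: "(complex \<Rightarrow> complex \<Rightarrow> real) \<Rightarrow> (real \<Rightarrow> complex) \<Rightarrow> real" where
  "riem_length G \<gamma> = integral {0..1} (\<lambda>t. sqrt (G (\<gamma> t) (vector_derivative \<gamma> (at t))))"

definition riem_dist :: "(complex \<Rightarrow> complex \<Rightarrow> real) \<Rightarrow> complex \<Rightarrow> complex \<Rightarrow> real" where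
  "riem_dist G z w =
     Inf {riem_length G \<gamma> | \<gamma>. valid_path \<gamma> \<and> pathstart \<gamma> = z \<and> pathfinish \<gamma> = w}"

(* The Riemannian distance induces the standard topology, so convergence is the usual one. *)
definition complete_metric :: "(complex \<Rightarrow> complex \<Rightarrow> real) \<Rightarrow> bool" where
  "complete_metric G \<longleftrightarrow> (\<forall>s :: nat \<Rightarrow> complex.
     (\<forall>e>0. \<exists>N. \<forall>m\<ge>N. \<forall>n\<ge>N. riem_dist G (s m) (s n) < e) \<longrightarrow> convergent s)"

section \<open>The twistor fibration\<close>

type_synonym R5 = "complex \<times> complex \<times> real"

text \<open>
  The twistor fibration in homogeneous coordinates. With \<open>a = v\<^sub>1 + j v\<^sub>2\<close> and \<open>b = v\<^sub>3 + j v\<^sub>4\<close>, the point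
  \<open>[a : b]\<close> of the quaternionic projective line (right lines) is identified with the point
  \<open>(2 b a\<^sup>*, |a|\<^sup>2 - |b|\<^sup>2) / (|a|\<^sup>2 + |b|\<^sup>2)\<close> of the unit sphere of \<open>\<bbbH> \<oplus> \<real> = \<complex> \<oplus> j\<complex> \<oplus> \<real>\<close>, where \<open>a\<^sup>*\<close> is
  the conjugate quaternion. The metric \<open>|\<omega>\<^sub>1|\<^sup>2 + |\<omega>\<^sub>2|\<^sup>2\<close> descends to half the unit sphere metric.
\<close>

definition twistor_vec :: "complex^4 \<Rightarrow> R5" where
  "twistor_vec v = inverse ((norm v)\<^sup>2) *\<^sub>R
     (2 * (v$3 * cnj (v$1) + cnj (v$4) * v$2),
      2 * (v$4 * cnj (v$1) - cnj (v$3) * v$2),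
      (cmod (v$1))\<^sup>2 + (cmod (v$2))\<^sup>2 - (cmod (v$3))\<^sup>2 - (cmod (v$4))\<^sup>2)"

definition twistor_proj :: "cp3 \<Rightarrow> R5" where
  "twistor_proj p = twistor_vec (SOME v. v \<noteq> 0 \<and> line v = p)"

(* differential of the projection at base_point g, on the tangent vector represented by A *)
definition d_twistor :: "complex^4^4 \<Rightarrow> complex^4^4 \<Rightarrow> R5" where
  "d_twistor g A = frechet_derivative twistor_vec (at (g *v axis 1 1)) ((g ** A) *v axis 1 1)"

text \<open>
  The almost complex structure on the tangent space of the sphere at \<open>twistor_proj p\<close> given by the
  point \<open>p\<close>: lift a vector to a horizontal vector at \<open>p\<close>, apply \<open>J\<close> and project. The orientation of the
  sphere is the one for which all these structures are orientation-reversing.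
\<close>

definition twistor_acs :: "cp3 \<Rightarrow> R5 \<Rightarrow> R5" where
  "twistor_acs p Y = (THE Y'. \<exists>g\<in>Sp2. \<exists>A\<in>lie_sp2. \<exists>B\<in>lie_sp2. base_point g = p \<and>
      \<omega>3 A = 0 \<and> is_J A B \<and> Y = d_twistor g A \<and> Y' = d_twistor g B)"

(* velocities of curves; this is the tangent plane when S is an embedded surface *)
definition tangent_space :: "R5 set \<Rightarrow> R5 \<Rightarrow> R5 set" where
  "tangent_space S y =
     {Y. \<exists>c :: real \<Rightarrow> R5. range c \<subseteq> S \<and> c 0 = y \<and> (c has_vector_derivative Y) (at 0)}"

text \<open>
  Over \<open>y\<close> there is exactly one point whose almost complex structure preserves the tangent plane of
  \<open>S\<close> and restricts to the rotation by 90 degrees for a given orientation of that plane. Hence a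
  continuous \<open>\<sigma>\<close> as below is the twistor lift of \<open>S\<close> for an orientation of \<open>S\<close>, and conversely.
\<close>

definition twistor_lift :: "R5 set \<Rightarrow> (R5 \<Rightarrow> cp3) \<Rightarrow> bool" where
  "twistor_lift S \<sigma> \<longleftrightarrow> continuous_on S \<sigma> \<and>
     (\<forall>y\<in>S. twistor_proj (\<sigma> y) = y \<and> twistor_acs (\<sigma> y) ` tangent_space S y \<subseteq> tangent_space S y)"

section \<open>Clifford tori\<close>

definition T11 :: "R5 set" where
  "T11 = {(z, w, 0) | z w. (cmod z)\<^sup>2 + (cmod w)\<^sup>2 = 1 \<and> Im (z * cnj w) = 0}"

definition clifford_torus :: "cp3 set \<Rightarrow> bool" where
  "clifford_torus T \<longleftrightarrow> (\<exists>\<sigma>. \<exists>g\<in>Sp2. twistor_lift T11 \<sigma> \<and> T = act g ` \<sigma> ` T11)"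

definition universal_cover :: "(complex \<Rightarrow> cp3) \<Rightarrow> cp3 set \<Rightarrow> bool" where
  "universal_cover F T \<longleftrightarrow> J_holomorphic F \<and> covering_space UNIV F T"

section \<open>Complex tori\<close>

definition lattice :: "complex set \<Rightarrow> bool" where
  "lattice L \<longleftrightarrow> (\<exists>a b. Im (cnj a * b) \<noteq> 0 \<and> L = {of_int m * a + of_int n * b | m n. True})"

definition coset :: "complex set \<Rightarrow> complex \<Rightarrow> complex set" where
  "coset L z = (\<lambda>l. z + l) ` L"

definition complex_torus :: "complex set \<Rightarrow> complex set set" where
  "complex_torus L = range (coset L)"

end

theory Submission
  imports Defs "HOL-Complex_Analysis.Complex_Analysis"
begin

text \<open>
  Along an adapted frame the structure equations form a Toda system for \<open>|\<omega>\<^sub>1|\<close>, \<open>|\<omega>\<^sub>3|\<close>, \<open>|\<tau>|\<close>, and the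
  quartic differential \<open>\<omega>\<^sub>1\<^sup>2 \<omega>\<^sub>3 \<tau>\<close> is holomorphic. If the metric is flat then \<open>|\<omega>\<^sub>1| = |e dz|\<close> for an entire
  function \<open>e\<close> without zeros, and the first Toda equation becomes \<open>|\<omega>\<^sub>3|\<^sup>2 + |\<tau>|\<^sup>2 = |\<omega>\<^sub>1|\<^sup>2\<close>. Hence the
  quotient of the quartic differential by \<open>e\<^sup>4\<close> is bounded, so constant by Liouville's theorem; then
  \<open>|\<omega>\<^sub>3| / |\<omega>\<^sub>1|\<close> is constant too, and the second Toda equation forces \<open>|\<omega>\<^sub>3| = |\<tau>|\<close>. With \<open>h\<close> a primitive
  of \<open>e\<close>, suitable phases turn the Maurer-Cartan form of the frame into the pullback by \<open>h\<close> of a form with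
  constant coefficients, so the curve is \<open>h\<close> followed by one fixed homogeneous curve up to \<open>Sp2\<close>. The
  twistor projection of that curve is the Clifford torus. Little Picard makes \<open>h\<close> hit every point of the
  torus; completeness or double periodicity makes \<open>h\<close> a homeomorphism of the plane.
\<close>

text \<open>Write \<open>p\<close>, \<open>c\<close>, \<open>t\<close> for the coefficients of the
  three forms in an adapted frame. A diagonal change of frame multiplies them by phases whose
  weights cancel in \<open>p^2 * cnj c * t\<close>, and the same weights govern the connection terms
  in their d-bar equations; hence the quartic differential is holomorphic. Frames exist only locally
  and, even normalised, only up to sign. So the global data come from invariants: \<open>e\<close>
  from the logarithmic derivative of the density of \<open>g_H\<close>, and the group element
  relating curve and model is followed up to sign, which acts trivially. The moduli become equal
  because a constant ratio allows \<open>p\<close> and \<open>cnj c\<close> to be made holomorphic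
  at once; the connection then vanishes, and with it its curvature, a multiple of
  \<open>|c|^2 - |p|^2\<close>. \<open>h\<close> is only a local isometry to the flat plane. Picard
  leaves at most one value uncovered, and a period of the model moves that value to a covered one;
  completeness continues inverse branches of \<open>h\<close> across every circle; on a torus
  \<open>|h'|\<close> is periodic, which makes \<open>h\<close> affine.\<close>

no_notation fps_nth (infixl \<open>$\<close> 75)

section \<open>Calculus of smooth maps\<close>

lemma Ck_on_cong:
  assumes "open U" "\<And>x. x \<in> U \<Longrightarrow> f x = g x"
  shows "Ck_on k U f \<longleftrightarrow> Ck_on k U g"
  using assms(2)
proof (induction k arbitrary: f g)
  case 0
  then show ?case by (simp cong: continuous_on_cong)
next
  case (Suc k)
  have fd: "frechet_derivative f (at x) = frechet_derivative g (at x)" if "x \<in> U" for x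
  proof -
    have "(f has_derivative D) (at x) \<longleftrightarrow> (g has_derivative D) (at x)" for D
      using has_derivative_transform_within_open[of f D x UNIV U g]
        has_derivative_transform_within_open[of g D x UNIV U f] assms(1) Suc.prems that by auto
    then show ?thesis by (simp add: frechet_derivative_def)
  qed
  have "f differentiable (at x) \<longleftrightarrow> g differentiable (at x)" if "x \<in> U" for x
    using has_derivative_transform_within_open[of f _ x UNIV U g]
      has_derivative_transform_within_open[of g _ x UNIV U f] assms(1) Suc.prems that
    unfolding differentiable_def by metis
  then have "f differentiable_on U \<longleftrightarrow> g differentiable_on U"
    using assms(1) by (simp add: differentiable_on_eq_differentiable_at)
  then show ?case using Suc.IH[of "\<lambda>x. frechet_derivative f (at x) v" "\<lambda>x. frechet_derivative g (at x) v" for v] fd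
    by simp
qed

text \<open>The recursion of \<open>Ck_on\<close> speaks of \<open>frechet_derivative\<close>; this
  rule and \<open>Ck_on_SucE\<close> exchange it for any family of derivatives, so that the usual
  differentiation rules apply as they stand.\<close>

lemma Ck_on_SucI:
  assumes "open U" "\<And>x. x \<in> U \<Longrightarrow> (f has_derivative D x) (at x)" "\<And>v. Ck_on k U (\<lambda>x. D x v)"
  shows "Ck_on (Suc k) U f"
proof -
  have "f differentiable_on U"
    using assms(1,2) by (meson differentiable_def differentiable_on_eq_differentiable_at)
  moreover have "Ck_on k U (\<lambda>x. frechet_derivative f (at x) v)" for v
    by (subst Ck_on_cong[OF assms(1), where g="\<lambda>x. D x v"])
      (use assms(2,3) frechet_derivative_at in \<open>fastforce+\<close>)
  ultimately show ?thesis by simp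
qed

lemma Ck_on_SucE:
  assumes "open U" "Ck_on (Suc k) U f"
  obtains D where "\<And>x. x \<in> U \<Longrightarrow> (f has_derivative D x) (at x)" "\<And>v. Ck_on k U (\<lambda>x. D x v)"
proof (rule that[of "\<lambda>x. frechet_derivative f (at x)"])
  show "(f has_derivative frechet_derivative f (at x)) (at x)" if "x \<in> U" for x
    using assms that by (simp add: differentiable_on_eq_differentiable_at frechet_derivative_works)
qed (use assms in simp)

lemma Ck_on_Suc_imp:
  assumes "Ck_on (Suc k) U f"
  shows "Ck_on k U f"
  using assms
proof (induction k arbitrary: f)
  case 0
  then show ?case by (simp add: differentiable_imp_continuous_on)
next
  case (Suc k)
  then show ?case by (metis Ck_on.simps(2))
qed

lemma Ck_on_const: "open U \<Longrightarrow> Ck_on k U (\<lambda>x. c)"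
proof (induction k arbitrary: c)
  case (Suc k)
  then show ?case by (intro Ck_on_SucI[where D="\<lambda>x v. 0"]) auto
qed simp

lemma Ck_on_bounded_linear:
  assumes "bounded_linear L" "open U" "Ck_on k U f"
  shows "Ck_on k U (\<lambda>x. L (f x))"
  using assms(3)
proof (induction k arbitrary: f)
  case 0
  then show ?case using assms(1) by (simp add: bounded_linear.continuous_on)
next
  case (Suc k)
  obtain D where D: "\<And>x. x \<in> U \<Longrightarrow> (f has_derivative D x) (at x)" "\<And>v. Ck_on k U (\<lambda>x. D x v)"
    using Ck_on_SucE[OF assms(2) Suc.prems] by blast
  show ?case
    by (rule Ck_on_SucI[where D="\<lambda>x v. L (D x v)"])
      (use assms D Suc.IH bounded_linear.has_derivative in \<open>blast+\<close>)
qed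

lemma Ck_on_id: "open U \<Longrightarrow> Ck_on k U (\<lambda>x. x)"
  by (cases k) (auto intro!: Ck_on_SucI[where D="\<lambda>x v. v"] Ck_on_const)

lemma Ck_on_add:
  assumes "open U" "Ck_on k U f" "Ck_on k U g"
  shows "Ck_on k U (\<lambda>x. f x + g x)"
  using assms(2,3)
proof (induction k arbitrary: f g)
  case 0
  then show ?case by (simp add: continuous_on_add)
next
  case (Suc k)
  obtain D where D: "\<And>x. x \<in> U \<Longrightarrow> (f has_derivative D x) (at x)" "\<And>v. Ck_on k U (\<lambda>x. D x v)"
    using Ck_on_SucE[OF assms(1) Suc.prems(1)] by blast
  obtain E where E: "\<And>x. x \<in> U \<Longrightarrow> (g has_derivative E x) (at x)" "\<And>v. Ck_on k U (\<lambda>x. E x v)"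
    using Ck_on_SucE[OF assms(1) Suc.prems(2)] by blast
  show ?case
    by (rule Ck_on_SucI[where D="\<lambda>x v. D x v + E x v"])
      (use assms(1) D E Suc.IH has_derivative_add in \<open>blast+\<close>)
qed

lemma Ck_on_bounded_bilinear:
  assumes "bounded_bilinear B" "open U" "Ck_on k U f" "Ck_on k U g"
  shows "Ck_on k U (\<lambda>x. B (f x) (g x))"
  using assms(3,4)
proof (induction k arbitrary: f g)
  case 0
  then show ?case using assms(1) by (simp add: bounded_bilinear.continuous_on)
next
  case (Suc k)
  obtain D where D: "\<And>x. x \<in> U \<Longrightarrow> (f has_derivative D x) (at x)" "\<And>v. Ck_on k U (\<lambda>x. D x v)"
    using Ck_on_SucE[OF assms(2) Suc.prems(1)] by blast
  obtain E where E: "\<And>x. x \<in> U \<Longrightarrow> (g has_derivative E x) (at x)" "\<And>v. Ck_on k U (\<lambda>x. E x v)"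
    using Ck_on_SucE[OF assms(2) Suc.prems(2)] by blast
  show ?case
  proof (rule Ck_on_SucI[where D="\<lambda>x v. B (f x) (E x v) + B (D x v) (g x)"])
    fix v
    show "Ck_on k U (\<lambda>x. B (f x) (E x v) + B (D x v) (g x))"
      using Suc.prems[THEN Ck_on_Suc_imp] D(2) E(2) Suc.IH by (intro Ck_on_add assms(2)) blast+
  qed (use assms D E bounded_bilinear.FDERIV in blast)+
qed

text \<open>The induction runs over all \<open>h\<close> at once, because the chain rule replaces
  \<open>h\<close> by \<open>deriv h\<close>. This supplies inverses, square roots and trigonometric
  functions of smooth maps.\<close>

lemma Ck_on_holomorphic_compose:
  fixes f :: "'a::real_normed_vector \<Rightarrow> complex"
  assumes "open U" "open V" "h holomorphic_on V" "f ` U \<subseteq> V" "Ck_on k U f"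
  shows "Ck_on k U (\<lambda>x. h (f x))"
  using assms(3,5)
proof (induction k arbitrary: h)
  case 0
  then show ?case
    using assms(4) by (metis Ck_on.simps(1) continuous_on_compose2 holomorphic_on_imp_continuous_on)
next
  case (Suc k)
  obtain D where D: "\<And>x. x \<in> U \<Longrightarrow> (f has_derivative D x) (at x)" "\<And>v. Ck_on k U (\<lambda>x. D x v)"
    using Ck_on_SucE[OF assms(1) Suc.prems(2)] by blast
  show ?case
  proof (rule Ck_on_SucI[where D="\<lambda>x v. deriv h (f x) * D x v"])
    fix x assume "x \<in> U"
    then have "(h has_derivative (*) (deriv h (f x))) (at (f x))"
      using assms(2,4) Suc.prems(1) by (metis has_field_derivative_imp_has_derivative holomorphic_derivI image_subset_iff)
    then show "((\<lambda>x. h (f x)) has_derivative (\<lambda>v. deriv h (f x) * D x v)) (at x)"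
      using has_derivative_compose[OF D(1)[OF \<open>x \<in> U\<close>]] by blast
  next
    fix v
    have "Ck_on k U (\<lambda>x. deriv h (f x))"
      using Suc.IH[OF holomorphic_deriv[OF Suc.prems(1) assms(2)]] Ck_on_Suc_imp[OF Suc.prems(2)] by blast
    then show "Ck_on k U (\<lambda>x. deriv h (f x) * D x v)"
      using D(2) by (intro Ck_on_bounded_bilinear[OF bounded_bilinear_mult assms(1)])
  qed (use assms in auto)
qed

text \<open>Used to translate frames of a periodic curve by a period.\<close>

lemma Ck_on_shift:
  assumes "open U" "Ck_on k U f"
  shows "Ck_on k ((\<lambda>x. x - c) ` U) (\<lambda>x. f (x + c))"
  using assms(2)
proof (induction k arbitrary: f)
  case 0
  then show ?case by (auto intro!: continuous_intros intro: continuous_on_compose2)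
next
  case (Suc k)
  obtain D where D: "\<And>x. x \<in> U \<Longrightarrow> (f has_derivative D x) (at x)" "\<And>v. Ck_on k U (\<lambda>x. D x v)"
    using Ck_on_SucE[OF assms(1) Suc.prems(1)] by blast
  show ?case
  proof (rule Ck_on_SucI[where D="\<lambda>x. D (x + c)"])
    show "open ((\<lambda>x. x - c) ` U)" using assms(1) by (simp add: open_translation_subtract)
    fix x assume "x \<in> (\<lambda>x. x - c) ` U"
    then have "(f has_derivative D (x + c)) (at (x + c))" using D(1) by auto
    moreover have "((\<lambda>x. x + c) has_derivative (\<lambda>v. v)) (at x)" by (auto intro!: derivative_eq_intros)
    ultimately show "((\<lambda>x. f (x + c)) has_derivative D (x + c)) (at x)"
      using has_derivative_compose by blast
  qed (use Suc.IH D(2) in blast)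
qed

lemma Ck_on_subset: "Ck_on k U f \<Longrightarrow> V \<subseteq> U \<Longrightarrow> Ck_on k V f"
  by (induction k arbitrary: f) (auto intro: continuous_on_subset differentiable_on_subset)

section \<open>Closure properties of smooth maps\<close>

lemma smooth_on_subset: "smooth_on U f \<Longrightarrow> V \<subseteq> U \<Longrightarrow> smooth_on V f"
  unfolding smooth_on_def using Ck_on_subset by blast

lemma smooth_on_const: "open U \<Longrightarrow> smooth_on U (\<lambda>x. c)"
  by (simp add: smooth_on_def Ck_on_const)

lemma smooth_on_id: "open U \<Longrightarrow> smooth_on U (\<lambda>x. x)"
  by (simp add: smooth_on_def Ck_on_id)

lemma smooth_on_bounded_linear:
  "bounded_linear L \<Longrightarrow> open U \<Longrightarrow> smooth_on U f \<Longrightarrow> smooth_on U (\<lambda>x. L (f x))"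
  by (simp add: smooth_on_def Ck_on_bounded_linear)

lemma smooth_on_add:
  "open U \<Longrightarrow> smooth_on U f \<Longrightarrow> smooth_on U g \<Longrightarrow> smooth_on U (\<lambda>x. f x + g x)"
  by (simp add: smooth_on_def Ck_on_add)

lemma smooth_on_mult:
  fixes f g :: "_ \<Rightarrow> complex"
  shows "open U \<Longrightarrow> smooth_on U f \<Longrightarrow> smooth_on U g \<Longrightarrow> smooth_on U (\<lambda>x. f x * g x)"
  by (simp add: smooth_on_def Ck_on_bounded_bilinear[OF bounded_bilinear_mult])

lemma smooth_on_minus: "open U \<Longrightarrow> smooth_on U f \<Longrightarrow> smooth_on U (\<lambda>x. - f x)"
  by (rule smooth_on_bounded_linear[OF bounded_linear_minus[OF bounded_linear_ident]])

lemma smooth_on_diff: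
  "open U \<Longrightarrow> smooth_on U f \<Longrightarrow> smooth_on U g \<Longrightarrow> smooth_on U (\<lambda>x. f x - g x)"
  using smooth_on_add[of U f "\<lambda>x. - g x"] smooth_on_minus by fastforce

lemma smooth_on_cnj: "open U \<Longrightarrow> smooth_on U f \<Longrightarrow> smooth_on U (\<lambda>x. cnj (f x))"
  by (rule smooth_on_bounded_linear[OF bounded_linear_cnj])

lemma smooth_on_sum:
  "open U \<Longrightarrow> (\<And>i. i \<in> S \<Longrightarrow> smooth_on U (f i)) \<Longrightarrow> smooth_on U (\<lambda>x. \<Sum>i\<in>S. f i x)"
  by (induction S rule: infinite_finite_induct) (auto intro: smooth_on_const smooth_on_add)

lemma smooth_on_holomorphic_compose:
  fixes f :: "'a::real_normed_vector \<Rightarrow> complex"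
  shows "open U \<Longrightarrow> open V \<Longrightarrow> h holomorphic_on V \<Longrightarrow> f ` U \<subseteq> V \<Longrightarrow> smooth_on U f \<Longrightarrow>
    smooth_on U (\<lambda>x. h (f x))"
  by (simp add: smooth_on_def Ck_on_holomorphic_compose)

lemma smooth_on_holomorphic: "open U \<Longrightarrow> h holomorphic_on U \<Longrightarrow> smooth_on U h"
  using smooth_on_holomorphic_compose[of U U h "\<lambda>x. x"] smooth_on_id by auto

lemma smooth_on_divide:
  fixes f g :: "_ \<Rightarrow> complex"
  assumes "open U" "smooth_on U f" "smooth_on U g" "\<And>x. x \<in> U \<Longrightarrow> g x \<noteq> 0"
  shows "smooth_on U (\<lambda>x. f x / g x)"
proof -
  have "smooth_on U (\<lambda>x. inverse (g x))"
    by (rule smooth_on_holomorphic_compose[where V="-{0}"])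
      (use assms in \<open>auto intro!: holomorphic_intros\<close>)
  from smooth_on_mult[OF assms(1,2) this] show ?thesis by (simp add: divide_inverse)
qed

lemma smooth_on_vec_nth: "open U \<Longrightarrow> smooth_on U f \<Longrightarrow> smooth_on U (\<lambda>x. f x $ i)"
  by (rule smooth_on_bounded_linear[OF bounded_linear_vec_nth])

lemma smooth_on_vec_lambda:
  fixes f :: "'a::real_normed_vector \<Rightarrow> 'b::real_normed_vector ^ 'n::finite"
  assumes "open U" "\<And>i. smooth_on U (\<lambda>x. f x $ i)"
  shows "smooth_on U f"
proof -
  have "bounded_linear (\<lambda>y. axis i y :: 'b ^ 'n)" for i :: 'n
  proof (rule bounded_linear_intro[where K=1])
    fix y :: 'b
    have "(norm ((axis i y :: 'b ^ 'n) $ j))\<^sup>2 = (if j = i then (norm y)\<^sup>2 else 0)" for j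
      by (simp add: axis_def)
    then show "norm (axis i y :: 'b ^ 'n) \<le> norm y * 1"
      by (simp add: norm_vec_def L2_set_def)
  next
    show "axis i (x + y) = axis i x + (axis i y :: 'b ^ 'n)" for x y
      by (simp add: axis_def vec_eq_iff)
    show "axis i (r *\<^sub>R x) = r *\<^sub>R (axis i x :: 'b ^ 'n)" for r x
      by (simp add: axis_def vec_eq_iff)
  qed
  then have "smooth_on U (\<lambda>x. \<Sum>i\<in>UNIV. axis i (f x $ i))"
    by (intro smooth_on_sum assms(1) smooth_on_bounded_linear[OF _ assms])
  moreover have "(\<Sum>i\<in>UNIV. axis i (f x $ i)) = f x" for x
    by (simp add: vec_eq_iff axis_def if_distrib sum.delta cong: if_cong)
  ultimately show ?thesis by simp
qed

lemma smooth_on_differentiable: "open U \<Longrightarrow> smooth_on U f \<Longrightarrow> x \<in> U \<Longrightarrow> f differentiable (at x)"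
  unfolding smooth_on_def using Ck_on.simps(2)[of 0 U f] by (meson differentiable_on_eq_differentiable_at)

lemma smooth_on_has_derivative:
  "open U \<Longrightarrow> smooth_on U f \<Longrightarrow> x \<in> U \<Longrightarrow> (f has_derivative frechet_derivative f (at x)) (at x)"
  using smooth_on_differentiable frechet_derivative_works by blast

lemma smooth_on_continuous: "smooth_on U f \<Longrightarrow> continuous_on U f"
  unfolding smooth_on_def using Ck_on.simps(1)[of U f] by blast

lemma smooth_on_frechet: "smooth_on U f \<Longrightarrow> smooth_on U (\<lambda>x. frechet_derivative f (at x) v)"
  unfolding smooth_on_def by (metis Ck_on.simps(2))

lemma smooth_on_matrix_mult:
  fixes f :: "'a::real_normed_vector \<Rightarrow> complex^'n::finite^'m::finite" and g :: "'a \<Rightarrow> complex^'k::finite^'n"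
  assumes "open U" "smooth_on U f" "smooth_on U g"
  shows "smooth_on U (\<lambda>x. f x ** g x)"
  by (intro smooth_on_vec_lambda assms(1))
    (simp add: matrix_matrix_mult_def assms smooth_on_sum smooth_on_mult smooth_on_vec_nth)

lemmas smooth_intros = smooth_on_const smooth_on_id smooth_on_add smooth_on_mult smooth_on_minus
  smooth_on_diff smooth_on_cnj smooth_on_sum smooth_on_divide smooth_on_vec_nth

text \<open>Schwarz's theorem. The second difference of \<open>f\<close> over a parallelogram is
  symmetric in its two sides, and two applications of the mean value theorem express it through a
  mixed derivative at a nearby point, in either order; continuity of these derivatives does the
  rest.\<close>

lemma mixed_partials_real:
  fixes f :: "complex \<Rightarrow> real"
  assumes "open U" "z \<in> U" "smooth_on U f"
  shows "frechet_derivative (\<lambda>w. frechet_derivative f (at w) 1) (at z) \<i> =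
         frechet_derivative (\<lambda>w. frechet_derivative f (at w) \<i>) (at z) 1"
proof -
  define a where "a v w = frechet_derivative f (at w) v" for v w
  define b where "b u v w = frechet_derivative (a v) (at w) u" for u v w
  have sa: "smooth_on U (a v)" for v using assms(3) unfolding a_def by (rule smooth_on_frechet)
  have cb: "continuous_on U (b u v)" for u v
    unfolding b_def by (intro smooth_on_continuous smooth_on_frechet sa)
  have df: "((\<lambda>t. f (p + of_real t * v)) has_real_derivative a v (p + of_real t * v)) (at t)"
    if "p + of_real t * v \<in> U" for p v t
  proof -
    have "((\<lambda>t. f (p + of_real t * v)) has_derivative (\<lambda>s. a v (p + of_real t * v) * s)) (at t)"
    proof -
      have D: "(f has_derivative frechet_derivative f (at (p + of_real t * v))) (at (p + of_real t * v))"
        using smooth_on_has_derivative assms(1,3) that by blast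
      have "((\<lambda>t. f (p + of_real t * v)) has_derivative (\<lambda>s. frechet_derivative f (at (p + of_real t * v)) (of_real s * v))) (at t)"
        by (rule has_derivative_compose[where f="\<lambda>t. p + of_real t * v" and g=f, OF _ D])
          (auto intro!: derivative_eq_intros)
      then show ?thesis
        using linear_cmul[OF has_derivative_linear[OF D], of _ v]
        by (simp add: a_def scaleR_conv_of_real mult.commute)
    qed
    then show ?thesis by (simp add: has_field_derivative_def)
  qed
  have da: "((\<lambda>t. a v (p + of_real t * u)) has_real_derivative b u v (p + of_real t * u)) (at t)"
    if "p + of_real t * u \<in> U" for p u v t
  proof -
    have D: "(a v has_derivative frechet_derivative (a v) (at (p + of_real t * u))) (at (p + of_real t * u))"
      using smooth_on_has_derivative assms(1) sa that by blast
    have "((\<lambda>t. a v (p + of_real t * u)) has_derivative (\<lambda>s. frechet_derivative (a v) (at (p + of_real t * u)) (of_real s * u))) (at t)"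
      by (rule has_derivative_compose[where f="\<lambda>t. p + of_real t * u" and g="a v", OF _ D])
        (auto intro!: derivative_eq_intros)
    then have "((\<lambda>t. a v (p + of_real t * u)) has_derivative (\<lambda>s. b u v (p + of_real t * u) * s)) (at t)"
      using linear_cmul[OF has_derivative_linear[OF D], of _ u]
      by (simp add: b_def scaleR_conv_of_real mult.commute)
    then show ?thesis by (simp add: has_field_derivative_def)
  qed
  have key: "\<exists>w\<in>ball z d. f (z + of_real h * u + of_real h * v) - f (z + of_real h * u) - f (z + of_real h * v) + f z = h * h * b v u w"
    if d: "ball z d \<subseteq> U" "0 < h" "2 * h < d" and uv: "cmod u = 1" "cmod v = 1" for d h u v
  proof -
    have inU: "z + of_real s * u + of_real t * v \<in> ball z d" if "0 \<le> s" "s \<le> h" "0 \<le> t" "t \<le> h" for s t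
    proof -
      have "cmod (of_real s * u + of_real t * v) \<le> s + t"
        using norm_triangle_ineq[of "of_real s * u" "of_real t * v"] uv that by (simp add: norm_mult)
      also have "\<dots> < d" using that d by simp
      finally have "dist (z + (of_real s * u + of_real t * v)) z < d" by (simp add: dist_norm)
      then show ?thesis by (simp add: dist_commute add.assoc)
    qed
    \<comment> \<open>The increment of \<open>F\<close> over \<open>[0, h]\<close> is the second
      difference. The first mean value theorem acts on \<open>F\<close> in direction
      \<open>u\<close>, the second on \<open>a u\<close> in direction \<open>v\<close>.\<close>
    define F where "F s = f ((z + of_real h * v) + of_real s * u) - f (z + of_real s * u)" for s
    have "\<exists>s. 0 < s \<and> s < h \<and> F h - F 0 = (h - 0) * (a u ((z + of_real h * v) + of_real s * u) - a u (z + of_real s * u))"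
    proof (rule MVT2[OF \<open>0 < h\<close>])
      fix s assume s: "0 \<le> s" "s \<le> h"
      have "(z + of_real h * v) + of_real s * u \<in> U" "z + of_real s * u \<in> U"
        using inU[OF s, of h] inU[OF s, of 0] d by (auto simp: algebra_simps)
      then show "(F has_real_derivative a u ((z + of_real h * v) + of_real s * u) - a u (z + of_real s * u)) (at s)"
        unfolding F_def by (intro DERIV_diff df)
    qed
    then obtain s where s: "0 < s" "s < h"
      "F h - F 0 = h * (a u ((z + of_real h * v) + of_real s * u) - a u (z + of_real s * u))" by auto
    have "\<exists>t. 0 < t \<and> t < h \<and> a u ((z + of_real s * u) + of_real h * v) - a u ((z + of_real s * u) + of_real 0 * v)
        = (h - 0) * b v u ((z + of_real s * u) + of_real t * v)"
    proof (rule MVT2[OF \<open>0 < h\<close>])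
      fix t assume t: "0 \<le> t" "t \<le> h"
      show "((\<lambda>t. a u ((z + of_real s * u) + of_real t * v)) has_real_derivative b v u ((z + of_real s * u) + of_real t * v)) (at t)"
        by (rule da) (use inU[of s t] s t d in auto)
    qed
    then obtain t where t: "0 < t" "t < h"
      "a u ((z + of_real s * u) + of_real h * v) - a u (z + of_real s * u) = h * b v u ((z + of_real s * u) + of_real t * v)"
      by auto
    have "F h - F 0 = h * h * b v u ((z + of_real s * u) + of_real t * v)"
      using s(3) t(3) by (simp add: add_ac)
    moreover have "(z + of_real s * u) + of_real t * v \<in> ball z d" using inU s t by auto
    ultimately show ?thesis unfolding F_def by (intro bexI[of _ "(z + of_real s * u) + of_real t * v"]) (auto simp: algebra_simps)
  qed
  have "dist (b \<i> 1 z) (b 1 \<i> z) \<le> e" if "e > 0" for e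
  proof -
    have iso: "isCont (b u v) z" for u v
      using cb assms(1,2) continuous_on_eq_continuous_at by blast
    obtain d1 where d1: "d1 > 0" "\<And>w. dist w z < d1 \<Longrightarrow> dist (b \<i> 1 w) (b \<i> 1 z) < e/2"
      using iso[of \<i> 1] \<open>e > 0\<close> unfolding continuous_at_eps_delta by (meson half_gt_zero)
    obtain d2 where d2: "d2 > 0" "\<And>w. dist w z < d2 \<Longrightarrow> dist (b 1 \<i> w) (b 1 \<i> z) < e/2"
      using iso[of 1 \<i>] \<open>e > 0\<close> unfolding continuous_at_eps_delta by (meson half_gt_zero)
    obtain d3 where d3: "d3 > 0" "ball z d3 \<subseteq> U" using assms(1,2) open_contains_ball by blast
    define d where "d = min d1 (min d2 d3)"
    have d: "d > 0" "d \<le> d1" "d \<le> d2" "d \<le> d3" using d1 d2 d3 by (auto simp: d_def)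
    have dU: "ball z d \<subseteq> U" using d(4) d3(2) by (meson subset_ball subset_trans)
    \<comment> \<open>A side of \<open>d/3\<close> meets the requirement \<open>2 * h < d\<close> of
      \<open>key\<close>, so the parallelogram stays in the ball.\<close>
    obtain w1 where w1: "w1 \<in> ball z d" "f (z + of_real (d/3) * 1 + of_real (d/3) * \<i>) - f (z + of_real (d/3) * 1) - f (z + of_real (d/3) * \<i>) + f z = (d/3) * (d/3) * b \<i> 1 w1"
      using key[OF dU, of "d/3" 1 \<i>] d(1) by auto
    obtain w2 where w2: "w2 \<in> ball z d" "f (z + of_real (d/3) * \<i> + of_real (d/3) * 1) - f (z + of_real (d/3) * \<i>) - f (z + of_real (d/3) * 1) + f z = (d/3) * (d/3) * b 1 \<i> w2"
      using key[OF dU, of "d/3" \<i> 1] d(1) by auto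
    have sw: "z + of_real (d/3) * \<i> + of_real (d/3) * 1 = z + of_real (d/3) * 1 + of_real (d/3) * \<i>"
      by simp
    have "(d/3) * (d/3) * b \<i> 1 w1 = (d/3) * (d/3) * b 1 \<i> w2" using w1(2) w2(2) unfolding sw by linarith
    then have "b \<i> 1 w1 = b 1 \<i> w2" using d(1) by simp
    moreover have "dist (b \<i> 1 w1) (b \<i> 1 z) < e/2" using d1(2) w1(1) d by (auto simp: dist_commute)
    moreover have "dist (b 1 \<i> w2) (b 1 \<i> z) < e/2" using d2(2) w2(1) d by (auto simp: dist_commute)
    ultimately show ?thesis unfolding dist_real_def by linarith
  qed
  then have "b \<i> 1 z = b 1 \<i> z" by (metis dense_ge dist_le_zero_iff)
  then show ?thesis unfolding b_def a_def .
qed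

lemma frechet_derivative_bounded_linear:
  assumes "bounded_linear L" "f differentiable (at x)"
  shows "frechet_derivative (\<lambda>x. L (f x)) (at x) v = L (frechet_derivative f (at x) v)"
proof -
  have "((\<lambda>x. L (f x)) has_derivative (\<lambda>v. L (frechet_derivative f (at x) v))) (at x)"
    using bounded_linear.has_derivative[OF assms(1)] assms(2) frechet_derivative_works by blast
  from frechet_derivative_at[OF this] show ?thesis by metis
qed

text \<open>Reduced to real functions by pairing with basis vectors. Applied to a frame, it yields
  the Maurer-Cartan equation.\<close>

lemma mixed_partials:
  fixes f :: "complex \<Rightarrow> 'a::euclidean_space"
  assumes "open U" "z \<in> U" "smooth_on U f"
  shows "frechet_derivative (\<lambda>w. frechet_derivative f (at w) 1) (at z) \<i> =
         frechet_derivative (\<lambda>w. frechet_derivative f (at w) \<i>) (at z) 1"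
proof (rule euclidean_eqI)
  fix b :: 'a
  let ?L = "\<lambda>x :: 'a. x \<bullet> b"
  note L = bounded_linear_inner_left[of b]
  have df: "f differentiable (at w)" if "w \<in> U" for w using smooth_on_differentiable assms that by blast
  have d2: "(\<lambda>w. frechet_derivative f (at w) v) differentiable (at z)" for v
    using smooth_on_differentiable smooth_on_frechet assms by blast
  have fd: "frechet_derivative (\<lambda>w. frechet_derivative (\<lambda>x. ?L (f x)) (at w) v) (at z) u =
      frechet_derivative (\<lambda>w. ?L (frechet_derivative f (at w) v)) (at z) u" for u v
  proof -
    have "(\<lambda>w. ?L (frechet_derivative f (at w) v)) differentiable (at z)"
      using d2[of v] bounded_linear.has_derivative[OF L] unfolding differentiable_def by blast
    then have "((\<lambda>w. ?L (frechet_derivative f (at w) v)) has_derivative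
        frechet_derivative (\<lambda>w. ?L (frechet_derivative f (at w) v)) (at z)) (at z)"
      using frechet_derivative_works by blast
    then have "((\<lambda>w. frechet_derivative (\<lambda>x. ?L (f x)) (at w) v) has_derivative
        frechet_derivative (\<lambda>w. ?L (frechet_derivative f (at w) v)) (at z)) (at z)"
      by (rule has_derivative_transform_within_open[OF _ assms(1,2)])
        (simp add: frechet_derivative_bounded_linear[OF L df])
    from frechet_derivative_at[OF this] show ?thesis by metis
  qed
  show "?L (frechet_derivative (\<lambda>w. frechet_derivative f (at w) 1) (at z) \<i>) =
      ?L (frechet_derivative (\<lambda>w. frechet_derivative f (at w) \<i>) (at z) 1)"
    using mixed_partials_real[OF assms(1,2) smooth_on_bounded_linear[OF L assms(1,3)]]
    by (simp add: fd frechet_derivative_bounded_linear[OF L d2])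
qed

section \<open>The complex projective space\<close>

lemma Rep_cp3_line: "v \<noteq> 0 \<Longrightarrow> Rep_cp3 (line v) = range (\<lambda>c. c *s v)"
  unfolding line_def by (intro Abs_cp3_inverse) auto

lemma ex_line: "\<exists>v. v \<noteq> 0 \<and> line v = p"
proof -
  obtain v :: "complex^4" where "v \<noteq> 0" "Rep_cp3 p = range (\<lambda>c. c *s v)" using Rep_cp3[of p] by auto
  then show ?thesis using Rep_cp3_inverse[of p] by (auto simp: line_def)
qed

lemma line_scale: "c \<noteq> 0 \<Longrightarrow> line (c *s v) = line v"
proof -
  assume c: "c \<noteq> 0"
  have "range (\<lambda>d. d *s (c *s v)) = range (\<lambda>d. d *s v)"
  proof
    show "range (\<lambda>d. d *s v) \<subseteq> range (\<lambda>d. d *s (c *s v))"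
    proof clarify
      fix d show "d *s v \<in> range (\<lambda>d. d *s (c *s v))"
        by (rule range_eqI[of _ _ "d / c"]) (use c in \<open>simp add: vec_eq_iff\<close>)
    qed
  qed (auto simp: vector_smult_assoc)
  then show ?thesis by (simp add: line_def)
qed

lemma line_eqD:
  assumes "u \<noteq> 0" "v \<noteq> 0" "line u = line v"
  obtains c where "c \<noteq> 0" "u = c *s v"
proof -
  have "range (\<lambda>c. c *s u) = range (\<lambda>c. c *s v)" using assms by (simp flip: Rep_cp3_line)
  moreover have "u \<in> range (\<lambda>c. c *s u)" by (rule range_eqI[of _ _ 1]) simp
  ultimately obtain c where "u = c *s v" by auto
  then show ?thesis using that assms(1) by (cases "c = 0") auto
qed

lemma matrix_vector_mult_smult: "A *v (c *s v) = c *s (A *v (v :: complex^4))"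
  by (simp add: vec_eq_iff matrix_vector_mult_def sum_distrib_left mult_ac)

lemma act_line: "v \<noteq> 0 \<Longrightarrow> act g (line v) = line (g *v v)"
  unfolding act_def by (simp add: Rep_cp3_line image_image matrix_vector_mult_smult) (simp add: line_def)

lemma open_nonzero: "open {v. v \<noteq> (0::complex^4)}"
  using open_Compl[OF closed_singleton[of "0::complex^4"]] by (simp add: Compl_eq)

text \<open>Universal property of the quotient topology that \<open>open_cp3\<close> defines through
  \<open>line\<close>.\<close>

lemma continuous_on_cp3:
  fixes f :: "cp3 \<Rightarrow> 'b::topological_space"
  assumes "continuous_on {v. v \<noteq> 0} (\<lambda>v. f (line v))"
  shows "continuous_on S f"
proof -
  have "open (f -` B)" if "open B" for B
  proof -
    have "open ((\<lambda>v. f (line v)) -` B \<inter> {v. v \<noteq> 0})"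
      using assms that continuous_on_open_vimage[OF open_nonzero] by blast
    then show ?thesis by (simp add: open_cp3_def vimage_def Int_def conj_commute)
  qed
  then have "continuous_on UNIV f" by (simp add: continuous_on_open_vimage)
  then show ?thesis by (rule continuous_on_subset) simp
qed

lemma continuous_on_line: "continuous_on {v. v \<noteq> 0} line"
  unfolding continuous_on_open_vimage[OF open_nonzero]
proof (intro allI impI)
  fix B :: "cp3 set" assume "open B"
  moreover have "line -` B \<inter> {v. v \<noteq> 0} = {v. v \<noteq> 0 \<and> line v \<in> B}" by auto
  ultimately show "open (line -` B \<inter> {v. v \<noteq> 0})" by (simp only: open_cp3_def)
qed

section \<open>Quaternionic and unitary matrices\<close>

definition quat :: "complex^4^4 \<Rightarrow> bool" where
  "quat A \<longleftrightarrow> (\<forall>v. A *v right_j v = right_j (A *v v))"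

lemma vector_4:
  "(vector [a,b,c,d] :: ('a::zero)^4) $ 1 = a" "(vector [a,b,c,d] :: 'a^4) $ 2 = b"
  "(vector [a,b,c,d] :: 'a^4) $ 3 = c" "(vector [a,b,c,d] :: 'a^4) $ 4 = d"
  by (simp_all add: vector_def)

lemma right_j_nth:
  "right_j v $ 1 = - cnj (v$2)" "right_j v $ 2 = cnj (v$1)"
  "right_j v $ 3 = - cnj (v$4)" "right_j v $ 4 = cnj (v$3)"
  by (simp_all add: right_j_def vector_4)

lemma matrix_vector_axis_nth: "(A *v axis c 1) $ r = (A::complex^4^4) $ r $ c"
  by (simp add: matrix_vector_mult_def axis_def if_distrib sum.delta cong: if_cong)

lemma matrix_vector_nth: "((A::complex^4^4) *v v) $ r = A$r$1 * v$1 + A$r$2 * v$2 + A$r$3 * v$3 + A$r$4 * v$4"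
  by (simp add: matrix_vector_mult_def sum_4)

lemma matrix_mult_nth:
  "((A::complex^4^4) ** (B::complex^4^4)) $ r $ c = A$r$1 * B$1$c + A$r$2 * B$2$c + A$r$3 * B$3$c + A$r$4 * B$4$c"
  by (simp add: matrix_matrix_mult_def sum_4)

text \<open>\<open>right_j\<close> is conjugate linear and sends the first basis vector to the
  second and the third to the fourth, so commuting with it merely ties columns 2 and 4 to columns 1
  and 3.\<close>

lemma quat_iff:
  "quat A \<longleftrightarrow> A$1$2 = - cnj (A$2$1) \<and> A$2$2 = cnj (A$1$1) \<and> A$3$2 = - cnj (A$4$1) \<and> A$4$2 = cnj (A$3$1)
     \<and> A$1$4 = - cnj (A$2$3) \<and> A$2$4 = cnj (A$1$3) \<and> A$3$4 = - cnj (A$4$3) \<and> A$4$4 = cnj (A$3$3)"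
  (is "_ \<longleftrightarrow> ?R")
proof
  assume q: "quat A"
  have "right_j (axis 1 1) = axis 2 1" "right_j (axis 3 1) = axis 4 1"
    by (simp_all add: vec_eq_iff forall_4 right_j_nth axis_def)
  then have "A$r$2 = right_j (A *v axis 1 1) $ r" "A$r$4 = right_j (A *v axis 3 1) $ r" for r
    using q by (metis quat_def matrix_vector_axis_nth)+
  note e = this[unfolded right_j_nth]
  show ?R
    using e[of 1] e[of 2] e[of 3] e[of 4] by (simp only: right_j_nth matrix_vector_axis_nth simp_thms)
next
  assume R: ?R
  then have "(A *v right_j v) $ 1 = right_j (A *v v) $ 1" "(A *v right_j v) $ 2 = right_j (A *v v) $ 2"
    "(A *v right_j v) $ 3 = right_j (A *v v) $ 3" "(A *v right_j v) $ 4 = right_j (A *v v) $ 4" for v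
    by (simp_all add: right_j_nth matrix_vector_nth algebra_simps)
  then show "quat A" by (simp add: quat_def vec_eq_iff forall_4)
qed

lemma quat_mult: "quat A \<Longrightarrow> quat B \<Longrightarrow> quat (A ** B)"
  by (simp add: quat_def matrix_vector_mul_assoc[symmetric])

lemma quat_adj: "quat A \<Longrightarrow> quat (adj A)"
  by (simp add: quat_iff adj_def)

lemma adj_nth: "adj A $ r $ c = cnj (A $ c $ r)"
  by (simp add: adj_def)

lemma adj_adj: "adj (adj A) = A"
  by (simp add: adj_def vec_eq_iff)

lemma adj_mult: "adj (A ** B) = adj B ** adj A"
  by (simp add: adj_def vec_eq_iff matrix_matrix_mult_def mult.commute)

lemma Sp2_iff: "g \<in> Sp2 \<longleftrightarrow> adj g ** g = mat 1 \<and> quat g"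
  by (simp add: Sp2_def quat_def)

lemma lie_sp2_iff: "A \<in> lie_sp2 \<longleftrightarrow> adj A = - A \<and> quat A"
  by (simp add: lie_sp2_def quat_def)

lemma Sp2_right: "g \<in> Sp2 \<Longrightarrow> g ** adj g = mat 1"
  by (simp add: Sp2_iff matrix_left_right_inverse)

lemma Sp2_adj: "g \<in> Sp2 \<Longrightarrow> adj g \<in> Sp2"
  by (simp add: Sp2_iff quat_adj adj_adj matrix_left_right_inverse)

lemma Sp2_mult: "g \<in> Sp2 \<Longrightarrow> h \<in> Sp2 \<Longrightarrow> g ** h \<in> Sp2"
  by (simp add: Sp2_iff quat_mult adj_mult matrix_mul_assoc)
    (metis matrix_mul_assoc matrix_mul_rid)

lemma Sp2_cancel: "g \<in> Sp2 \<Longrightarrow> adj g ** (g ** A) = A" "g \<in> Sp2 \<Longrightarrow> g ** (adj g ** A) = A"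
  by (simp_all add: matrix_mul_assoc Sp2_right) (simp add: Sp2_iff)

lemma Sp2_nonzero: "g \<in> Sp2 \<Longrightarrow> v \<noteq> 0 \<Longrightarrow> g *v v \<noteq> (0::complex^4)"
  by (metis Sp2_iff matrix_vector_mul_assoc matrix_vector_mul_lid matrix_vector_mult_0_right)

lemma axis_1_nonzero: "axis 1 1 \<noteq> (0::complex^4)"
  by (simp add: axis_eq_0_iff)

lemma base_point_mult: "h \<in> Sp2 \<Longrightarrow> base_point (g ** h) = act g (base_point h)"
  by (simp add: base_point_def act_line Sp2_nonzero axis_1_nonzero matrix_vector_mul_assoc)

lemma act_act: "h \<in> Sp2 \<Longrightarrow> act g (act h p) = act (g ** h) p"
proof -
  assume h: "h \<in> Sp2"
  obtain v where v: "v \<noteq> 0" "line v = p" using ex_line by metis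
  then have "act g (act h p) = line (g *v (h *v v))" using Sp2_nonzero[OF h v(1)] act_line by metis
  also have "\<dots> = act (g ** h) p" 
    unfolding v(2)[symmetric] act_line[OF v(1)] by (simp add: matrix_vector_mul_assoc)
  finally show ?thesis .
qed

lemma act_mat1: "act (mat 1) p = p"
  using ex_line[of p] act_line[of _ "mat 1"] by (metis matrix_vector_mul_lid)

lemma continuous_on_act: "g \<in> Sp2 \<Longrightarrow> continuous_on S (act g)"
proof (rule continuous_on_cp3)
  assume g: "g \<in> Sp2"
  have "continuous_on {v. v \<noteq> 0} (\<lambda>v. line (g *v v))"
    by (rule continuous_on_compose2[OF continuous_on_line])
      (use Sp2_nonzero[OF g] in \<open>auto intro!: linear_continuous_on matrix_vector_mul_bounded_linear\<close>)
  then show "continuous_on {v. v \<noteq> 0} (\<lambda>v. act g (line v))"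
    by (rule continuous_on_eq) (auto simp: act_line)
qed

lemma bounded_bilinear_matrix_mult:
  "bounded_bilinear (\<lambda>A B. (A :: complex^4^4) ** (B :: complex^4^4))"
proof -
  have "bilinear (\<lambda>A B. (A :: complex^4^4) ** (B :: complex^4^4))"
    unfolding bilinear_def
    by (auto intro!: linearI simp: matrix_matrix_mult_def vec_eq_iff scaleR_sum_right algebra_simps sum.distrib)
  then show ?thesis by (simp add: bilinear_conv_bounded_bilinear)
qed

lemma bounded_linear_adj: "bounded_linear adj"
  by (rule linear_conv_bounded_linear[THEN iffD1])
    (auto intro!: linearI simp: adj_def vec_eq_iff)

lemma smooth_on_adj: "open U \<Longrightarrow> smooth_on U g \<Longrightarrow> smooth_on U (\<lambda>x. adj (g x))"
  by (rule smooth_on_bounded_linear[OF bounded_linear_adj])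

lemma bounded_linear_entry: "bounded_linear (\<lambda>A. (A :: complex^4^4) $ r $ c)"
  by (rule bounded_linear_compose[OF bounded_linear_vec_nth bounded_linear_vec_nth])

section \<open>Frames\<close>

lemma frame_derivative:
  assumes "frame \<phi> U g" "z \<in> U"
  shows "(g has_derivative (\<lambda>v. g z ** mc g z v)) (at z)"
proof -
  have g: "g z \<in> Sp2" using assms by (simp add: frame_def)
  have "(g has_derivative frechet_derivative g (at z)) (at z)"
    using assms smooth_on_has_derivative by (auto simp: frame_def)
  then show ?thesis by (simp add: mc_def Sp2_cancel[OF g])
qed

lemma mc_linear:
  assumes "frame \<phi> U g" "z \<in> U"
  shows "linear (mc g z)"
proof -
  have "linear (frechet_derivative g (at z))"
    by (rule has_derivative_linear[OF smooth_on_has_derivative]) (use assms in \<open>auto simp: frame_def\<close>)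
  moreover have "linear (\<lambda>B :: complex^4^4. adj (g z) ** B)"
    by (rule bounded_linear.linear[OF bounded_bilinear.bounded_linear_right[OF bounded_bilinear_matrix_mult]])
  ultimately have "linear ((\<lambda>B. adj (g z) ** B) \<circ> frechet_derivative g (at z))" by (rule linear_compose)
  then show ?thesis by (simp add: mc_def[abs_def] o_def)
qed

lemma mc_eq:
  assumes "open U" "z \<in> U" "\<And>w. w \<in> U \<Longrightarrow> g w \<in> Sp2" "(g has_derivative D) (at z)"
  shows "mc g z v = adj (g z) ** D v"
  using frechet_derivative_at[OF assms(4)] by (simp add: mc_def)

text \<open>Differentiating the two equations that define \<open>Sp2\<close> along the frame gives
  the two that define \<open>lie_sp2\<close>.\<close>

lemma mc_lie:
  assumes "frame \<phi> U g" "z \<in> U"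
  shows "mc g z v \<in> lie_sp2"
proof -
  have U: "open U" and g: "\<And>w. w \<in> U \<Longrightarrow> g w \<in> Sp2" using assms by (auto simp: frame_def)
  define D where "D = frechet_derivative g (at z)"
  have D: "(g has_derivative D) (at z)"
    using assms smooth_on_has_derivative by (auto simp: frame_def D_def)
  have "((\<lambda>w. adj (g w) ** g w) has_derivative (\<lambda>v. adj (g z) ** D v + adj (D v) ** g z)) (at z)"
    by (rule bounded_bilinear.FDERIV[OF bounded_bilinear_matrix_mult
          bounded_linear.has_derivative[OF bounded_linear_adj D] D])
  moreover have "((\<lambda>w. adj (g w) ** g w) has_derivative (\<lambda>v. 0)) (at z)"
    by (rule has_derivative_transform_within_open[OF has_derivative_const[of "mat 1"] U assms(2)])
      (use g in \<open>simp add: Sp2_iff\<close>)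
  ultimately have "(\<lambda>v. adj (g z) ** D v + adj (D v) ** g z) = (\<lambda>v. 0)" by (rule has_derivative_unique)
  then have "adj (g z) ** D v + adj (D v) ** g z = 0" by (rule fun_cong)
  then have 1: "adj (mc g z v) = - mc g z v"
    by (simp add: mc_def adj_mult adj_adj D_def[symmetric] eq_neg_iff_add_eq_0 add.commute)
  have "quat (D v)"
    unfolding quat_def
  proof
    fix u
    \<comment> \<open>For fixed \<open>u\<close> the quaternionic condition is real linear in the
      matrix and therefore passes to the derivative.\<close>
    have "bounded_linear (\<lambda>A. A *v right_j u - right_j (A *v u))"
      by (rule linear_conv_bounded_linear[THEN iffD1])
        (auto intro!: linearI simp: vec_eq_iff forall_4 right_j_nth matrix_vector_mult_def sum_4 algebra_simps)
    from bounded_linear.has_derivative[OF this D]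
    have "((\<lambda>w. g w *v right_j u - right_j (g w *v u)) has_derivative
        (\<lambda>v. D v *v right_j u - right_j (D v *v u))) (at z)" .
    moreover have "((\<lambda>w. g w *v right_j u - right_j (g w *v u)) has_derivative (\<lambda>v. 0)) (at z)"
      by (rule has_derivative_transform_within_open[OF has_derivative_const[of "0"] U assms(2)])
        (use g in \<open>auto simp: Sp2_def\<close>)
    ultimately have "(\<lambda>v. D v *v right_j u - right_j (D v *v u)) = (\<lambda>v. 0)" by (rule has_derivative_unique)
    from fun_cong[OF this, of v] show "D v *v right_j u = right_j (D v *v u)" by simp
  qed
  then have "quat (mc g z v)"
    using g[OF assms(2)] by (simp add: mc_def D_def Sp2_iff quat_mult quat_adj)
  with 1 show ?thesis by (simp add: lie_sp2_iff)
qed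

lemma frame_nonzero: "g \<in> Sp2 \<Longrightarrow> g *v axis 1 1 \<noteq> 0"
  by (simp add: Sp2_nonzero axis_1_nonzero)

lemma mat1_entries:
  "(mat 1 :: complex^4^4) $ 1 $ 1 = 1" "(mat 1 :: complex^4^4) $ 3 $ 3 = 1" "(mat 1 :: complex^4^4) $ 1 $ 3 = 0"
  "(mat 1 :: complex^4^4) $ 2 $ 3 = 0"
  by (simp_all add: mat_def)

text \<open>The stabiliser \<open>S\<^sup>1 \<times> S\<^sup>3\<close> of \<open>[1, 0, 0, 0]\<close>; its block form is derived in \<open>stab_entries\<close>.\<close>

definition stab :: "complex^4^4 \<Rightarrow> bool" where
  "stab s \<longleftrightarrow> s \<in> Sp2 \<and> s$2$1 = 0 \<and> s$3$1 = 0 \<and> s$4$1 = 0"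

text \<open>Unitarity makes the corner entry a unit; orthogonality of the third column to the first
  two then clears its upper half, and \<open>quat\<close> supplies the columns 2 and 4.\<close>

lemma stab_entries:
  assumes "stab s"
  shows "s$1$2 = 0" "s$2$2 = cnj (s$1$1)" "s$3$2 = 0" "s$4$2 = 0" "s$1$3 = 0" "s$2$3 = 0" "s$1$4 = 0" "s$2$4 = 0"
    "s$3$4 = - cnj (s$4$3)" "s$4$4 = cnj (s$3$3)" "s$2$1 = 0" "s$3$1 = 0" "s$4$1 = 0"
    "cnj (s$1$1) * s$1$1 = 1" "cnj (s$3$3) * s$3$3 + cnj (s$4$3) * s$4$3 = 1"
proof -
  have q: "quat s" and u: "adj s ** s = mat 1" and z: "s$2$1 = 0" "s$3$1 = 0" "s$4$1 = 0"
    using assms by (auto simp: stab_def Sp2_iff)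
  note e = q[unfolded quat_iff]
  have u11: "cnj (s$1$1) * s$1$1 = 1"
    using arg_cong[OF u, of "\<lambda>A. A$1$1"] z by (simp add: matrix_mult_nth adj_nth mat1_entries)
  have u13: "cnj (s$1$1) * s$1$3 = 0"
    using arg_cong[OF u, of "\<lambda>A. A$1$3"] z by (simp add: matrix_mult_nth adj_nth mat1_entries)
  have u23: "s$1$1 * s$2$3 = 0"
    using arg_cong[OF u, of "\<lambda>A. A$2$3"] z e by (simp add: matrix_mult_nth adj_nth mat1_entries)
  have z3: "s$1$3 = 0" "s$2$3 = 0" using u11 u13 u23 by auto
  have "cnj (s$3$3) * s$3$3 + cnj (s$4$3) * s$4$3 = 1"
    using arg_cong[OF u, of "\<lambda>A. A$3$3"] z3 by (simp add: matrix_mult_nth adj_nth mat1_entries)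
  then show "s$1$2 = 0" "s$2$2 = cnj (s$1$1)" "s$3$2 = 0" "s$4$2 = 0" "s$1$3 = 0" "s$2$3 = 0" "s$1$4 = 0" "s$2$4 = 0"
    "s$3$4 = - cnj (s$4$3)" "s$4$4 = cnj (s$3$3)" "s$2$1 = 0" "s$3$1 = 0" "s$4$1 = 0"
    "cnj (s$1$1) * s$1$1 = 1" "cnj (s$3$3) * s$3$3 + cnj (s$4$3) * s$4$3 = 1"
    using e z z3 u11 by auto
qed

lemma same_base_point:
  assumes "g \<in> Sp2" "h \<in> Sp2" "base_point g = base_point h"
  shows "stab (adj g ** h)"
proof -
  obtain c where c: "h *v axis 1 1 = c *s (g *v axis 1 1)"
    using assms line_eqD frame_nonzero unfolding base_point_def by metis
  have "(adj g ** h) *v axis 1 1 = c *s (adj g *v (g *v axis 1 1))"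
    by (simp add: matrix_vector_mul_assoc[symmetric] c matrix_vector_mult_smult)
  also have "\<dots> = c *s axis 1 1"
    using assms(1) by (simp add: matrix_vector_mul_assoc Sp2_iff)
  finally have "((adj g ** h) *v axis 1 1) $ r = (c *s axis 1 1 :: complex^4) $ r" for r by simp
  then have "(adj g ** h) $ r $ 1 = (c *s axis 1 1 :: complex^4) $ r" for r
    by (simp only: matrix_vector_axis_nth)
  then show ?thesis using assms by (simp add: stab_def Sp2_mult Sp2_adj axis_def)
qed

text \<open>The gauge rule \<open>h^-1 dh = s^-1 (g^-1 dg) s + s^-1 ds\<close> for
  \<open>h = g s\<close>. Since \<open>s\<close> stays in the stabiliser, \<open>ds\<close> has
  nothing below the corner of its first column, so that \<open>\<omega>1\<close>,
  \<open>\<omega>2\<close>, \<open>\<omega>3\<close> change without an inhomogeneous term.\<close>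

lemma frame_transition:
  assumes "frame \<phi> U g" "frame \<phi> V h" "z \<in> U" "z \<in> V"
  defines "s \<equiv> \<lambda>w. adj (g w) ** h w"
  shows "h z = g z ** s z" "stab (s z)"
    "mc h z v = adj (s z) ** (mc g z v ** s z + frechet_derivative s (at z) v)"
    "\<And>r. r \<noteq> 1 \<Longrightarrow> frechet_derivative s (at z) v $ r $ 1 = 0"
    "(s has_derivative frechet_derivative s (at z)) (at z)"
proof -
  define W where "W = U \<inter> V"
  have W: "open W" "z \<in> W" using assms by (auto simp: W_def frame_def)
  have gh: "g w \<in> Sp2" "h w \<in> Sp2" "base_point (g w) = base_point (h w)" if "w \<in> W" for w
    using assms that by (auto simp: W_def frame_def)
  have st: "stab (s w)" if "w \<in> W" for w unfolding s_def using same_base_point gh that by blast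
  show "stab (s z)" using st W by blast
  have h: "h w = g w ** s w" if "w \<in> W" for w using gh that by (simp add: s_def Sp2_cancel)
  then show "h z = g z ** s z" using W by blast
  have sm: "smooth_on W s"
    unfolding s_def using assms(1,2) W
    by (intro smooth_on_matrix_mult smooth_on_adj) (auto simp: frame_def W_def intro: smooth_on_subset)
  define S where "S = frechet_derivative s (at z)"
  have S: "(s has_derivative S) (at z)" unfolding S_def using smooth_on_has_derivative[OF W(1) sm W(2)] .
  then show "(s has_derivative frechet_derivative s (at z)) (at z)" by (simp add: S_def)
  have "((\<lambda>w. g w ** s w) has_derivative (\<lambda>v. g z ** S v + (g z ** mc g z v) ** s z)) (at z)"
    by (rule bounded_bilinear.FDERIV[OF bounded_bilinear_matrix_mult frame_derivative[OF assms(1,3)] S])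
  then have "(h has_derivative (\<lambda>v. g z ** S v + (g z ** mc g z v) ** s z)) (at z)"
    by (rule has_derivative_transform_within_open[OF _ W]) (simp add: h)
  then have "mc h z v = adj (h z) ** (g z ** S v + (g z ** mc g z v) ** s z)"
    using mc_eq[OF W] gh by blast
  also have "\<dots> = adj (s z) ** (adj (g z) ** (g z ** (S v + mc g z v ** s z)))"
    by (simp add: h[OF W(2)] adj_mult matrix_mul_assoc matrix_add_ldistrib)
  finally show "mc h z v = adj (s z) ** (mc g z v ** s z + frechet_derivative s (at z) v)"
    by (simp add: S_def add.commute Sp2_cancel(1)[OF gh(1)[OF W(2)]])
  show "frechet_derivative s (at z) v $ r $ 1 = 0" if "r \<noteq> 1" for r
  proof -
    have "((\<lambda>w. s w $ r $ 1) has_derivative (\<lambda>v. S v $ r $ 1)) (at z)"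
      by (rule bounded_linear.has_derivative[OF bounded_linear_entry S])
    moreover have "((\<lambda>w. s w $ r $ 1) has_derivative (\<lambda>v. 0)) (at z)"
    proof (rule has_derivative_transform_within_open[OF has_derivative_const[of 0] W])
      fix w assume "w \<in> W"
      show "0 = s w $ r $ 1"
        using exhaust_4[of r] that stab_entries(11-13)[OF st[OF \<open>w \<in> W\<close>]] by auto
    qed
    ultimately have "(\<lambda>v. S v $ r $ 1) = (\<lambda>v. 0)" by (rule has_derivative_unique)
    from fun_cong[OF this, of v] show ?thesis by (simp add: S_def)
  qed
qed

text \<open>Here \<open>l\<close> and \<open>a + j b\<close> are the diagonal quaternions of the
  transition element, and the formulas are its isotropy action on tangent vectors.\<close>

lemma frame_change:
  assumes "frame \<phi> U g" "frame \<phi> V h" "z \<in> U" "z \<in> V"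
  obtains l a b where "cnj l * l = 1" "cnj a * a + cnj b * b = 1"
    "\<And>v. mc h z v $ 2 $ 1 = l\<^sup>2 * mc g z v $ 2 $ 1"
    "\<And>v. mc h z v $ 3 $ 1 = l * (cnj a * mc g z v $ 3 $ 1 + cnj b * mc g z v $ 4 $ 1)"
    "\<And>v. mc h z v $ 4 $ 1 = l * (- b * mc g z v $ 3 $ 1 + a * mc g z v $ 4 $ 1)"
proof -
  define s where "s = adj (g z) ** h z"
  note t = frame_transition[OF assms, folded s_def]
  note e = stab_entries[OF t(2)]
  show ?thesis
  proof (rule that[of "s$1$1" "s$3$3" "s$4$3"])
    show "cnj (s$1$1) * s$1$1 = 1" "cnj (s$3$3) * s$3$3 + cnj (s$4$3) * s$4$3 = 1" by (fact e)+
    fix v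
    show "mc h z v $ 2 $ 1 = (s$1$1)\<^sup>2 * mc g z v $ 2 $ 1"
      using t(4) by (simp add: t(3) matrix_mult_nth adj_nth e(1-13) power2_eq_square)
    show "mc h z v $ 3 $ 1 = s$1$1 * (cnj (s$3$3) * mc g z v $ 3 $ 1 + cnj (s$4$3) * mc g z v $ 4 $ 1)"
      using t(4) by (simp add: t(3) matrix_mult_nth adj_nth e(1-13) ring_distribs mult_ac)
    show "mc h z v $ 4 $ 1 = s$1$1 * (- s$4$3 * mc g z v $ 3 $ 1 + s$3$3 * mc g z v $ 4 $ 1)"
      using t(4) by (simp add: t(3) matrix_mult_nth adj_nth e(1-13) ring_distribs mult_ac)
  qed
qed

section \<open>The Hermitian form and orthonormal quaternionic columns\<close>

definition herm :: "complex^4 \<Rightarrow> complex^4 \<Rightarrow> complex" where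
  "herm u v = cnj (u$1) * v$1 + cnj (u$2) * v$2 + cnj (u$3) * v$3 + cnj (u$4) * v$4"

lemma herm_self: "herm u u = of_real ((norm u)\<^sup>2)"
  by (simp add: herm_def norm_vec_def L2_set_def sum_4 complex_norm_square mult.commute flip: of_real_power)

lemma herm_add: "herm u (v + w) = herm u v + herm u w" "herm (u + v) w = herm u w + herm v w"
  by (simp_all add: herm_def algebra_simps)

lemma herm_diff: "herm u (v - w) = herm u v - herm u w" "herm (u - v) w = herm u w - herm v w"
  by (simp_all add: herm_def algebra_simps)

lemma herm_smult: "herm u (c *s v) = c * herm u v" "herm (c *s u) v = cnj c * herm u v"
  by (simp_all add: herm_def algebra_simps)

lemma herm_right_j: "herm (right_j u) (right_j v) = cnj (herm u v)" "herm (right_j u) u = 0" "herm u (right_j u) = 0"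
  by (simp_all add: herm_def right_j_nth algebra_simps)

text \<open>The quaternionic 2 by 2 matrix with columns \<open>v\<close> and \<open>w\<close>; each
  is followed by its right multiple by j, as \<open>quat_iff\<close> demands.\<close>

definition quat_columns :: "complex^4 \<Rightarrow> complex^4 \<Rightarrow> complex^4^4" where
  "quat_columns v w = (\<chi> r c. if c = 1 then v$r else if c = 2 then right_j v $ r
     else if c = 3 then w$r else right_j w $ r)"

lemma quat_columns_nth:
  "quat_columns v w $ r $ 1 = v $ r" "quat_columns v w $ r $ 2 = right_j v $ r"
  "quat_columns v w $ r $ 3 = w $ r" "quat_columns v w $ r $ 4 = right_j w $ r"
  by (simp_all add: quat_columns_def)

lemma quat_columns_Sp2:
  assumes "herm v v = 1" "herm w w = 1" "herm v w = 0" "herm (right_j v) w = 0"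
  shows "quat_columns v w \<in> Sp2"
proof -
  define G where "G = quat_columns v w"
  have q: "quat G" by (simp add: quat_iff G_def quat_columns_nth right_j_nth)
  have e1: "cnj (v$1) * v$1 + cnj (v$2) * v$2 + cnj (v$3) * v$3 + cnj (v$4) * v$4 = 1"
    and e2: "cnj (w$1) * w$1 + cnj (w$2) * w$2 + cnj (w$3) * w$3 + cnj (w$4) * w$4 = 1"
    and e3: "cnj (v$1) * w$1 + cnj (v$2) * w$2 + cnj (v$3) * w$3 + cnj (v$4) * w$4 = 0"
    and e4: "v$1 * w$2 - v$2 * w$1 + v$3 * w$4 - v$4 * w$3 = 0"
    using assms by (simp_all add: herm_def right_j_nth algebra_simps)
  have e5: "cnj (w$1) * v$1 + cnj (w$2) * v$2 + cnj (w$3) * v$3 + cnj (w$4) * v$4 = 0"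
    using arg_cong[OF e3, of cnj] by (simp add: mult.commute)
  have e6: "cnj (v$1) * cnj (w$2) - cnj (v$2) * cnj (w$1) + cnj (v$3) * cnj (w$4) - cnj (v$4) * cnj (w$3) = 0"
    using arg_cong[OF e4, of cnj] by simp
  have qq: "quat (adj G ** G)" using q by (simp add: quat_mult quat_adj)
  have c: "(adj G ** G) $ 1 $ 1 = 1" "(adj G ** G) $ 2 $ 1 = 0" "(adj G ** G) $ 3 $ 1 = 0" "(adj G ** G) $ 4 $ 1 = 0"
    "(adj G ** G) $ 1 $ 3 = 0" "(adj G ** G) $ 2 $ 3 = 0" "(adj G ** G) $ 3 $ 3 = 1" "(adj G ** G) $ 4 $ 3 = 0"
    using e1 e2 e3 e4 e5 e6 by (simp_all add: matrix_mult_nth adj_nth G_def quat_columns_nth right_j_nth algebra_simps)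
  have "adj G ** G = mat 1"
    using c qq[unfolded quat_iff] by (simp add: vec_eq_iff forall_4 mat_def)
  then show ?thesis using q by (simp add: Sp2_iff G_def)
qed

lemma smooth_on_herm:
  "open U \<Longrightarrow> smooth_on U f \<Longrightarrow> smooth_on U g \<Longrightarrow> smooth_on U (\<lambda>x. herm (f x) (g x))"
  unfolding herm_def by (intro smooth_intros)

lemma smooth_on_right_j: "open U \<Longrightarrow> smooth_on U f \<Longrightarrow> smooth_on U (\<lambda>x. right_j (f x))"
proof (rule smooth_on_vec_lambda)
  fix i :: 4
  assume *: "open U" "smooth_on U f"
  then have n: "smooth_on U (\<lambda>x. cnj (f x $ k))" for k by (intro smooth_intros)
  show "smooth_on U (\<lambda>x. right_j (f x) $ i)"
    using exhaust_4[of i] n smooth_on_minus[OF *(1) n] by (auto simp: right_j_nth)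
qed

lemma smooth_on_smult:
  assumes "open U" "smooth_on U f" "smooth_on U (g :: 'a::real_normed_vector \<Rightarrow> complex^'n::finite)"
  shows "smooth_on U (\<lambda>x. f x *s g x)"
  by (intro smooth_on_vec_lambda assms(1)) (simp add: assms smooth_on_mult smooth_on_vec_nth)

lemma smooth_on_quat_columns:
  "open U \<Longrightarrow> smooth_on U f \<Longrightarrow> smooth_on U g \<Longrightarrow> smooth_on U (\<lambda>x. quat_columns (f x) (g x))"
proof (intro smooth_on_vec_lambda)
  fix r c :: 4
  assume *: "open U" "smooth_on U f" "smooth_on U g"
  show "smooth_on U (\<lambda>x. quat_columns (f x) (g x) $ r $ c)"
    using exhaust_4[of c] smooth_on_vec_nth[OF *(1) *(2)] smooth_on_vec_nth[OF *(1) *(3)]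
      smooth_on_vec_nth[OF *(1) smooth_on_right_j[OF *(1) *(2)]]
      smooth_on_vec_nth[OF *(1) smooth_on_right_j[OF *(1) *(3)]]
    by (elim disjE) (simp_all add: quat_columns_nth)
qed

lemma csqrt_norm: "csqrt (of_real ((norm (u :: complex^4))\<^sup>2)) = of_real (norm u)"
  by (simp flip: of_real_power)

lemma herm_normalize:
  assumes "u \<noteq> 0"
  shows "herm ((1 / of_real (norm u) :: complex) *s u) ((1 / of_real (norm u) :: complex) *s u) = 1"
  unfolding herm_smult herm_self[of u] using assms by (simp add: power2_eq_square)

lemma smooth_on_normalize:
  fixes f :: "'a::real_normed_vector \<Rightarrow> complex^4"
  assumes "open U" "smooth_on U f" "\<And>x. x \<in> U \<Longrightarrow> f x \<noteq> 0"
  shows "smooth_on U (\<lambda>x. (1 / of_real (norm (f x)) :: complex) *s f x)"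
proof -
  \<comment> \<open>The norm is taken as \<open>csqrt\<close> of a positive number, off the branch
    cut, which brings it under composition with holomorphic functions.\<close>
  have "smooth_on U (\<lambda>x. csqrt (herm (f x) (f x)))"
  proof (rule smooth_on_holomorphic_compose[where V="- \<real>\<^sub>\<le>\<^sub>0" and h=csqrt])
    show "csqrt holomorphic_on - \<real>\<^sub>\<le>\<^sub>0" by (intro holomorphic_on_csqrt)
    show "(\<lambda>x. herm (f x) (f x)) ` U \<subseteq> - \<real>\<^sub>\<le>\<^sub>0"
      using assms(3) by (auto simp: herm_self complex_nonpos_Reals_iff simp flip: of_real_power)
  qed (use assms smooth_on_herm in auto)
  then have "smooth_on U (\<lambda>x. of_real (norm (f x)) :: complex)"
    by (simp add: herm_self csqrt_norm del: of_real_power)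
  then show ?thesis using assms by (intro smooth_on_smult smooth_on_divide smooth_on_const) auto
qed

text \<open>Quaternionic Gram-Schmidt: a unit lift \<open>v\<close> of the curve is completed by the
  normalised projection of some coordinate vector to the complement of \<open>v\<close> and
  \<open>right_j v\<close>.\<close>

lemma frame_exists:
  assumes "smooth_curve \<phi>"
  obtains U g where "frame \<phi> U g" "z \<in> U"
proof -
  obtain U F where U: "open U" "z \<in> U" "smooth_on U F" "\<And>w. w \<in> U \<Longrightarrow> F w \<noteq> 0 \<and> line (F w) = \<phi> w"
    using assms unfolding smooth_curve_def by meson
  define v where "v w = (1 / of_real (norm (F w)) :: complex) *s F w" for w
  have sv: "smooth_on U v" unfolding v_def using U by (intro smooth_on_normalize) auto
  have hv: "herm (v w) (v w) = 1" if "w \<in> U" for w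
    using U(4)[OF that] herm_normalize by (simp add: v_def)
  have lv: "v w \<noteq> 0" "line (v w) = \<phi> w" if "w \<in> U" for w
  proof -
    show "line (v w) = \<phi> w" using U(4)[OF that] by (simp add: v_def line_scale)
    show "v w \<noteq> 0" using hv[OF that] by (auto simp: herm_def)
  qed
  define y where "y k w = axis k 1 - herm (v w) (axis k 1) *s v w - herm (right_j (v w)) (axis k 1) *s right_j (v w)"
    for k :: 4 and w
  \<comment> \<open>The left side is the trace of the projection. It equals 2 for unit
    \<open>v w\<close>, so not every coordinate vector is killed.\<close>
  have tr: "y 1 w $ 1 + y 2 w $ 2 + y 3 w $ 3 + y 4 w $ 4 = 4 - 2 * herm (v w) (v w)" for w
    by (simp add: y_def herm_def right_j_nth axis_def algebra_simps)
  have "\<exists>k. y k z \<noteq> 0"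
  proof (rule ccontr)
    assume "\<not> ?thesis"
    then have "y k z = 0" for k by blast
    then show False using tr[of z] hv[OF U(2)] by simp
  qed
  then obtain k where k: "y k z \<noteq> 0" by blast
  have sy: "smooth_on U (y k)"
    unfolding y_def
    by (intro smooth_on_diff smooth_on_smult smooth_on_herm smooth_on_right_j smooth_on_const U(1) sv)
  define V where "V = U \<inter> y k -` (- {0})"
  have V: "open V" "z \<in> V" "V \<subseteq> U" "\<And>w. w \<in> V \<Longrightarrow> y k w \<noteq> 0"
    using continuous_open_preimage[OF smooth_on_continuous[OF sy] U(1), of "- {0}"] U k
    by (auto simp: V_def)
  define w3 where "w3 w = (1 / of_real (norm (y k w)) :: complex) *s y k w" for w
  have sw: "smooth_on V w3" unfolding w3_def
    using V by (intro smooth_on_normalize smooth_on_subset[OF sy]) auto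
  have "frame \<phi> V (\<lambda>w. quat_columns (v w) (w3 w))"
    unfolding frame_def
  proof (intro conjI ballI V(1))
    show "smooth_on V (\<lambda>w. quat_columns (v w) (w3 w))"
      by (rule smooth_on_quat_columns[OF V(1) smooth_on_subset[OF sv V(3)] sw])
    fix w assume w: "w \<in> V"
    then have wU: "w \<in> U" using V by blast
    have 1: "herm (v w) (y k w) = 0" by (simp add: y_def herm_diff herm_smult hv[OF wU] herm_right_j)
    have 2: "herm (right_j (v w)) (y k w) = 0" by (simp add: y_def herm_diff herm_smult hv[OF wU] herm_right_j)
    have 3: "herm (w3 w) (w3 w) = 1"
      using V(4)[OF w] herm_normalize by (simp add: w3_def)
    show "quat_columns (v w) (w3 w) \<in> Sp2"
      by (rule quat_columns_Sp2) (use hv[OF wU] 1 2 3 in \<open>simp_all add: w3_def herm_smult\<close>)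
    have "quat_columns (v w) (w3 w) *v axis 1 1 = v w"
      by (simp add: vec_eq_iff matrix_vector_axis_nth quat_columns_nth)
    then show "base_point (quat_columns (v w) (w3 w)) = \<phi> w" using lv[OF wU] by (simp add: base_point_def)
  qed
  then show ?thesis using that V(2) by blast
qed

lemma frame_stab:
  assumes "frame \<phi> U g" "smooth_on U s" "\<And>w. w \<in> U \<Longrightarrow> stab (s w)"
  shows "frame \<phi> U (\<lambda>w. g w ** s w)"
  unfolding frame_def
proof (intro conjI ballI)
  show "open U" using assms by (simp add: frame_def)
  then show "smooth_on U (\<lambda>w. g w ** s w)"
    using assms by (intro smooth_on_matrix_mult) (auto simp: frame_def)
  fix w assume w: "w \<in> U"
  show "g w ** s w \<in> Sp2" using assms(1) assms(3)[OF w] w by (auto simp: frame_def stab_def Sp2_mult)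
  note e = stab_entries[OF assms(3)[OF w]]
  have "s w *v axis 1 1 = (s w $1$1) *s axis 1 1"
    using e unfolding vec_eq_iff forall_4 matrix_vector_axis_nth by (simp add: axis_def)
  then have "(g w ** s w) *v axis 1 1 = (s w $1$1) *s (g w *v axis 1 1)"
    by (simp add: matrix_vector_mul_assoc[symmetric] matrix_vector_mult_smult)
  moreover have "s w $ 1 $ 1 \<noteq> 0" using e(14) by auto
  ultimately show "base_point (g w ** s w) = \<phi> w"
    using assms(1) w by (simp add: base_point_def line_scale frame_def)
qed

lemma frame_subset: "frame \<phi> U g \<Longrightarrow> open V \<Longrightarrow> V \<subseteq> U \<Longrightarrow> frame \<phi> V g"
  by (auto simp: frame_def intro: smooth_on_subset)

lemma adapted_frame_subset: "adapted_frame \<phi> U g \<Longrightarrow> open V \<Longrightarrow> V \<subseteq> U \<Longrightarrow> adapted_frame \<phi> V g"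
  by (auto simp: adapted_frame_def intro: frame_subset)

lemma smooth_on_mc: "frame \<phi> U g \<Longrightarrow> smooth_on U (\<lambda>z. mc g z v)"
  unfolding mc_def frame_def by (auto intro!: smooth_on_matrix_mult smooth_on_adj smooth_on_frechet)

lemma complex_as_combination: "v = Re v *\<^sub>R 1 + Im v *\<^sub>R \<i>"
  by (simp add: complex_eq_iff)

lemma mc_combination:
  assumes "frame \<phi> U g" "z \<in> U"
  shows "mc g z v $ r $ c = of_real (Re v) * mc g z 1 $ r $ c + of_real (Im v) * mc g z \<i> $ r $ c"
proof -
  note L = mc_linear[OF assms]
  have "mc g z v = Re v *\<^sub>R mc g z 1 + Im v *\<^sub>R mc g z \<i>"
    by (subst complex_as_combination[of v]) (simp only: linear_add[OF L] linear_cmul[OF L])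
  then show ?thesis by (simp add: scaleR_conv_of_real[where 'a=complex])
qed

text \<open>Entry (2,1) carries the conjugate of \<open>\<omega>3\<close>; hence it is conjugate
  linear in \<open>v\<close> where the other two are complex linear.\<close>

lemma J_holomorphic_mc:
  assumes "J_holomorphic \<phi>" "frame \<phi> U g" "z \<in> U"
  shows "mc g z v $ 3 $ 1 = v * mc g z 1 $ 3 $ 1" "mc g z v $ 4 $ 1 = v * mc g z 1 $ 4 $ 1"
    "mc g z v $ 2 $ 1 = cnj v * mc g z 1 $ 2 $ 1"
proof -
  have "is_J (mc g z 1) (mc g z (\<i> * 1))" using assms unfolding J_holomorphic_def by blast
  then have i: "mc g z \<i> $ 3 $ 1 = \<i> * mc g z 1 $ 3 $ 1" "mc g z \<i> $ 4 $ 1 = \<i> * mc g z 1 $ 4 $ 1"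
    "cnj (mc g z \<i> $ 2 $ 1) = \<i> * cnj (mc g z 1 $ 2 $ 1)"
    by (simp_all add: is_J_def \<omega>1_def \<omega>2_def \<omega>3_def)
  have i3: "mc g z \<i> $ 2 $ 1 = - \<i> * mc g z 1 $ 2 $ 1"
    using arg_cong[OF i(3), of cnj] by simp
  note v = mc_combination[OF assms(2,3), of v]
  have cv: "cnj v = of_real (Re v) - \<i> * of_real (Im v)" "v = of_real (Re v) + \<i> * of_real (Im v)"
    by (simp_all add: complex_eq_iff)
  show "mc g z v $ 3 $ 1 = v * mc g z 1 $ 3 $ 1" "mc g z v $ 4 $ 1 = v * mc g z 1 $ 4 $ 1"
    by (subst v, subst (3) cv(2), simp add: i algebra_simps)+
  show "mc g z v $ 2 $ 1 = cnj v * mc g z 1 $ 2 $ 1"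
    by (subst v, subst cv(1), simp add: i3 algebra_simps)
qed

section \<open>Adapted frames\<close>

text \<open>
  In an adapted frame the forms \<open>\<omega>\<^sub>1 / sqrt 2\<close>, \<open>cnj \<omega>\<^sub>3\<close> and \<open>\<tau>\<close> have the following values on the
  coordinate vector \<open>1\<close>.
\<close>

abbreviation coeff_p :: "(complex \<Rightarrow> complex^4^4) \<Rightarrow> complex \<Rightarrow> complex" where
  "coeff_p g z \<equiv> mc g z 1 $ 3 $ 1"

abbreviation coeff_c :: "(complex \<Rightarrow> complex^4^4) \<Rightarrow> complex \<Rightarrow> complex" where
  "coeff_c g z \<equiv> mc g z 1 $ 2 $ 1"

abbreviation coeff_t :: "(complex \<Rightarrow> complex^4^4) \<Rightarrow> complex \<Rightarrow> complex" where
  "coeff_t g z \<equiv> mc g z 1 $ 4 $ 3"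

lemma lie_entries:
  assumes "A \<in> lie_sp2"
  shows "A$1$2 = - cnj (A$2$1)" "A$2$2 = - A$1$1" "A$3$2 = - cnj (A$4$1)" "A$4$2 = cnj (A$3$1)"
    "A$1$3 = - cnj (A$3$1)" "A$1$4 = - cnj (A$4$1)" "A$2$3 = A$4$1" "A$2$4 = - A$3$1"
    "A$3$4 = - cnj (A$4$3)" "A$4$4 = - A$3$3" "cnj (A$1$1) = - A$1$1" "cnj (A$3$3) = - A$3$3"
proof -
  have a: "adj A = - A" and q: "quat A" using assms by (auto simp: lie_sp2_iff)
  have a': "cnj (A$c$r) = - A$r$c" for r c using arg_cong[OF a, of "\<lambda>B. B$r$c"] by (simp add: adj_nth)
  note q' = q[unfolded quat_iff]
  show "A$1$2 = - cnj (A$2$1)" "A$2$2 = - A$1$1" "A$3$2 = - cnj (A$4$1)" "A$4$2 = cnj (A$3$1)"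
    "A$3$4 = - cnj (A$4$3)" "A$4$4 = - A$3$3" "cnj (A$1$1) = - A$1$1" "cnj (A$3$3) = - A$3$3"
    using q' a'[of 1 1] a'[of 3 3] by simp_all
  show "A$1$3 = - cnj (A$3$1)" "A$1$4 = - cnj (A$4$1)" using a'[of 3 1] a'[of 4 1] by simp_all
  show "A$2$3 = A$4$1" using a'[of 3 2] q' by simp
  show "A$2$4 = - A$3$1" using a'[of 4 2] q' by simp
qed

text \<open>\<open>frame_transition\<close> read in the other direction: the transition
  \<open>s\<close> is prescribed and the new frame is built from it.\<close>

lemma mc_stab:
  assumes "frame \<phi> U g" "z \<in> U" "smooth_on U s" "\<And>w. w \<in> U \<Longrightarrow> stab (s w)"
  shows "mc (\<lambda>w. g w ** s w) z v = adj (s z) ** (mc g z v ** s z + frechet_derivative s (at z) v)"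
    "\<And>r. r \<noteq> 1 \<Longrightarrow> frechet_derivative s (at z) v $ r $ 1 = 0"
proof -
  have f: "frame \<phi> U (\<lambda>w. g w ** s w)" by (rule frame_stab[OF assms(1,3,4)])
  have U: "open U" using assms by (simp add: frame_def)
  have eq: "adj (g w) ** (g w ** s w) = s w" if "w \<in> U" for w
    using assms(1) that by (auto simp: frame_def Sp2_cancel)
  have "((\<lambda>w. adj (g w) ** (g w ** s w)) has_derivative frechet_derivative s (at z)) (at z)"
    by (rule has_derivative_transform_within_open[OF smooth_on_has_derivative[OF U assms(3,2)] U assms(2)])
      (simp add: eq)
  then have d: "frechet_derivative (\<lambda>w. adj (g w) ** (g w ** s w)) (at z) = frechet_derivative s (at z)"
    by (rule frechet_derivative_at[symmetric])
  note t = frame_transition[OF assms(1) f assms(2,2), unfolded d eq[OF assms(2)]]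
  show "mc (\<lambda>w. g w ** s w) z v = adj (s z) ** (mc g z v ** s z + frechet_derivative s (at z) v)"
    by (fact t(3))
  show "\<And>r. r \<noteq> 1 \<Longrightarrow> frechet_derivative s (at z) v $ r $ 1 = 0" by (fact t(4))
qed

lemma stab_quat_columns:
  assumes "cnj l * l = 1" "cnj a * a + cnj b * b = 1"
  shows "stab (quat_columns (vector [l, 0, 0, 0]) (vector [0, 0, a, b]))"
proof -
  have "quat_columns (vector [l, 0, 0, 0]) (vector [0, 0, a, b]) \<in> Sp2"
    by (rule quat_columns_Sp2) (use assms in \<open>simp_all add: herm_def vector_4 right_j_nth\<close>)
  then show ?thesis by (simp add: stab_def quat_columns_nth vector_4)
qed

lemma smooth_on_vector4:
  assumes "open U" "smooth_on U a" "smooth_on U b" "smooth_on U c" "smooth_on U d"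
  shows "smooth_on U (\<lambda>x. vector [a x, b x, c x, d x] :: complex^4)"
proof (rule smooth_on_vec_lambda[OF assms(1)])
  fix i :: 4
  show "smooth_on U (\<lambda>x. (vector [a x, b x, c x, d x] :: complex^4) $ i)"
    using exhaust_4[of i] assms by (auto simp: vector_4)
qed

lemma mult_cnj_eq_cmod: "cnj z * z = of_real ((cmod z)\<^sup>2)" 
  by (simp add: complex_norm_square mult.commute flip: of_real_power)

text \<open>Justifies the \<open>THE\<close> in \<open>g_H\<close>: by \<open>frame_change\<close>
  another frame alters the two horizontal components by a unit scalar and a unitary matrix.\<close>

lemma g_H_frame:
  assumes "frame \<phi> U g" "z \<in> U"
  shows "g_H \<phi> z v = 2 * ((cmod (mc g z v $ 3 $ 1))\<^sup>2 + (cmod (mc g z v $ 4 $ 1))\<^sup>2)"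
proof -
  have eq: "(cmod (\<omega>1 A))\<^sup>2 + (cmod (\<omega>2 A))\<^sup>2 = 2 * ((cmod (A $ 3 $ 1))\<^sup>2 + (cmod (A $ 4 $ 1))\<^sup>2)" for A
    by (simp add: \<omega>1_def \<omega>2_def norm_mult power_mult_distrib)
  show ?thesis
    unfolding g_H_def eq
  proof (rule the_equality)
    show "\<exists>U' g'. frame \<phi> U' g' \<and> z \<in> U' \<and> 2 * ((cmod (mc g z v $ 3 $ 1))\<^sup>2 + (cmod (mc g z v $ 4 $ 1))\<^sup>2) =
      2 * ((cmod (mc g' z v $ 3 $ 1))\<^sup>2 + (cmod (mc g' z v $ 4 $ 1))\<^sup>2)" using assms by blast
    fix r assume "\<exists>U g. frame \<phi> U g \<and> z \<in> U \<and> r = 2 * ((cmod (mc g z v $ 3 $ 1))\<^sup>2 + (cmod (mc g z v $ 4 $ 1))\<^sup>2)"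
    then obtain V h where h: "frame \<phi> V h" "z \<in> V" "r = 2 * ((cmod (mc h z v $ 3 $ 1))\<^sup>2 + (cmod (mc h z v $ 4 $ 1))\<^sup>2)"
      by blast
    define x y where "x = mc g z v $ 3 $ 1" and "y = mc g z v $ 4 $ 1"
    obtain l a b where lab: "cnj l * l = 1" "cnj a * a + cnj b * b = 1"
      "mc h z v $ 3 $ 1 = l * (cnj a * x + cnj b * y)" "mc h z v $ 4 $ 1 = l * (- b * x + a * y)"
      unfolding x_def y_def using frame_change[OF assms(1) h(1) assms(2) h(2)] by metis
    have "cnj (l * (cnj a * x + cnj b * y)) * (l * (cnj a * x + cnj b * y)) + cnj (l * (- b * x + a * y)) * (l * (- b * x + a * y))
      = (cnj l * l) * ((cnj a * a + cnj b * b) * (cnj x * x + cnj y * y))"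
      by (simp add: algebra_simps)
    then have "of_real ((cmod (mc h z v $ 3 $ 1))\<^sup>2 + (cmod (mc h z v $ 4 $ 1))\<^sup>2) = complex_of_real ((cmod x)\<^sup>2 + (cmod y)\<^sup>2)"
      unfolding lab(1,2) lab(3,4)[symmetric] by (simp only: mult_cnj_eq_cmod of_real_add mult_1)
    then show "r = 2 * ((cmod (mc g z v $ 3 $ 1))\<^sup>2 + (cmod (mc g z v $ 4 $ 1))\<^sup>2)"
      unfolding of_real_eq_iff by (simp add: h(3) x_def y_def)
  qed
qed

context
  fixes \<phi> :: "complex \<Rightarrow> cp3"
  assumes J: "J_holomorphic \<phi>" and tr: "transverse \<phi>"
begin

text \<open>As \<open>\<omega>2\<close> vanishes, a zero of \<open>\<omega>1\<close> would be a
  vertical tangent; a zero of \<open>\<omega>3\<close> would be a horizontal one. The rest is the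
  type of the forms.\<close>

lemma adapted_coeffs:
  assumes "adapted_frame \<phi> U g" "z \<in> U"
  shows "coeff_p g z \<noteq> 0" "coeff_c g z \<noteq> 0" "mc g z v $ 4 $ 1 = 0" "mc g z v $ 3 $ 1 = v * coeff_p g z"
    "mc g z v $ 2 $ 1 = cnj v * coeff_c g z"
proof -
  have f: "frame \<phi> U g" using assms by (simp add: adapted_frame_def)
  note j = J_holomorphic_mc[OF J f assms(2)]
  show z41: "mc g z v $ 4 $ 1 = 0" for v using assms by (simp add: adapted_frame_def \<omega>2_def)
  show "mc g z v $ 3 $ 1 = v * coeff_p g z" "mc g z v $ 2 $ 1 = cnj v * coeff_c g z" by (fact j(1), fact j(3))
  show "coeff_p g z \<noteq> 0"
  proof
    assume "coeff_p g z = 0"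
    then have "mc g z v $ 3 $ 1 = 0" for v using j(1)[of v] by simp
    then have "\<forall>v. \<omega>1 (mc g z v) = 0 \<and> \<omega>2 (mc g z v) = 0" using z41 by (simp add: \<omega>1_def \<omega>2_def)
    then show False using tr f assms(2) unfolding transverse_def tangent_vertical_def by blast
  qed
  show "coeff_c g z \<noteq> 0"
  proof
    assume "coeff_c g z = 0"
    then have "mc g z v $ 2 $ 1 = 0" for v using j(3)[of v] by simp
    then have "\<forall>v. \<omega>3 (mc g z v) = 0" by (simp add: \<omega>3_def)
    then show False using tr f assms(2) unfolding transverse_def tangent_horizontal_def by blast
  qed
qed

lemma g_H_adapted:
  assumes "adapted_frame \<phi> U g" "z \<in> U"
  shows "g_H \<phi> z v = 2 * (cmod (coeff_p g z))\<^sup>2 * (cmod v)\<^sup>2"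
  using g_H_frame[of \<phi> U g z v] adapted_coeffs(3,4)[OF assms, of v] assms
  by (simp add: adapted_frame_def norm_mult power_mult_distrib)

text \<open>The pair of horizontal components is nonzero because the curve is nowhere vertical. Its
  normalisation \<open>u\<close> is taken as second quaternionic column of a stabiliser element,
  which turns the pair into the \<open>\<omega>1\<close> direction.\<close>

lemma adapted_frame_exists:
  obtains U g where "adapted_frame \<phi> U g" "z \<in> U"
proof -
  obtain U g where f: "frame \<phi> U g" "z \<in> U" using frame_exists J unfolding J_holomorphic_def by blast
  have U: "open U" using f by (simp add: frame_def)
  define y where "y w = (vector [0, 0, mc g w 1 $ 3 $ 1, mc g w 1 $ 4 $ 1] :: complex^4)" for w
  have y0: "y w \<noteq> 0" if "w \<in> U" for w
  proof
    assume y0: "y w = 0"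
    have "y w $ 3 = 0" "y w $ 4 = 0" unfolding y0 by simp_all
    then have "mc g w 1 $ 3 $ 1 = 0" "mc g w 1 $ 4 $ 1 = 0" by (simp_all add: y_def vector_4)
    then have "mc g w v $ 3 $ 1 = 0" "mc g w v $ 4 $ 1 = 0" for v
      using J_holomorphic_mc(1,2)[OF J f(1) that, of v] by simp_all
    then have "\<forall>v. \<omega>1 (mc g w v) = 0 \<and> \<omega>2 (mc g w v) = 0" by (simp add: \<omega>1_def \<omega>2_def)
    then show False using tr f that unfolding transverse_def tangent_vertical_def by blast
  qed
  have sy: "smooth_on U y"
    unfolding y_def
    by (intro smooth_on_vector4 U smooth_on_const smooth_on_vec_nth smooth_on_mc[OF f(1)])
  define u where "u w = (1 / of_real (norm (y w)) :: complex) *s y w" for w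
  have su: "smooth_on U u" unfolding u_def by (intro smooth_on_normalize U sy y0)
  have u34: "u w $ 1 = 0" "u w $ 2 = 0" for w by (simp_all add: u_def y_def vector_4)
  have uv: "u w = vector [0, 0, u w $ 3, u w $ 4]" for w
    by (simp add: vec_eq_iff forall_4 vector_4 u34)
  define s where "s w = quat_columns (vector [1, 0, 0, 0]) (u w)" for w
  have st: "stab (s w)" if "w \<in> U" for w
  proof -
    have "cnj (u w $ 3) * u w $ 3 + cnj (u w $ 4) * u w $ 4 = 1"
      using herm_normalize[OF y0[OF that]] by (simp add: herm_def u34 flip: u_def)
    then show ?thesis unfolding s_def by (subst uv) (rule stab_quat_columns, simp_all)
  qed
  have ss: "smooth_on U s" unfolding s_def by (intro smooth_on_quat_columns U su smooth_on_const)
  have "adapted_frame \<phi> U (\<lambda>w. g w ** s w)"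
    unfolding adapted_frame_def
  proof (intro conjI ballI allI frame_stab f(1) ss st)
    fix w v assume w: "w \<in> U"
    note e = stab_entries[OF st[OF w]]
    have D: "frechet_derivative s (at w) v $ 2 $ 1 = 0" "frechet_derivative s (at w) v $ 3 $ 1 = 0"
      "frechet_derivative s (at w) v $ 4 $ 1 = 0" using mc_stab(2)[OF f(1) w ss st] by simp_all
    have "s w $ 3 $ 3 * mc g w 1 $ 4 $ 1 = s w $ 4 $ 3 * mc g w 1 $ 3 $ 1"
      by (simp add: s_def quat_columns_nth u_def y_def vector_4)
    then have "s w $ 3 $ 3 * mc g w v $ 4 $ 1 = s w $ 4 $ 3 * mc g w v $ 3 $ 1"
      using J_holomorphic_mc(1,2)[OF J f(1) w, of v] by (simp add: algebra_simps)
    moreover have "s w $ 1 $ 1 = 1" by (simp add: s_def quat_columns_nth vector_4)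
    ultimately show "\<omega>2 (mc (\<lambda>w. g w ** s w) w v) = 0"
      by (simp add: \<omega>2_def mc_stab(1)[OF f(1) w ss st] matrix_mult_nth adj_nth e(1-13) D)
  qed
  then show ?thesis using that f(2) by blast
qed

text \<open>A transition with entry \<open>b = s $ 4 $ 3\<close> would produce a multiple of
  \<open>b * \<omega>1\<close> in \<open>\<omega>2\<close>, and both frames have
  \<open>\<omega>2 = 0\<close>; so \<open>b\<close> vanishes on the whole overlap, together with its
  derivative. What remains is the torus of diagonal elements, acting by phases even on
  \<open>\<tau>\<close>.\<close>

lemma adapted_change:
  assumes "adapted_frame \<phi> U g" "adapted_frame \<phi> V h" "z \<in> U" "z \<in> V"
  obtains s where "stab s" "s $ 4 $ 3 = 0" "h z = g z ** s"
    "coeff_p h z = cnj (s$3$3) * s$1$1 * coeff_p g z" "coeff_c h z = (s$1$1)\<^sup>2 * coeff_c g z"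
    "coeff_t h z = (s$3$3)\<^sup>2 * coeff_t g z"
proof -
  have f: "frame \<phi> U g" "frame \<phi> V h" using assms by (auto simp: adapted_frame_def)
  define s where "s w = adj (g w) ** h w" for w
  define W where "W = U \<inter> V"
  have W: "open W" "z \<in> W" using assms f by (auto simp: W_def frame_def)
  note t = frame_transition[OF f, folded s_def]
  have s43: "s w $ 4 $ 3 = 0" if "w \<in> W" for w
  proof -
    have w: "w \<in> U" "w \<in> V" using that by (auto simp: W_def)
    note e = stab_entries[OF t(2)[OF w]]
    have D: "frechet_derivative s (at w) 1 $ 2 $ 1 = 0" "frechet_derivative s (at w) 1 $ 3 $ 1 = 0"
      "frechet_derivative s (at w) 1 $ 4 $ 1 = 0" using t(4)[OF w] by (simp_all add: s_def[abs_def])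
    have "mc h w 1 $ 4 $ 1 = 0" by (rule adapted_coeffs(3)[OF assms(2) w(2)])
    moreover have "mc g w 1 $ 4 $ 1 = 0" by (rule adapted_coeffs(3)[OF assms(1) w(1)])
    moreover have "s w $ 1 $ 1 \<noteq> 0" using e(14) by auto
    moreover have "mc h w 1 = adj (s w) ** (mc g w 1 ** s w + frechet_derivative s (at w) 1)"
      using t(3)[OF w, of 1] by (simp add: s_def[abs_def])
    ultimately show ?thesis
      using adapted_coeffs(1)[OF assms(1) w(1)] by (simp add: matrix_mult_nth adj_nth e(1-13) D)
  qed
  have sd: "(s has_derivative frechet_derivative s (at z)) (at z)"
    using t(5)[OF assms(3,4)] by (simp add: s_def[abs_def])
  have D43: "frechet_derivative s (at z) 1 $ 4 $ 3 = 0"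
  proof -
    have "((\<lambda>w. s w $ 4 $ 3) has_derivative (\<lambda>v. frechet_derivative s (at z) v $ 4 $ 3)) (at z)"
      by (rule bounded_linear.has_derivative[OF bounded_linear_entry sd])
    moreover have "((\<lambda>w. s w $ 4 $ 3) has_derivative (\<lambda>v. 0)) (at z)"
      by (rule has_derivative_transform_within_open[OF has_derivative_const[of 0] W]) (simp add: s43)
    ultimately have "(\<lambda>v. frechet_derivative s (at z) v $ 4 $ 3) = (\<lambda>v. 0)" by (rule has_derivative_unique)
    from fun_cong[OF this, of 1] show ?thesis by simp
  qed
  have D: "frechet_derivative s (at z) 1 $ 2 $ 1 = 0" "frechet_derivative s (at z) 1 $ 3 $ 1 = 0"
      "frechet_derivative s (at z) 1 $ 4 $ 1 = 0" using t(4)[OF assms(3,4)] by (simp_all add: s_def[abs_def])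
  have st: "stab (s z)" by (rule t(2)[OF assms(3,4)])
  note e = stab_entries[OF st]
  have mch: "mc h z 1 = adj (s z) ** (mc g z 1 ** s z + frechet_derivative s (at z) 1)"
    using t(3)[OF assms(3,4), of 1] by (simp add: s_def[abs_def])
  have g41: "mc g z 1 $ 4 $ 1 = 0" by (rule adapted_coeffs(3)[OF assms(1,3)])
  show ?thesis
  proof (rule that[of "s z"])
    show "stab (s z)" by (fact st)
    show "s z $ 4 $ 3 = 0" by (rule s43[OF W(2)])
    show "h z = g z ** s z" by (rule t(1)[OF assms(3,4)])
    show "coeff_p h z = cnj (s z$3$3) * s z$1$1 * coeff_p g z"
      by (simp add: mch matrix_mult_nth adj_nth e(1-13) D s43[OF W(2)])
    show "coeff_c h z = (s z$1$1)\<^sup>2 * coeff_c g z"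
      by (simp add: mch matrix_mult_nth adj_nth e(1-13) D s43[OF W(2)] power2_eq_square)
    show "coeff_t h z = (s z$3$3)\<^sup>2 * coeff_t g z"
      by (simp add: mch matrix_mult_nth adj_nth e(1-13) D43 s43[OF W(2)] power2_eq_square)
  qed
qed

text \<open>The phases \<open>l\<close>, \<open>m\<close> of the diagonal torus have to solve
  \<open>l^2 * coeff_c g = C\<close> and \<open>cnj m * l * coeff_p g = P\<close>; the hypotheses on
  moduli make the solutions unimodular.\<close>

lemma gauge:
  assumes "adapted_frame \<phi> U g" "z \<in> U" "smooth_on U P" "smooth_on U C"
    "\<And>w. w \<in> U \<Longrightarrow> cmod (P w) = cmod (coeff_p g w)" "\<And>w. w \<in> U \<Longrightarrow> cmod (C w) = cmod (coeff_c g w)"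
  obtains V h where "adapted_frame \<phi> V h" "z \<in> V" "V \<subseteq> U"
    "\<And>w. w \<in> V \<Longrightarrow> coeff_p h w = P w" "\<And>w. w \<in> V \<Longrightarrow> coeff_c h w = C w"
proof -
  have f: "frame \<phi> U g" using assms by (simp add: adapted_frame_def)
  have U: "open U" using f by (simp add: frame_def)
  note a = adapted_coeffs[OF assms(1)]
  define r where "r w = C w / coeff_c g w" for w
  have r1: "cmod (r w) = 1" if "w \<in> U" for w
    using assms(6)[OF that] a(2)[OF that] by (simp add: r_def norm_divide)
  have sc: "smooth_on U (\<lambda>w. mc g w 1 $ i $ j)" for i j
    by (intro smooth_on_vec_nth smooth_on_mc[OF f] U)
  have sr: "smooth_on U r" unfolding r_def by (rule smooth_on_divide[OF U assms(4) sc a(2)])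
  \<comment> \<open>Division by the value at \<open>z\<close> moves the ratio to 1, where a smooth
    square root exists; \<open>V\<close> is the region on which it avoids the cut.\<close>
  define k where "k w = r w / r z" for w
  have rz: "r z \<noteq> 0" using r1[OF assms(2)] by auto
  have sk: "smooth_on U k" unfolding k_def by (rule smooth_on_divide[OF U sr smooth_on_const[OF U] rz])
  define V where "V = U \<inter> k -` (- \<real>\<^sub>\<le>\<^sub>0)"
  have V: "open V" "V \<subseteq> U"
    using continuous_open_preimage[OF smooth_on_continuous[OF sk] U, of "- \<real>\<^sub>\<le>\<^sub>0"] closed_nonpos_Reals_complex
    by (auto simp: V_def open_Compl)
  have zV: "z \<in> V" using assms(2) rz by (simp add: V_def k_def)
  define l where "l w = csqrt (r z) * csqrt (k w)" for w
  have sl: "smooth_on V l" unfolding l_def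
  proof (intro smooth_on_mult V(1) smooth_on_const)
    show "smooth_on V (\<lambda>w. csqrt (k w))"
    proof (rule smooth_on_holomorphic_compose[where V="- \<real>\<^sub>\<le>\<^sub>0" and h=csqrt])
      show "csqrt holomorphic_on - \<real>\<^sub>\<le>\<^sub>0" by (intro holomorphic_on_csqrt)
      show "smooth_on V k" by (rule smooth_on_subset[OF sk V(2)])
    qed (use V(1) in \<open>auto simp: V_def\<close>)
  qed
  have l2: "(l w)\<^sup>2 = r w" for w using rz by (simp add: l_def power_mult_distrib k_def)
  have l1: "cmod (l w) = 1" if "w \<in> U" for w
    using arg_cong[OF l2[of w], of cmod] r1[OF that] norm_ge_zero[of "l w"]
    by (simp add: norm_power power2_eq_1_iff)
  have l0: "l w \<noteq> 0" if "w \<in> U" for w using l1[OF that] by auto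
  define m where "m w = cnj (P w / (l w * coeff_p g w))" for w
  have m1: "cmod (m w) = 1" if "w \<in> U" for w
    using assms(5)[OF that] a(1)[OF that] l1[OF that] by (simp add: m_def norm_divide norm_mult)
  have sm: "smooth_on V m" unfolding m_def
  proof (intro smooth_on_cnj smooth_on_divide smooth_on_mult V(1) sl)
    show "smooth_on V P" "smooth_on V (coeff_p g)" using assms(3) sc V(2) smooth_on_subset by blast+
    show "l x * coeff_p g x \<noteq> 0" if "x \<in> V" for x using l0 a(1) V(2) that by auto
  qed
  define s where "s w = quat_columns (vector [l w, 0, 0, 0]) (vector [0, 0, m w, 0])" for w
  have ss: "smooth_on V s" unfolding s_def
    by (intro smooth_on_quat_columns smooth_on_vector4 smooth_on_const V(1) sl sm)
  have st: "stab (s w)" if "w \<in> V" for w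
    unfolding s_def using l1 m1 V(2) that by (intro stab_quat_columns) (auto simp: mult_cnj_eq_cmod)
  have fV: "frame \<phi> V g" by (rule frame_subset[OF f V])
  have ent: "s w $ 1 $ 1 = l w" "s w $ 3 $ 3 = m w" "s w $ 4 $ 3 = 0" for w
    by (simp_all add: s_def quat_columns_nth vector_4)
  have D: "frechet_derivative s (at w) v $ 2 $ 1 = 0" "frechet_derivative s (at w) v $ 3 $ 1 = 0"
      "frechet_derivative s (at w) v $ 4 $ 1 = 0" if "w \<in> V" for w v
    using mc_stab(2)[OF fV that ss st] by simp_all
  let ?h = "\<lambda>w. g w ** s w"
  show ?thesis
  proof (rule that[of V ?h])
    show "adapted_frame \<phi> V ?h"
      unfolding adapted_frame_def
    proof (intro conjI ballI allI frame_stab fV ss st)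
      fix w v assume w: "w \<in> V"
      note e = stab_entries[OF st[OF w]]
      have "mc g w v $ 4 $ 1 = 0" using a(3) w V(2) by blast
      then show "\<omega>2 (mc ?h w v) = 0"
        by (simp add: \<omega>2_def mc_stab(1)[OF fV w ss st] matrix_mult_nth adj_nth e(1-13) D[OF w] ent)
    qed
    fix w assume w: "w \<in> V"
    note e = stab_entries[OF st[OF w]]
    have wU: "w \<in> U" using w V(2) by blast
    have "coeff_p ?h w = cnj (m w) * (coeff_p g w * l w)"
      using a(3)[OF wU] by (simp add: mc_stab(1)[OF fV w ss st] matrix_mult_nth adj_nth e(1-13) D[OF w] ent)
    then show "coeff_p ?h w = P w" using l0[OF wU] a(1)[OF wU] by (simp add: m_def)
    have "coeff_c ?h w = (l w)\<^sup>2 * coeff_c g w"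
      by (simp add: mc_stab(1)[OF fV w ss st] matrix_mult_nth adj_nth e(1-13) D[OF w] ent power2_eq_square)
    then show "coeff_c ?h w = C w" using a(2)[OF wU] by (simp add: l2 r_def)
  qed (use zV V in auto)
qed

end

section \<open>The structure equations\<close>

lemma mc_entry_derivative:
  assumes "frame \<phi> U g" "z \<in> U"
  shows "((\<lambda>w. mc g w v $ r $ c) has_derivative (\<lambda>u. frechet_derivative (\<lambda>w. mc g w v) (at z) u $ r $ c)) (at z)"
  by (rule bounded_linear.has_derivative[OF bounded_linear_entry
        smooth_on_has_derivative[OF _ smooth_on_mc[OF assms(1)] assms(2)]])
    (use assms in \<open>simp add: frame_def\<close>)

text \<open>The equation \<open>d\<omega> + \<omega> \<and> \<omega> = 0\<close> for the full form,
  evaluated on 1 and i: insert \<open>dg = g * mc\<close> into the two mixed second derivatives of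
  \<open>g\<close>, compare, and cancel \<open>g\<close>.\<close>

lemma maurer_cartan_equation:
  assumes "frame \<phi> U g" "z \<in> U"
  shows "frechet_derivative (\<lambda>w. mc g w 1) (at z) \<i> - frechet_derivative (\<lambda>w. mc g w \<i>) (at z) 1
    = mc g z 1 ** mc g z \<i> - mc g z \<i> ** mc g z 1"
proof -
  have U: "open U" "smooth_on U g" "g z \<in> Sp2" using assms by (auto simp: frame_def)
  define D where "D v = frechet_derivative (\<lambda>w. mc g w v) (at z)" for v
  have fg: "frechet_derivative g (at w) v = g w ** mc g w v" if "w \<in> U" for w v
    using frechet_derivative_at[OF frame_derivative[OF assms(1) that]] by metis
  have "frechet_derivative (\<lambda>w. frechet_derivative g (at w) v) (at z) u = g z ** D v u + (g z ** mc g z u) ** mc g z v" for u v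
  proof -
    have "((\<lambda>w. mc g w v) has_derivative D v) (at z)"
      unfolding D_def by (rule smooth_on_has_derivative[OF U(1) smooth_on_mc[OF assms(1)] assms(2)])
    then have "((\<lambda>w. g w ** mc g w v) has_derivative (\<lambda>u. g z ** D v u + (g z ** mc g z u) ** mc g z v)) (at z)"
      by (rule bounded_bilinear.FDERIV[OF bounded_bilinear_matrix_mult frame_derivative[OF assms]])
    then have "((\<lambda>w. frechet_derivative g (at w) v) has_derivative (\<lambda>u. g z ** D v u + (g z ** mc g z u) ** mc g z v)) (at z)"
      by (rule has_derivative_transform_within_open[OF _ U(1) assms(2)]) (simp add: fg)
    from fun_cong[OF frechet_derivative_at[OF this], of u] show ?thesis by simp
  qed
  then have "g z ** D 1 \<i> + (g z ** mc g z \<i>) ** mc g z 1 = g z ** D \<i> 1 + (g z ** mc g z 1) ** mc g z \<i>"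
    using mixed_partials[OF U(1) assms(2) U(2)] by simp
  then have "g z ** (D 1 \<i> + mc g z \<i> ** mc g z 1) = g z ** (D \<i> 1 + mc g z 1 ** mc g z \<i>)"
    by (simp add: matrix_add_ldistrib matrix_mul_assoc)
  then have "D 1 \<i> + mc g z \<i> ** mc g z 1 = D \<i> 1 + mc g z 1 ** mc g z \<i>"
    using Sp2_cancel(1)[OF U(3)] by metis
  then show ?thesis by (simp add: D_def algebra_simps)
qed

text \<open>\<open>D 1 + \<i> * D \<i>\<close> is twice the d-bar derivative, the shape in which the
  structure equations deliver it.\<close>

lemma CR_imp_field_derivative:
  fixes f :: "complex \<Rightarrow> complex"
  assumes "(f has_derivative D) (at z)" "D 1 + \<i> * D \<i> = 0"
  shows "(f has_field_derivative D 1) (at z)"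
proof -
  have L: "linear D" using assms(1) by (rule has_derivative_linear)
  have "D \<i> = \<i> * D 1" using arg_cong[OF assms(2), of "\<lambda>x. - \<i> * x"] by (simp add: algebra_simps)
  then have "D v = D 1 * v" for v
    by (subst complex_as_combination[of v])
      (simp only: linear_add[OF L] linear_cmul[OF L], simp add: scaleR_conv_of_real complex_eq_iff)
  then have "D = (*) (D 1)" by (rule ext)
  then show ?thesis using assms(1) by (simp add: has_field_derivative_def)
qed

lemma field_derivative_imp_CR:
  assumes "(f has_derivative D) (at z)" "(f has_field_derivative d) (at z)"
  shows "D 1 + \<i> * D \<i> = 0"
proof -
  have "D = (*) d" using assms by (metis has_derivative_unique has_field_derivative_def)
  then show ?thesis by (simp add: algebra_simps)
qed

text \<open>An imaginary-valued 1-form vanishes as soon as its (0,1) part does; \<open>a\<close> and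
  \<open>b\<close> are its values on 1 and i.\<close>

lemma imaginary_combination_zero:
  assumes "cnj a = - a" "cnj b = - b" "a + \<i> * b = 0"
  shows "a = 0" "b = 0"
proof -
  have "Re a = 0" "Re b = 0" using assms(1,2) by (auto simp: complex_eq_iff)
  then show "a = 0" "b = 0" using assms(3) by (auto simp: complex_eq_iff)
qed

text \<open>The local functions are unique up to unimodular constants, so \<open>f' / f\<close> is
  globally defined: it is the Wirtinger derivative of \<open>ln N\<close>, called \<open>P\<close>
  below. The exponential of a primitive of \<open>P\<close> has the right modulus up to a locally
  constant factor.\<close>

lemma local_modulus_global:
  fixes N :: "complex \<Rightarrow> real"
  assumes "\<And>z. \<exists>V f. open V \<and> z \<in> V \<and> f holomorphic_on V \<and> (\<forall>w\<in>V. f w \<noteq> 0 \<and> N w = (cmod (f w))\<^sup>2)"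
  obtains e where "e holomorphic_on UNIV" "\<And>z. e z \<noteq> 0" "\<And>z. N z = (cmod (e z))\<^sup>2"
proof -
  define D where "D z = frechet_derivative N (at z)" for z
  define P where "P z = (of_real (D z 1) - \<i> * of_real (D z \<i>)) / of_real (2 * N z)" for z
  have loc: "\<exists>V f. open V \<and> z \<in> V \<and> f holomorphic_on V \<and> (\<forall>w\<in>V. f w \<noteq> 0 \<and> N w = (cmod (f w))\<^sup>2 \<and> P w = deriv f w / f w)" for z
  proof -
    obtain V f where V: "open V" "z \<in> V" "f holomorphic_on V" "\<And>w. w \<in> V \<Longrightarrow> f w \<noteq> 0" "\<And>w. w \<in> V \<Longrightarrow> N w = (cmod (f w))\<^sup>2"
      using assms[of z] by metis
    have "P w = deriv f w / f w" if w: "w \<in> V" for w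
    proof -
      have f': "(f has_derivative (\<lambda>v. deriv f w * v)) (at w)"
        using holomorphic_derivI[OF V(3,1) w] by (simp add: has_field_derivative_def)
      have "((\<lambda>x. (Re (f x))\<^sup>2 + (Im (f x))\<^sup>2) has_derivative
          (\<lambda>v. 2 * Re (f w) * Re (deriv f w * v) + 2 * Im (f w) * Im (deriv f w * v))) (at w)"
        by (rule has_derivative_eq_rhs, (rule derivative_intros f')+)
          (simp add: fun_eq_iff algebra_simps)
      then have "(N has_derivative (\<lambda>v. 2 * Re (f w) * Re (deriv f w * v) + 2 * Im (f w) * Im (deriv f w * v))) (at w)"
        by (rule has_derivative_transform_within_open[OF _ V(1) w]) (simp add: V(5) cmod_power2)
      then have "D w = (\<lambda>v. 2 * Re (f w) * Re (deriv f w * v) + 2 * Im (f w) * Im (deriv f w * v))"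
        unfolding D_def by (rule frechet_derivative_at[symmetric])
      then have "of_real (D w 1) - \<i> * of_real (D w \<i>) = 2 * cnj (f w) * deriv f w"
        by (simp add: complex_eq_iff algebra_simps)
      moreover have "complex_of_real (2 * N w) = 2 * cnj (f w) * f w"
        by (simp add: V(5)[OF w] mult_cnj_eq_cmod mult.assoc)
      ultimately show ?thesis using V(4)[OF w] by (simp add: P_def)
    qed
    then show ?thesis using V by blast
  qed
  have "P field_differentiable (at z)" for z
  proof -
    obtain V f where V: "open V" "z \<in> V" "f holomorphic_on V" "\<forall>w\<in>V. f w \<noteq> 0 \<and> N w = (cmod (f w))\<^sup>2 \<and> P w = deriv f w / f w"
      using loc by metis
    have "(\<lambda>w. deriv f w / f w) holomorphic_on V"
      using V by (intro holomorphic_on_divide holomorphic_deriv) auto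
    then have "P holomorphic_on V" by (rule holomorphic_transform) (use V(4) in auto)
    then show ?thesis using V(1,2) holomorphic_on_imp_differentiable_at by blast
  qed
  then have Phol: "P holomorphic_on UNIV" by (simp add: holomorphic_on_def)
  obtain L where L: "\<And>z. (L has_field_derivative P z) (at z)"
    using holomorphic_convex_primitive'[OF convex_UNIV open_UNIV Phol] by auto
  define e0 where "e0 z = exp (L z)" for z
  have e0': "(e0 has_field_derivative P z * e0 z) (at z)" for z
    unfolding e0_def by (auto intro!: derivative_eq_intros L)
  have e0: "e0 z \<noteq> 0" for z by (simp add: e0_def)
  define R where "R z = N z / (cmod (e0 z))\<^sup>2" for z
  have "(R has_derivative (\<lambda>v. 0)) (at z)" for z
  proof -
    obtain V f where V: "open V" "z \<in> V" "f holomorphic_on V" "\<forall>w\<in>V. f w \<noteq> 0 \<and> N w = (cmod (f w))\<^sup>2 \<and> P w = deriv f w / f w"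
      using loc by metis
    obtain r where r: "r > 0" "ball z r \<subseteq> V" using V(1,2) open_contains_ball by blast
    have "((\<lambda>x. f x / e0 x) has_derivative (\<lambda>v. 0)) (at w within ball z r)" if "w \<in> ball z r" for w
    proof -
      have w: "w \<in> V" using that r by blast
      have "((\<lambda>x. f x / e0 x) has_field_derivative (deriv f w * e0 w - f w * (P w * e0 w)) / (e0 w * e0 w)) (at w)"
        by (rule DERIV_divide[OF holomorphic_derivI[OF V(3,1) w] e0' e0])
      moreover have "deriv f w * e0 w - f w * (P w * e0 w) = 0" using V(4) w by simp
      ultimately have "((\<lambda>x. f x / e0 x) has_field_derivative 0) (at w)" by simp
      from has_field_derivative_imp_has_derivative[OF this] show ?thesis
        unfolding lambda_zero by (rule has_derivative_at_withinI)
    qed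
    then have "\<exists>c. \<forall>w\<in>ball z r. f w / e0 w = c"
      by (intro has_derivative_zero_constant convex_ball)
    then obtain c where c: "\<And>w. w \<in> ball z r \<Longrightarrow> f w / e0 w = c" by blast
    have "R w = (cmod c)\<^sup>2" if "w \<in> ball z r" for w
    proof -
      have "N w = (cmod (f w))\<^sup>2" using V(4) r(2) that by blast
      then have "R w = (cmod (f w / e0 w))\<^sup>2" by (simp add: R_def norm_divide power_divide)
      then show ?thesis by (simp only: c[OF that])
    qed
    then show ?thesis
      using has_derivative_transform_within_open[OF has_derivative_const[of "(cmod c)\<^sup>2"] open_ball, of z z r R UNIV] r(1)
      by simp
  qed
  then have R: "R z = R 0" for z
    using has_derivative_zero_unique[OF convex_UNIV, of R z 0] by auto
  have N0: "N z > 0" for z using assms[of z] by force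
  have R0: "R 0 > 0" using N0[of 0] e0[of 0] by (simp add: R_def)
  show ?thesis
  proof (rule that[of "\<lambda>z. of_real (sqrt (R 0)) * e0 z"])
    show "(\<lambda>z. of_real (sqrt (R 0)) * e0 z) holomorphic_on UNIV"
      using e0' by (intro holomorphic_on_mult holomorphic_on_const) (auto simp: holomorphic_on_def field_differentiable_def)
    show "of_real (sqrt (R 0)) * e0 z \<noteq> 0" for z using e0 R0 by simp
    show "N z = (cmod (of_real (sqrt (R 0)) * e0 z))\<^sup>2" for z
      using R[of z] R0 e0[of z] by (simp add: norm_mult power_mult_distrib R_def[of z] field_simps)
  qed
qed

context
  fixes \<phi> :: "complex \<Rightarrow> cp3"
  assumes J: "J_holomorphic \<phi>" and tr: "transverse \<phi>"
begin

lemma adapted_B_entries: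
  assumes "adapted_frame \<phi> U g" "z \<in> U"
  shows "mc g z \<i> $ 3 $ 1 = \<i> * coeff_p g z" "mc g z \<i> $ 2 $ 1 = - \<i> * coeff_c g z"
    "mc g z \<i> $ 4 $ 1 = 0" "mc g z 1 $ 4 $ 1 = 0"
  using adapted_coeffs(3)[OF J tr assms, of \<i>] adapted_coeffs(3)[OF J tr assms, of 1]
    adapted_coeffs(4)[OF J tr assms, of \<i>] adapted_coeffs(5)[OF J tr assms, of \<i>] by simp_all

lemma mc_equation_entry:
  assumes "adapted_frame \<phi> U g" "z \<in> U"
  shows "frechet_derivative (\<lambda>w. mc g w 1) (at z) \<i> $ r $ c - frechet_derivative (\<lambda>w. mc g w \<i>) (at z) 1 $ r $ c
    = (mc g z 1 ** mc g z \<i>) $ r $ c - (mc g z \<i> ** mc g z 1) $ r $ c"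
  using arg_cong[OF maurer_cartan_equation[of \<phi> U g z], of "\<lambda>A. A $ r $ c"] assms
  by (simp add: adapted_frame_def)

lemma derivative_entry_scale:
  assumes "adapted_frame \<phi> U g" "z \<in> U" "\<And>w. w \<in> U \<Longrightarrow> mc g w \<i> $ r $ c = k * mc g w 1 $ r $ c"
  shows "frechet_derivative (\<lambda>w. mc g w \<i>) (at z) u $ r $ c = k * frechet_derivative (\<lambda>w. mc g w 1) (at z) u $ r $ c"
proof -
  have f: "frame \<phi> U g" "open U" using assms by (auto simp: adapted_frame_def frame_def)
  have "((\<lambda>w. k * mc g w 1 $ r $ c) has_derivative (\<lambda>u. k * frechet_derivative (\<lambda>w. mc g w 1) (at z) u $ r $ c)) (at z)"
    by (rule bounded_linear.has_derivative[OF bounded_linear_mult_right mc_entry_derivative[OF f(1) assms(2)]])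
  then have "((\<lambda>w. mc g w \<i> $ r $ c) has_derivative (\<lambda>u. k * frechet_derivative (\<lambda>w. mc g w 1) (at z) u $ r $ c)) (at z)"
    by (rule has_derivative_transform_within_open[OF _ f(2) assms(2)]) (simp add: assms(3))
  from fun_cong[OF has_derivative_unique[OF this mc_entry_derivative[OF f(1) assms(2)]], of u]
  show ?thesis by simp
qed

text \<open>Entry (4,1) of the Maurer-Cartan equation. Its left side vanishes with
  \<open>\<omega>2\<close>, and of the commutator only \<open>p\<close> times the failure of
  \<open>\<tau>\<close> to be complex linear survives.\<close>

lemma tau_type:
  assumes "adapted_frame \<phi> U g" "z \<in> U"
  shows "mc g z \<i> $ 4 $ 3 = \<i> * coeff_t g z"
proof -
  have f: "frame \<phi> U g" using assms by (simp add: adapted_frame_def)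
  note B = adapted_B_entries[OF assms]
  note l1 = lie_entries[OF mc_lie[OF f assms(2), of 1]]
  note li = lie_entries[OF mc_lie[OF f assms(2), of \<i>]]
  have Z: "frechet_derivative (\<lambda>w. mc g w v) (at z) u $ 4 $ 1 = 0" for u v
  proof -
    have "((\<lambda>w. mc g w v $ 4 $ 1) has_derivative (\<lambda>u. 0)) (at z)"
      by (rule has_derivative_transform_within_open[OF has_derivative_const[of 0] _ assms(2)])
        (use f adapted_coeffs(3)[OF J tr assms(1)] in \<open>auto simp: frame_def\<close>)
    from fun_cong[OF has_derivative_unique[OF this mc_entry_derivative[OF f assms(2)]], of u] show ?thesis by simp
  qed
  have "coeff_p g z * mc g z \<i> $ 4 $ 3 = coeff_p g z * (\<i> * coeff_t g z)"
    using mc_equation_entry[OF assms, of 4 1] B l1(4) li(4) by (simp add: Z matrix_mult_nth algebra_simps)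
  then show ?thesis using adapted_coeffs(1)[OF J tr assms] by simp
qed

lemma coeff_t_nonzero:
  assumes "adapted_frame \<phi> U g" "z \<in> U"
  shows "coeff_t g z \<noteq> 0"
proof
  assume t0: "coeff_t g z = 0"
  have f: "frame \<phi> U g" using assms by (simp add: adapted_frame_def)
  have "mc g z v $ 4 $ 3 = 0" for v
    using mc_combination[OF f assms(2), of v 4 3] tau_type[OF assms] t0 by simp
  then show False using tr assms unfolding transverse_def \<tau>_def by blast
qed

text \<open>Five entries of the Maurer-Cartan equation. \<open>A$1$1 + \<i> * B$1$1\<close> and
  \<open>A$3$3 + \<i> * B$3$3\<close> are twice the (0,1) coefficients of the two connection forms;
  they enter with weights (1, -1) for \<open>p\<close>, (-2, 0) for \<open>cnj c\<close> and (0, 2)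
  for \<open>t\<close>, which cancel in \<open>p^2 * cnj c * t\<close>. The last two equations are
  the curvatures of the connection forms.\<close>

lemma structure_equations:
  assumes "adapted_frame \<phi> U g" "z \<in> U"
  defines "A \<equiv> mc g z 1" and "B \<equiv> mc g z \<i>"
  defines "DA \<equiv> frechet_derivative (\<lambda>w. mc g w 1) (at z)" and "DB \<equiv> frechet_derivative (\<lambda>w. mc g w \<i>) (at z)"
  shows "DA 1 $ 3 $ 1 + \<i> * DA \<i> $ 3 $ 1 = coeff_p g z * ((A$1$1 + \<i> * B$1$1) - (A$3$3 + \<i> * B$3$3))"
    "cnj (DA 1 $ 2 $ 1) + \<i> * cnj (DA \<i> $ 2 $ 1) = - 2 * cnj (coeff_c g z) * (A$1$1 + \<i> * B$1$1)"
    "DA 1 $ 4 $ 3 + \<i> * DA \<i> $ 4 $ 3 = 2 * coeff_t g z * (A$3$3 + \<i> * B$3$3)"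
    "DA \<i> $ 1 $ 1 - DB 1 $ 1 $ 1 = 2 * \<i> * (cnj (coeff_c g z) * coeff_c g z - cnj (coeff_p g z) * coeff_p g z)"
    "DA \<i> $ 3 $ 3 - DB 1 $ 3 $ 3 = 2 * \<i> * (cnj (coeff_p g z) * coeff_p g z - cnj (coeff_t g z) * coeff_t g z)"
proof -
  have f: "frame \<phi> U g" using assms by (simp add: adapted_frame_def)
  note b = adapted_B_entries[OF assms(1,2), folded A_def B_def] tau_type[OF assms(1,2), folded A_def B_def]
  note l = lie_entries[OF mc_lie[OF f assms(2), of 1], folded A_def]
     lie_entries[OF mc_lie[OF f assms(2), of \<i>], folded B_def]
  note m = mc_equation_entry[OF assms(1,2), folded A_def B_def DA_def DB_def]
  note d31 = derivative_entry_scale[OF assms(1,2) adapted_B_entries(1)[OF assms(1)], folded DA_def DB_def]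
  note d21 = derivative_entry_scale[OF assms(1,2) adapted_B_entries(2)[OF assms(1)], folded DA_def DB_def]
  note d43 = derivative_entry_scale[OF assms(1,2) tau_type[OF assms(1)], folded DA_def DB_def]
  have "DA \<i> $ 3 $ 1 - \<i> * DA 1 $ 3 $ 1 = A$3$1 * (B$1$1 - \<i> * A$1$1) + A$3$1 * (\<i> * A$3$3 - B$3$3)"
    using m[of 3 1] by (simp add: d31 matrix_mult_nth l b algebra_simps)
  from arg_cong[OF this, of "\<lambda>x. \<i> * x"]
  show "DA 1 $ 3 $ 1 + \<i> * DA \<i> $ 3 $ 1 = mc g z 1 $ 3 $ 1 * ((A$1$1 + \<i> * B$1$1) - (A$3$3 + \<i> * B$3$3))"
    unfolding A_def[symmetric] by (simp add: algebra_simps)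
  have "DA \<i> $ 2 $ 1 + \<i> * DA 1 $ 2 $ 1 = 2 * A$2$1 * (B$1$1 + \<i> * A$1$1)"
    using m[of 2 1] by (simp add: d21 matrix_mult_nth l b algebra_simps)
  from arg_cong[OF this, of "\<lambda>x. \<i> * cnj x"]
  show "cnj (DA 1 $ 2 $ 1) + \<i> * cnj (DA \<i> $ 2 $ 1) = - 2 * cnj (mc g z 1 $ 2 $ 1) * (A$1$1 + \<i> * B$1$1)"
    unfolding A_def[symmetric] by (simp add: l algebra_simps)
  have "DA \<i> $ 4 $ 3 - \<i> * DA 1 $ 4 $ 3 = 2 * A$4$3 * (B$3$3 - \<i> * A$3$3)"
    using m[of 4 3] by (simp add: d43 matrix_mult_nth l b algebra_simps)
  from arg_cong[OF this, of "\<lambda>x. \<i> * x"]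
  show "DA 1 $ 4 $ 3 + \<i> * DA \<i> $ 4 $ 3 = 2 * mc g z 1 $ 4 $ 3 * (A$3$3 + \<i> * B$3$3)"
    unfolding A_def[symmetric] by (simp add: algebra_simps)
  show "DA \<i> $ 1 $ 1 - DB 1 $ 1 $ 1 = 2 * \<i> * (cnj (mc g z 1 $ 2 $ 1) * mc g z 1 $ 2 $ 1 - cnj (mc g z 1 $ 3 $ 1) * mc g z 1 $ 3 $ 1)"
    unfolding A_def[symmetric] using m[of 1 1] by (simp add: matrix_mult_nth l b algebra_simps)
  show "DA \<i> $ 3 $ 3 - DB 1 $ 3 $ 3 = 2 * \<i> * (cnj (mc g z 1 $ 3 $ 1) * mc g z 1 $ 3 $ 1 - cnj (mc g z 1 $ 4 $ 3) * mc g z 1 $ 4 $ 3)"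
    unfolding A_def[symmetric] using m[of 3 3] by (simp add: matrix_mult_nth l b algebra_simps)
qed

end

section \<open>Flat transverse curves\<close>

context
  fixes \<phi> :: "complex \<Rightarrow> cp3"
  assumes J: "J_holomorphic \<phi>" and tr: "transverse \<phi>"
begin

text \<open>With \<open>dh = a dz + b d(cnj z)\<close>, conformality of \<open>g_H\<close> forces
  \<open>a = 0\<close> or \<open>b = 0\<close> at each point. One alternative persists near
  \<open>z\<close>, so \<open>h\<close> or its conjugate is holomorphic there, and its derivative is
  the function sought.\<close>

lemma flat_local:
  assumes flat: "flat_metric (g_H \<phi>)"
  obtains V f where "open V" "z \<in> V" "f holomorphic_on V" "\<And>w. w \<in> V \<Longrightarrow> f w \<noteq> 0"
    "\<And>w. w \<in> V \<Longrightarrow> g_H \<phi> w 1 = (cmod (f w))\<^sup>2"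
proof -
  define N where "N w = g_H \<phi> w 1" for w
  have N: "N w > 0" "g_H \<phi> w v = N w * (cmod v)\<^sup>2" for w v
  proof -
    obtain U g where g: "adapted_frame \<phi> U g" "w \<in> U" using adapted_frame_exists[OF J tr] .
    show "N w > 0" "g_H \<phi> w v = N w * (cmod v)\<^sup>2"
      using g_H_adapted[OF J tr g] adapted_coeffs(1)[OF J tr g] by (simp_all add: N_def)
  qed
  obtain U and h :: "complex \<Rightarrow> complex" where U: "open U" "z \<in> U" "smooth_on U h"
    "\<And>w v. w \<in> U \<Longrightarrow> g_H \<phi> w v = (norm (frechet_derivative h (at w) v))\<^sup>2"
    using flat unfolding flat_metric_def by metis
  define a where "a w = (frechet_derivative h (at w) 1 - \<i> * frechet_derivative h (at w) \<i>) / 2" for w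
  define b where "b w = (frechet_derivative h (at w) 1 + \<i> * frechet_derivative h (at w) \<i>) / 2" for w
  have hd: "(h has_derivative frechet_derivative h (at w)) (at w)" if "w \<in> U" for w
    using smooth_on_has_derivative[OF U(1,3) that] .
  have hx: "frechet_derivative h (at w) 1 = a w + b w" and hy: "frechet_derivative h (at w) \<i> = \<i> * (a w - b w)" for w
    by (simp_all add: a_def b_def field_simps)
  have hxy: "frechet_derivative h (at w) (1 + \<i>) = (1 + \<i>) * a w + (1 - \<i>) * b w" if "w \<in> U" for w
    using linear_add[OF has_derivative_linear[OF hd[OF that]], of 1 \<i>] by (simp add: hx hy algebra_simps)
  \<comment> \<open>Evaluating \<open>|a v + b cnj v|^2 = N |v|^2\<close> at 1, i and 1 + i shows
    that the real and the imaginary part of \<open>a * cnj b\<close> both vanish.\<close>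
  have ab: "(a w = 0 \<or> b w = 0) \<and> N w = (cmod (a w))\<^sup>2 + (cmod (b w))\<^sup>2" if w: "w \<in> U" for w
  proof -
    have 1: "N w = (cmod (a w + b w))\<^sup>2" using U(4)[OF w, of 1] N(2)[of w 1] hx by simp
    have 2: "N w = (cmod (a w - b w))\<^sup>2" using U(4)[OF w, of \<i>] N(2)[of w \<i>] hy by (simp add: norm_mult)
    have "(cmod (1 + \<i>))\<^sup>2 = 2" by (simp add: cmod_power2)
    then have 3: "N w * 2 = (cmod ((1 + \<i>) * a w + (1 - \<i>) * b w))\<^sup>2"
      using U(4)[OF w, of "1 + \<i>"] N(2)[of w "1 + \<i>"] hxy[OF w] by simp
    note e = 1[unfolded cmod_power2] 2[unfolded cmod_power2] 3[unfolded cmod_power2]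
    define p q r s where pqrs: "p = Re (a w)" "q = Im (a w)" "r = Re (b w)" "s = Im (b w)"
    have e1: "N w = (p + r)\<^sup>2 + (q + s)\<^sup>2" "N w = (p - r)\<^sup>2 + (q - s)\<^sup>2"
      "N w * 2 = (p - q + r + s)\<^sup>2 + (p + q + s - r)\<^sup>2"
      using e by (simp_all add: pqrs algebra_simps)
    have n: "N w = p\<^sup>2 + q\<^sup>2 + (r\<^sup>2 + s\<^sup>2)" and re: "p * r + q * s = 0"
      using e1(1,2) by (simp_all add: power2_eq_square algebra_simps)
    have im: "p * s - q * r = 0"
      using e1(3) n by (simp add: power2_eq_square algebra_simps)
    have "(p\<^sup>2 + q\<^sup>2) * (r\<^sup>2 + s\<^sup>2) = (p * r + q * s)\<^sup>2 + (p * s - q * r)\<^sup>2"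
      by (simp add: power2_eq_square algebra_simps)
    then have "p\<^sup>2 + q\<^sup>2 = 0 \<or> r\<^sup>2 + s\<^sup>2 = 0" using re im by simp
    then have "a w = 0 \<or> b w = 0" by (simp add: pqrs complex_eq_iff sum_power2_eq_zero_iff)
    then show ?thesis using n by (simp add: cmod_power2 pqrs)
  qed
  have sa: "smooth_on U a" "smooth_on U b" unfolding a_def b_def
    by (intro smooth_on_divide smooth_on_diff smooth_on_add smooth_on_mult smooth_on_const smooth_on_frechet U(1,3); simp)+
  have open_ne: "open (U \<inter> k -` (- {0}))" if "smooth_on U k" for k :: "complex \<Rightarrow> complex"
    by (rule continuous_open_preimage[OF smooth_on_continuous[OF that] U(1)]) (simp add: open_Compl)
  show ?thesis
  proof (cases "a z = 0")
    case False
    define V where "V = U \<inter> a -` (- {0})"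
    have V: "open V" "z \<in> V" "V \<subseteq> U" using open_ne[OF sa(1)] U(2) False by (auto simp: V_def)
    have bz: "b w = 0" "w \<in> U" "a w \<noteq> 0" if "w \<in> V" for w using ab that by (auto simp: V_def)
    have "(h has_field_derivative a w) (at w)" if "w \<in> V" for w
    proof -
      have "(h has_field_derivative frechet_derivative h (at w) 1) (at w)"
        by (rule CR_imp_field_derivative[OF hd]) (use bz[OF that] in \<open>simp_all add: hx hy\<close>)
      then show ?thesis using bz[OF that] by (simp add: hx)
    qed
    then have "h holomorphic_on V" "\<And>w. w \<in> V \<Longrightarrow> deriv h w = a w"
      using V(1) by (auto simp: holomorphic_on_open DERIV_imp_deriv)
    then have "a holomorphic_on V"
      using holomorphic_deriv[OF _ V(1), of h] holomorphic_cong[of V V "deriv h" a] by auto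
    moreover have "g_H \<phi> w 1 = (cmod (a w))\<^sup>2" if "w \<in> V" for w
      using ab[of w] bz[OF that] by (simp add: N_def)
    ultimately show ?thesis using that V bz by blast
  next
    case True
    have "b z \<noteq> 0" using ab[OF U(2)] N(1)[of z] True by auto
    define V where "V = U \<inter> b -` (- {0})"
    have V: "open V" "z \<in> V" "V \<subseteq> U" using open_ne[OF sa(2)] U(2) \<open>b z \<noteq> 0\<close> by (auto simp: V_def)
    have az: "a w = 0" "w \<in> U" "b w \<noteq> 0" if "w \<in> V" for w using ab that by (auto simp: V_def)
    have "((\<lambda>w. cnj (h w)) has_field_derivative cnj (b w)) (at w)" if "w \<in> V" for w
    proof -
      have "((\<lambda>w. cnj (h w)) has_field_derivative cnj (frechet_derivative h (at w) 1)) (at w)"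
        by (rule CR_imp_field_derivative[OF bounded_linear.has_derivative[OF bounded_linear_cnj hd]])
          (use az[OF that] in \<open>simp_all add: hx hy\<close>)
      then show ?thesis using az[OF that] by (simp add: hx)
    qed
    then have "(\<lambda>w. cnj (h w)) holomorphic_on V" "\<And>w. w \<in> V \<Longrightarrow> deriv (\<lambda>w. cnj (h w)) w = cnj (b w)"
      using V(1) by (auto simp: holomorphic_on_open DERIV_imp_deriv)
    then have "(\<lambda>w. cnj (b w)) holomorphic_on V"
      using holomorphic_deriv[OF _ V(1), of "\<lambda>w. cnj (h w)"] holomorphic_cong[of V V "deriv (\<lambda>w. cnj (h w))" "\<lambda>w. cnj (b w)"] by auto
    moreover have "g_H \<phi> w 1 = (cmod (cnj (b w)))\<^sup>2" if "w \<in> V" for w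
      using ab[of w] az[OF that] by (simp add: N_def)
    ultimately show ?thesis using that[of V "\<lambda>w. cnj (b w)"] V az by force
  qed
qed

lemma coeff_derivatives:
  assumes "adapted_frame \<phi> U g" "z \<in> U"
  shows "((\<lambda>w. mc g w 1 $ r $ c) has_derivative (\<lambda>u. frechet_derivative (\<lambda>w. mc g w 1) (at z) u $ r $ c)) (at z)"
    "((\<lambda>w. cnj (mc g w 1 $ r $ c)) has_derivative (\<lambda>u. cnj (frechet_derivative (\<lambda>w. mc g w 1) (at z) u $ r $ c))) (at z)"
proof -
  have f: "frame \<phi> U g" using assms by (simp add: adapted_frame_def)
  show 1: "((\<lambda>w. mc g w 1 $ r $ c) has_derivative (\<lambda>u. frechet_derivative (\<lambda>w. mc g w 1) (at z) u $ r $ c)) (at z)"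
    by (rule mc_entry_derivative[OF f assms(2)])
  show "((\<lambda>w. cnj (mc g w 1 $ r $ c)) has_derivative (\<lambda>u. cnj (frechet_derivative (\<lambda>w. mc g w 1) (at z) u $ r $ c))) (at z)"
    by (rule bounded_linear.has_derivative[OF bounded_linear_cnj 1])
qed

text \<open>The d-bar equation of \<open>p\<close> removes the (0,1) part of the difference of the
  two connection forms; being imaginary, the difference itself is zero.\<close>

lemma holomorphic_p:
  assumes "adapted_frame \<phi> U g" "z \<in> U" "P holomorphic_on U" "\<And>w. w \<in> U \<Longrightarrow> coeff_p g w = P w"
  shows "mc g z 1 $ 3 $ 3 = mc g z 1 $ 1 $ 1" "mc g z \<i> $ 3 $ 3 = mc g z \<i> $ 1 $ 1"
proof -
  have f: "frame \<phi> U g" "open U" using assms by (auto simp: adapted_frame_def frame_def)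
  have "(coeff_p g has_field_derivative deriv P z) (at z)"
    using holomorphic_derivI[OF assms(3) f(2) assms(2)]
    by (rule DERIV_cong_ev[THEN iffD1, rotated -1])
      (use f(2) assms(2,4) eventually_nhds in \<open>auto simp: eventually_nhds\<close>)
  note this = field_derivative_imp_CR[OF coeff_derivatives(1)[OF assms(1,2)] this]
  then have "(mc g z 1 $ 1 $ 1 + \<i> * mc g z \<i> $ 1 $ 1) - (mc g z 1 $ 3 $ 3 + \<i> * mc g z \<i> $ 3 $ 3) = 0"
    unfolding structure_equations(1)[OF J tr assms(1,2)] using adapted_coeffs(1)[OF J tr assms(1,2)]
    by (metis mult_eq_0_iff)
  then have "(mc g z 1 $ 1 $ 1 - mc g z 1 $ 3 $ 3) + \<i> * (mc g z \<i> $ 1 $ 1 - mc g z \<i> $ 3 $ 3) = 0"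
    by (simp add: algebra_simps)
  then have "mc g z 1 $ 1 $ 1 - mc g z 1 $ 3 $ 3 = 0" "mc g z \<i> $ 1 $ 1 - mc g z \<i> $ 3 $ 3 = 0"
    using imaginary_combination_zero[of "mc g z 1 $ 1 $ 1 - mc g z 1 $ 3 $ 3" "mc g z \<i> $ 1 $ 1 - mc g z \<i> $ 3 $ 3"]
      lie_entries(11,12)[OF mc_lie[OF f(1) assms(2), of 1]] lie_entries(11,12)[OF mc_lie[OF f(1) assms(2), of \<i>]] by simp_all
  then show "mc g z 1 $ 3 $ 3 = mc g z 1 $ 1 $ 1" "mc g z \<i> $ 3 $ 3 = mc g z \<i> $ 1 $ 1" by simp_all
qed

text \<open>Equal connection forms have equal curvatures, which is the first claim. They also cancel
  in the d-bar derivative of \<open>cnj c * t\<close>, where they carry opposite weights.\<close>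

lemma holomorphic_p_consequences:
  assumes "adapted_frame \<phi> U g" "z \<in> U" "P holomorphic_on U" "\<And>w. w \<in> U \<Longrightarrow> coeff_p g w = P w"
  shows "(cmod (coeff_c g z))\<^sup>2 + (cmod (coeff_t g z))\<^sup>2 = 2 * (cmod (coeff_p g z))\<^sup>2"
    "(\<lambda>w. cnj (coeff_c g w) * coeff_t g w) field_differentiable (at z)"
proof -
  have f: "frame \<phi> U g" "open U" using assms by (auto simp: adapted_frame_def frame_def)
  note s = structure_equations[OF J tr assms(1,2)]
  note h = holomorphic_p[OF assms(1) _ assms(3,4)]
  have eq: "frechet_derivative (\<lambda>w. mc g w v) (at z) u $ 3 $ 3 = frechet_derivative (\<lambda>w. mc g w v) (at z) u $ 1 $ 1"
    if "\<And>w. w \<in> U \<Longrightarrow> mc g w v $ 3 $ 3 = mc g w v $ 1 $ 1" for u v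
  proof -
    have "((\<lambda>w. mc g w v $ 3 $ 3) has_derivative (\<lambda>u. frechet_derivative (\<lambda>w. mc g w v) (at z) u $ 1 $ 1)) (at z)"
      by (rule has_derivative_transform_within_open[OF mc_entry_derivative[OF f(1) assms(2)] f(2) assms(2)])
        (simp add: that)
    from fun_cong[OF has_derivative_unique[OF this mc_entry_derivative[OF f(1) assms(2)]], of u]
    show ?thesis by simp
  qed
  have "2 * \<i> * (cnj (coeff_c g z) * coeff_c g z - cnj (coeff_p g z) * coeff_p g z) =
      2 * \<i> * (cnj (coeff_p g z) * coeff_p g z - cnj (coeff_t g z) * coeff_t g z)"
    unfolding s(4)[symmetric] s(5)[symmetric] using eq[of 1 \<i>] eq[of \<i> 1] h by simp
  then have "cnj (coeff_c g z) * coeff_c g z - cnj (coeff_p g z) * coeff_p g z =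
      cnj (coeff_p g z) * coeff_p g z - cnj (coeff_t g z) * coeff_t g z" by simp
  then have "cnj (coeff_c g z) * coeff_c g z + cnj (coeff_t g z) * coeff_t g z = 2 * (cnj (coeff_p g z) * coeff_p g z)"
    by (simp add: algebra_simps)
  then have "complex_of_real ((cmod (coeff_c g z))\<^sup>2 + (cmod (coeff_t g z))\<^sup>2) = complex_of_real (2 * (cmod (coeff_p g z))\<^sup>2)"
    by (simp only: mult_cnj_eq_cmod of_real_add of_real_mult of_real_numeral)
  then show "(cmod (coeff_c g z))\<^sup>2 + (cmod (coeff_t g z))\<^sup>2 = 2 * (cmod (coeff_p g z))\<^sup>2"
    by (simp only: of_real_eq_iff)
  have "((\<lambda>w. cnj (coeff_c g w) * coeff_t g w) has_derivative
     (\<lambda>u. cnj (coeff_c g z) * frechet_derivative (\<lambda>w. mc g w 1) (at z) u $ 4 $ 3 +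
       cnj (frechet_derivative (\<lambda>w. mc g w 1) (at z) u $ 2 $ 1) * coeff_t g z)) (at z)"
    by (rule has_derivative_mult[OF coeff_derivatives(2)[OF assms(1,2)] coeff_derivatives(1)[OF assms(1,2)]])
  from CR_imp_field_derivative[OF this]
  show "(\<lambda>w. cnj (coeff_c g w) * coeff_t g w) field_differentiable (at z)"
  proof -
    have "cnj (coeff_c g z) * frechet_derivative (\<lambda>w. mc g w 1) (at z) 1 $ 4 $ 3 +
       cnj (frechet_derivative (\<lambda>w. mc g w 1) (at z) 1 $ 2 $ 1) * coeff_t g z +
       \<i> * (cnj (coeff_c g z) * frechet_derivative (\<lambda>w. mc g w 1) (at z) \<i> $ 4 $ 3 +
       cnj (frechet_derivative (\<lambda>w. mc g w 1) (at z) \<i> $ 2 $ 1) * coeff_t g z)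
       = cnj (coeff_c g z) * (frechet_derivative (\<lambda>w. mc g w 1) (at z) 1 $ 4 $ 3 + \<i> * frechet_derivative (\<lambda>w. mc g w 1) (at z) \<i> $ 4 $ 3)
       + coeff_t g z * (cnj (frechet_derivative (\<lambda>w. mc g w 1) (at z) 1 $ 2 $ 1) + \<i> * cnj (frechet_derivative (\<lambda>w. mc g w 1) (at z) \<i> $ 2 $ 1))"
      by (simp add: algebra_simps)
    also have "\<dots> = 0"
      unfolding s(2,3) using h[OF assms(2)] by (simp add: algebra_simps)
    finally show ?thesis
      using CR_imp_field_derivative[OF \<open>((\<lambda>w. cnj (coeff_c g w) * coeff_t g w) has_derivative _) (at z)\<close>]
      unfolding field_differentiable_def by blast
  qed
qed

text \<open>The product \<open>\<omega>\<^sub>1\<^sup>2 \<omega>\<^sub>3 \<tau>\<close> is a quartic differential that does not depend on the frame.\<close>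

definition quartic :: "complex \<Rightarrow> complex" where
  "quartic z = (SOME q. \<exists>U g. adapted_frame \<phi> U g \<and> z \<in> U \<and> q = (coeff_p g z)\<^sup>2 * cnj (coeff_c g z) * coeff_t g z)"

lemma adapted_invariants:
  assumes "adapted_frame \<phi> U g" "adapted_frame \<phi> V h" "z \<in> U" "z \<in> V"
  shows "(coeff_p h z)\<^sup>2 * cnj (coeff_c h z) * coeff_t h z = (coeff_p g z)\<^sup>2 * cnj (coeff_c g z) * coeff_t g z"
    "cmod (coeff_p h z) = cmod (coeff_p g z)" "cmod (coeff_c h z) = cmod (coeff_c g z)" "cmod (coeff_t h z) = cmod (coeff_t g z)"
proof -
  obtain s where s: "stab s" "s $ 4 $ 3 = 0"
    "coeff_p h z = cnj (s$3$3) * s$1$1 * coeff_p g z" "coeff_c h z = (s$1$1)\<^sup>2 * coeff_c g z"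
    "coeff_t h z = (s$3$3)\<^sup>2 * coeff_t g z" using adapted_change[OF J tr assms] by metis
  have u: "cnj (s$1$1) * s$1$1 = 1" "cnj (s$3$3) * s$3$3 = 1" using stab_entries(14,15)[OF s(1)] s(2) by simp_all
  have c: "cmod (s$1$1) = 1" "cmod (s$3$3) = 1"
    using arg_cong[OF u(1), of cmod] arg_cong[OF u(2), of cmod] norm_ge_zero[of "s$1$1"] norm_ge_zero[of "s$3$3"]
    by (simp_all add: norm_mult square_eq_1_iff)
  have "(coeff_p h z)\<^sup>2 * cnj (coeff_c h z) * coeff_t h z =
     (cnj (s$1$1) * s$1$1)\<^sup>2 * (cnj (s$3$3) * s$3$3)\<^sup>2 * ((coeff_p g z)\<^sup>2 * cnj (coeff_c g z) * coeff_t g z)"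
    by (simp add: s(3-5) power2_eq_square algebra_simps)
  then show "(coeff_p h z)\<^sup>2 * cnj (coeff_c h z) * coeff_t h z = (coeff_p g z)\<^sup>2 * cnj (coeff_c g z) * coeff_t g z"
    by (simp add: u)
  show "cmod (coeff_p h z) = cmod (coeff_p g z)" "cmod (coeff_c h z) = cmod (coeff_c g z)" "cmod (coeff_t h z) = cmod (coeff_t g z)"
    by (simp_all add: s(3-5) norm_mult norm_power c)
qed

lemma quartic_eq:
  assumes "adapted_frame \<phi> U g" "z \<in> U"
  shows "quartic z = (coeff_p g z)\<^sup>2 * cnj (coeff_c g z) * coeff_t g z"
proof -
  have "\<exists>q U g. adapted_frame \<phi> U g \<and> z \<in> U \<and> q = (coeff_p g z)\<^sup>2 * cnj (coeff_c g z) * coeff_t g z"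
    using assms by blast
  from someI_ex[OF this, folded quartic_def]
  obtain V h where h: "adapted_frame \<phi> V h" "z \<in> V" "quartic z = (coeff_p h z)\<^sup>2 * cnj (coeff_c h z) * coeff_t h z"
    by blast
  then show ?thesis using adapted_invariants(1)[OF assms(1) h(1) assms(2) h(2)] by simp
qed


lemma holomorphic_p_frame:
  assumes flat: "flat_metric (g_H \<phi>)"
  obtains V h P where "adapted_frame \<phi> V h" "z \<in> V" "P holomorphic_on V" "\<And>w. w \<in> V \<Longrightarrow> coeff_p h w = P w"
proof -
  obtain V f where V: "open V" "z \<in> V" "f holomorphic_on V" "\<And>w. w \<in> V \<Longrightarrow> f w \<noteq> 0"
    "\<And>w. w \<in> V \<Longrightarrow> g_H \<phi> w 1 = (cmod (f w))\<^sup>2" using flat_local[OF flat] by metis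
  obtain U g where g: "adapted_frame \<phi> U g" "z \<in> U" using adapted_frame_exists[OF J tr] .
  define W where "W = U \<inter> V"
  have W: "open W" "z \<in> W" "W \<subseteq> U" "W \<subseteq> V" using V g by (auto simp: W_def adapted_frame_def frame_def)
  have gW: "adapted_frame \<phi> W g" by (rule adapted_frame_subset[OF g(1) W(1,3)])
  \<comment> \<open>The divisor accounts for \<open>g_H\<close> being twice \<open>|p|^2\<close> on
    unit vectors. The gauge below leaves \<open>coeff_c\<close> as it is.\<close>
  define P where "P w = f w / of_real (sqrt 2)" for w
  have P: "P holomorphic_on W" unfolding P_def
    using V(3) W(4) by (intro holomorphic_intros holomorphic_on_subset[OF V(3)]) auto
  have mod: "cmod (P w) = cmod (coeff_p g w)" if "w \<in> W" for w
  proof -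
    have "(cmod (f w))\<^sup>2 = 2 * (cmod (coeff_p g w))\<^sup>2"
      using V(5)[of w] g_H_adapted[OF J tr gW that, of 1] W(4) that by auto
    then have "(cmod (P w))\<^sup>2 = (cmod (coeff_p g w))\<^sup>2" by (simp add: P_def norm_divide power_divide)
    then show ?thesis by (rule power2_eq_imp_eq) auto
  qed
  have sc: "smooth_on W (coeff_c g)"
    using gW W(1) by (intro smooth_on_vec_nth smooth_on_mc) (auto simp: adapted_frame_def)
  obtain V' h where h: "adapted_frame \<phi> V' h" "z \<in> V'" "V' \<subseteq> W" "\<And>w. w \<in> V' \<Longrightarrow> coeff_p h w = P w"
    using gauge[OF J tr gW W(2) smooth_on_holomorphic[OF W(1) P] sc mod] by metis
  show ?thesis by (rule that[OF h(1,2) holomorphic_on_subset[OF P h(3)] h(4)])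
qed

lemma flat_identity:
  assumes flat: "flat_metric (g_H \<phi>)" and g: "adapted_frame \<phi> U g" "z \<in> U"
  shows "(cmod (coeff_c g z))\<^sup>2 + (cmod (coeff_t g z))\<^sup>2 = 2 * (cmod (coeff_p g z))\<^sup>2"
proof -
  obtain V h P where h: "adapted_frame \<phi> V h" "z \<in> V" "P holomorphic_on V" "\<And>w. w \<in> V \<Longrightarrow> coeff_p h w = P w"
    using holomorphic_p_frame[OF flat, of z] by metis
  show ?thesis
    using holomorphic_p_consequences(1)[OF h] adapted_invariants(2-4)[OF g(1) h(1) g(2) h(2)] by simp
qed

lemma quartic_holomorphic:
  assumes flat: "flat_metric (g_H \<phi>)"
  shows "quartic holomorphic_on UNIV"
proof -
  have "quartic field_differentiable (at z)" for z
  proof -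
    obtain V h P where h: "adapted_frame \<phi> V h" "z \<in> V" "P holomorphic_on V" "\<And>w. w \<in> V \<Longrightarrow> coeff_p h w = P w"
      using holomorphic_p_frame[OF flat, of z] by metis
    have V: "open V" using h by (simp add: adapted_frame_def frame_def)
    define F where "F w = cnj (coeff_c h w) * coeff_t h w" for w
    have "F holomorphic_on V"
      unfolding holomorphic_on_def F_def
      using holomorphic_p_consequences(2)[OF h(1) _ h(3,4)] field_differentiable_at_within by blast
    then have "(\<lambda>w. (P w)\<^sup>2 * F w) holomorphic_on V" by (intro holomorphic_intros h(3))
    then have "quartic holomorphic_on V"
      by (rule holomorphic_transform) (simp add: quartic_eq[OF h(1)] h(4) F_def mult.assoc)
    then show ?thesis using V h(2) holomorphic_on_imp_differentiable_at by blast
  qed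
  then show ?thesis by (simp add: holomorphic_on_def)
qed

end

text \<open>The value of the Maurer-Cartan form of the normalised frames, see \<open>normal_frames\<close>.\<close>

definition model_form :: "complex \<Rightarrow> complex^4^4" where
  "model_form u = (let k = \<i> / of_real (sqrt 2) in
     vector [vector [0, k * u, k * cnj u, 0],
             vector [k * cnj u, 0, 0, - k * u],
             vector [k * u, 0, 0, - k * cnj u],
             vector [0, - k * cnj u, - k * u, 0]])"

lemma lie_eqI:
  assumes "A \<in> lie_sp2" "B \<in> lie_sp2" "A$1$1 = B$1$1" "A$2$1 = B$2$1" "A$3$1 = B$3$1" "A$4$1 = B$4$1"
    "A$3$3 = B$3$3" "A$4$3 = B$4$3"
  shows "A = B"
  using assms(3-) by (simp add: vec_eq_iff forall_4 lie_entries[OF assms(1)] lie_entries[OF assms(2)])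

lemma model_form_entries:
  "model_form u $ 1 $ 1 = 0" "model_form u $ 2 $ 1 = \<i> / of_real (sqrt 2) * cnj u"
  "model_form u $ 3 $ 1 = \<i> / of_real (sqrt 2) * u" "model_form u $ 4 $ 1 = 0"
  "model_form u $ 3 $ 3 = 0" "model_form u $ 4 $ 3 = - \<i> / of_real (sqrt 2) * u"
  by (simp_all add: model_form_def Let_def vector_4)

lemma model_form_lie: "model_form u \<in> lie_sp2"
  by (simp add: lie_sp2_iff quat_iff adj_def vec_eq_iff forall_4 model_form_def Let_def vector_4)

context
  fixes \<phi> :: "complex \<Rightarrow> cp3"
  assumes J: "J_holomorphic \<phi>" and tr: "transverse \<phi>" and flat: "flat_metric (g_H \<phi>)"
begin

text \<open>
  By \<open>flat_identity\<close> and the inequality between the means, the quotient of the quartic differential by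
  the fourth power of \<open>e\<close> is bounded, hence constant.
\<close>

lemma quartic_constant_multiple:
  obtains e K where "e holomorphic_on UNIV" "\<And>z. e z \<noteq> 0" "\<And>z. g_H \<phi> z 1 = (cmod (e z))\<^sup>2"
    "K > 0" "\<And>z. quartic \<phi> z = of_real K * (e z) ^ 4"
proof -
  have "\<exists>V f. open V \<and> z \<in> V \<and> f holomorphic_on V \<and> (\<forall>w\<in>V. f w \<noteq> 0 \<and> g_H \<phi> w 1 = (cmod (f w))\<^sup>2)" for z
    using flat_local[OF J tr flat, of z] by metis
  then obtain e where e: "e holomorphic_on UNIV" "\<And>z. e z \<noteq> 0" "\<And>z. g_H \<phi> z 1 = (cmod (e z))\<^sup>2"
    using local_modulus_global[of "\<lambda>w. g_H \<phi> w 1"] by metis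
  define q where "q z = quartic \<phi> z / (e z) ^ 4" for z
  \<comment> \<open>The bound 1/4 compares \<open>p^2 * (c * t)\<close>, at most \<open>p^4\<close>,
    with \<open>|e|^4 = 4 p^4\<close>.\<close>
  have b: "cmod (q z) \<le> 1 / 4" and q0: "q z \<noteq> 0" for z
  proof -
    obtain U g where g: "adapted_frame \<phi> U g" "z \<in> U" using adapted_frame_exists[OF J tr] .
    define p c t where pct: "p = cmod (coeff_p g z)" "c = cmod (coeff_c g z)" "t = cmod (coeff_t g z)"
    have e2: "(cmod (e z))\<^sup>2 = 2 * p\<^sup>2" using e(3)[of z] g_H_adapted[OF J tr g, of 1] by (simp add: pct)
    have "c\<^sup>2 + t\<^sup>2 = 2 * p\<^sup>2" unfolding pct by (rule flat_identity[OF J tr flat g])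
    then have "c * t \<le> p\<^sup>2" using sum_squares_bound[of c t] by simp
    then have "p\<^sup>2 * (c * t) \<le> p\<^sup>2 * p\<^sup>2" by (intro mult_left_mono) auto
    moreover have "cmod (quartic \<phi> z) = p\<^sup>2 * (c * t)"
      by (simp add: quartic_eq[OF J tr g] norm_mult norm_power pct)
    moreover have "(cmod (e z)) ^ 4 = 4 * (p\<^sup>2 * p\<^sup>2)"
      using arg_cong[OF e2, of "\<lambda>x. x * x"] by (simp add: power2_eq_square power4_eq_xxxx algebra_simps)
    ultimately have "4 * cmod (quartic \<phi> z) \<le> (cmod (e z)) ^ 4" by simp
    then show "cmod (q z) \<le> 1 / 4" using e(2)[of z] by (simp add: q_def norm_divide norm_power field_simps)
    show "q z \<noteq> 0"
      using adapted_coeffs(1,2)[OF J tr g] coeff_t_nonzero[OF J tr g] e(2)[of z] by (simp add: q_def quartic_eq[OF J tr g])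
  qed
  have "q holomorphic_on UNIV" unfolding q_def
    using e(1,2) quartic_holomorphic[OF J tr flat] by (intro holomorphic_intros) auto
  moreover have "bounded (range q)" unfolding bounded_iff using b by blast
  ultimately have "q constant_on UNIV" by (rule Liouville_theorem)
  then obtain k where k: "\<And>z. q z = k" unfolding constant_on_def by blast
  have k0: "k \<noteq> 0" using q0 k by metis
  \<comment> \<open>A fourth root of the phase of \<open>k\<close>. Absorbed into \<open>e\<close>,
    it keeps the modulus of \<open>e\<close> and makes the constant positive.\<close>
  define a where "a = exp (Ln (k / of_real (cmod k)) / 4)"
  have a4: "a ^ 4 = k / of_real (cmod k)"
    using k0 by (simp add: a_def flip: exp_of_nat_mult)
  have a1: "cmod a = 1"
  proof -
    have "(cmod a) ^ 4 = 1" using arg_cong[OF a4, of cmod] k0 by (simp add: norm_power norm_divide)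
    then show ?thesis using power_eq_iff_eq_base[of 4 "cmod a" 1] by simp
  qed
  show ?thesis
  proof (rule that[of "\<lambda>z. a * e z" "cmod k"])
    show "(\<lambda>z. a * e z) holomorphic_on UNIV" by (intro holomorphic_intros e(1))
    show "a * e z \<noteq> 0" for z using a1 e(2) by auto
    show "g_H \<phi> z 1 = (cmod (a * e z))\<^sup>2" for z using e(3) a1 by (simp add: norm_mult)
    show "cmod k > 0" using k0 by simp
    show "quartic \<phi> z = of_real (cmod k) * (a * e z) ^ 4" for z
      using k[of z] e(2)[of z] k0 by (simp add: q_def power_mult_distrib a4 field_simps)
  qed
qed

text \<open>Recovers \<open>t\<close> from the quartic differential once \<open>p\<close>,
  \<open>cnj c\<close> and the constant 1/4 are known; \<open>r\<close> stands for the root of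
  2.\<close>

lemma quartic_root:
  fixes r x t :: complex
  assumes "r * r = 2" "x \<noteq> 0" "x ^ 4 / 4 = (\<i> / r * x)\<^sup>2 * (- \<i> / r * x) * t"
  shows "t = - \<i> / r * x"
proof -
  have r: "r \<noteq> 0" using assms(1) by auto
  have "(\<i> / r * x)\<^sup>2 = - (x * x / (r * r))" by (simp add: power_mult_distrib power_divide) (simp add: power2_eq_square)
  then have "(\<i> / r * x)\<^sup>2 = - (x * x / 2)" by (simp only: assms(1))
  then have "x * x * x * x = x * x * x * (2 * \<i> / r * t)"
    using assms(3) by (simp add: power4_eq_xxxx)
  then have "x = 2 * \<i> / r * t" using assms(2) by (metis mult_cancel_left mult_eq_0_iff)
  then have "- \<i> / r * x = 2 / (r * r) * t" by (simp add: mult_ac)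
  then show ?thesis by (simp add: assms(1))
qed

text \<open>Once \<open>|c| / |p|\<close> is known to be constant, phases can be chosen that make
  \<open>p\<close> and \<open>cnj c\<close> holomorphic together. Both connection forms then vanish;
  their curvature gives \<open>|c| = |p|\<close>, \<open>flat_identity\<close> gives
  \<open>|t| = |p|\<close>, and the quartic differential determines the phase of
  \<open>t\<close>.\<close>

lemma normal_frames:
  obtains e where "e holomorphic_on UNIV" "\<And>z. e z \<noteq> 0" "\<And>z v. g_H \<phi> z v = (cmod (e z * v))\<^sup>2"
    "\<And>z. \<exists>V h. adapted_frame \<phi> V h \<and> z \<in> V \<and> (\<forall>w\<in>V. \<forall>v. mc h w v = model_form (e w * v))"
proof -
  obtain e K where e: "e holomorphic_on UNIV" "\<And>z. e z \<noteq> 0" "\<And>z. g_H \<phi> z 1 = (cmod (e z))\<^sup>2"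
    "K > 0" "\<And>z. quartic \<phi> z = of_real K * (e z) ^ 4" using quartic_constant_multiple by metis
  define P where "P w = \<i> / of_real (sqrt 2) * e w" for w
  have Phol: "P holomorphic_on UNIV" unfolding P_def by (intro holomorphic_intros e(1)) auto
  have e2: "(cmod (e z))\<^sup>2 = 2 * (cmod (coeff_p g z))\<^sup>2" if "adapted_frame \<phi> U g" "z \<in> U" for z U g
    using e(3)[of z] g_H_adapted[OF J tr that, of 1] by simp
  have P2: "cmod (P z) = cmod (coeff_p g z)" if "adapted_frame \<phi> U g" "z \<in> U" for z U g
  proof -
    have "(cmod (P z))\<^sup>2 = (cmod (coeff_p g z))\<^sup>2"
      using e2[OF that] by (simp add: P_def norm_mult norm_divide power_divide power_mult_distrib)
    then show ?thesis by (rule power2_eq_imp_eq) auto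
  qed
  have main: "\<exists>V h. adapted_frame \<phi> V h \<and> z \<in> V \<and> (\<forall>w\<in>V. \<forall>v. mc h w v = model_form (e w * v))" for z
  proof -
    obtain U0 g where g0: "adapted_frame \<phi> U0 g" "z \<in> U0" using adapted_frame_exists[OF J tr] .
    then have "open U0" by (simp add: adapted_frame_def frame_def)
    then obtain r where r: "r > 0" "ball z r \<subseteq> U0" using g0(2) open_contains_ball by blast
    define U where "U = ball z r"
    have U: "open U" "z \<in> U" "connected U" using r by (auto simp: U_def)
    have g: "adapted_frame \<phi> U g" unfolding U_def by (rule adapted_frame_subset[OF g0(1) _ r(2)]) simp
    have sm: "smooth_on U (\<lambda>w. mc g w 1 $ i $ j)" for i j
      using g U(1) by (intro smooth_on_vec_nth smooth_on_mc) (auto simp: adapted_frame_def)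
    \<comment> \<open>Eliminating \<open>|t|\<close> through \<open>flat_identity\<close> turns the
      constancy of the quartic ratio into a quadratic equation for \<open>X\<close>; being
      continuous with at most two values, \<open>X\<close> is constant on the ball.\<close>
    define X where "X w = (cmod (coeff_c g w))\<^sup>2 / (cmod (coeff_p g w))\<^sup>2" for w
    have X2: "(X w - 1)\<^sup>2 = 1 - 16 * K\<^sup>2" if w: "w \<in> U" for w
    proof -
      define p c t where pct: "p = (cmod (coeff_p g w))\<^sup>2" "c = (cmod (coeff_c g w))\<^sup>2" "t = (cmod (coeff_t g w))\<^sup>2"
      have p0: "p \<noteq> 0" using adapted_coeffs(1)[OF J tr g w] by (simp add: pct)
      have "c + t = 2 * p" unfolding pct by (rule flat_identity[OF J tr flat g w])
      then have t: "t = 2 * p - c" by simp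
      have "(cmod (quartic \<phi> w))\<^sup>2 = p\<^sup>2 * c * t"
        by (simp add: quartic_eq[OF J tr g w] norm_mult norm_power pct power_mult_distrib flip: power_mult)
      moreover have "(cmod (quartic \<phi> w))\<^sup>2 = K\<^sup>2 * ((cmod (e w))\<^sup>2) ^ 4"
        using e(4) by (simp add: e(5) norm_mult norm_power power_mult_distrib flip: power_mult)
      moreover have "((cmod (e w))\<^sup>2) ^ 4 = 16 * p ^ 4" by (simp add: e2[OF g w] pct power_mult_distrib)
      ultimately have "p\<^sup>2 * (c * t) = p\<^sup>2 * (16 * K\<^sup>2 * p\<^sup>2)" by (simp add: power2_eq_square power4_eq_xxxx mult_ac)
      then have ct: "c * (2 * p - c) = 16 * K\<^sup>2 * p\<^sup>2" using p0 t by simp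
      have "(X w - 1)\<^sup>2 = 1 - c * (2 * p - c) / p\<^sup>2"
      proof -
        have "X w = c / p" by (simp add: X_def pct)
        then have "c = X w * p" using p0 by simp
        then show ?thesis using p0 by (simp only:) (simp add: power2_eq_square field_simps)
      qed
      then show ?thesis using p0 by (simp add: ct)
    qed
    have "continuous_on U X" unfolding X_def
      using adapted_coeffs(1)[OF J tr g] by (intro continuous_intros smooth_on_continuous[OF sm]) auto
    moreover have "finite (X ` U)"
    proof (rule finite_subset)
      show "X ` U \<subseteq> {1 + sqrt (1 - 16 * K\<^sup>2), 1 - sqrt (1 - 16 * K\<^sup>2)}"
      proof (rule image_subsetI)
        fix w assume "w \<in> U"
        have "\<bar>X w - 1\<bar> = sqrt (1 - 16 * K\<^sup>2)" using X2[OF \<open>w \<in> U\<close>] by (metis real_sqrt_abs)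
        then show "X w \<in> {1 + sqrt (1 - 16 * K\<^sup>2), 1 - sqrt (1 - 16 * K\<^sup>2)}"
          by (auto simp: abs_if split: if_splits)
      qed
    qed simp
    ultimately have "X constant_on U" by (rule continuous_finite_range_constant[OF U(3)])
    then obtain x where x: "\<And>w. w \<in> U \<Longrightarrow> X w = x" unfolding constant_on_def by blast
    have x0: "x > 0" using x[OF U(2)] adapted_coeffs(1,2)[OF J tr g U(2)] by (auto simp: X_def)
    \<comment> \<open>The modulus is that of \<open>coeff_c g\<close> and the conjugate is
      holomorphic. The sign is a free phase, chosen to match \<open>model_form\<close>.\<close>
    define C where "C w = cnj (- of_real (sqrt x) * P w)" for w
    have C2: "cmod (C w) = cmod (coeff_c g w)" if "w \<in> U" for w
    proof -
      have "(cmod (C w))\<^sup>2 = X w * (cmod (coeff_p g w))\<^sup>2"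
        using x0 by (simp add: C_def norm_mult power_mult_distrib P2[OF g that] x[OF that])
      also have "\<dots> = (cmod (coeff_c g w))\<^sup>2" using adapted_coeffs(1)[OF J tr g that] by (simp add: X_def)
      finally show ?thesis by (rule power2_eq_imp_eq) auto
    qed
    have sP: "smooth_on U P" by (rule smooth_on_holomorphic[OF U(1) holomorphic_on_subset[OF Phol]]) simp
    have sC: "smooth_on U C" unfolding C_def by (intro smooth_on_cnj smooth_on_mult smooth_on_const U(1) sP)
    obtain V h where h: "adapted_frame \<phi> V h" "z \<in> V" "V \<subseteq> U"
      "\<And>w. w \<in> V \<Longrightarrow> coeff_p h w = P w" "\<And>w. w \<in> V \<Longrightarrow> coeff_c h w = C w"
      using gauge[OF J tr g U(2) sP sC P2[OF g] C2] by metis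
    have f: "frame \<phi> V h" "open V" using h(1) by (auto simp: adapted_frame_def frame_def)
    have a11: "mc h w 1 $ 1 $ 1 = 0" "mc h w \<i> $ 1 $ 1 = 0" if w: "w \<in> V" for w
    proof -
      have "((\<lambda>w. cnj (coeff_c h w)) has_field_derivative deriv (\<lambda>w. - of_real (sqrt x) * P w) w) (at w)"
      proof (rule has_field_derivative_transform_within_open[OF _ f(2) w])
        show "((\<lambda>w. - of_real (sqrt x) * P w) has_field_derivative deriv (\<lambda>w. - of_real (sqrt x) * P w) w) (at w)"
          by (rule holomorphic_derivI[where S=UNIV]) (auto intro!: holomorphic_intros Phol)
      qed (simp add: h(5) C_def)
      from field_derivative_imp_CR[OF coeff_derivatives(2)[OF J tr h(1) w] this]
      have "- 2 * cnj (coeff_c h w) * (mc h w 1 $ 1 $ 1 + \<i> * mc h w \<i> $ 1 $ 1) = 0"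
        unfolding structure_equations(2)[OF J tr h(1) w] .
      then have "mc h w 1 $ 1 $ 1 + \<i> * mc h w \<i> $ 1 $ 1 = 0"
        using adapted_coeffs(2)[OF J tr h(1) w] by simp
      then show "mc h w 1 $ 1 $ 1 = 0" "mc h w \<i> $ 1 $ 1 = 0"
        using imaginary_combination_zero lie_entries(11)[OF mc_lie[OF f(1) w, of 1]] lie_entries(11)[OF mc_lie[OF f(1) w, of \<i>]]
        by blast+
    qed
    have a33: "mc h w 1 $ 3 $ 3 = 0" "mc h w \<i> $ 3 $ 3 = 0" if w: "w \<in> V" for w
      using holomorphic_p[OF J tr h(1) w holomorphic_on_subset[OF Phol] h(4)] a11[OF w] by auto
    \<comment> \<open>The connection form vanishes on an open set, so its exterior derivative
      vanishes there too; the curvature equation is then the equality of moduli.\<close>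
    have cp: "cmod (coeff_c h w) = cmod (coeff_p h w)" if w: "w \<in> V" for w
    proof -
      have Z: "frechet_derivative (\<lambda>w. mc h w v) (at w) u $ 1 $ 1 = 0" if "\<And>w. w \<in> V \<Longrightarrow> mc h w v $ 1 $ 1 = 0" for u v
      proof -
        have "((\<lambda>w. mc h w v $ 1 $ 1) has_derivative (\<lambda>u. 0)) (at w)"
          by (rule has_derivative_transform_within_open[OF has_derivative_const[of 0] f(2) w]) (simp add: that)
        from fun_cong[OF has_derivative_unique[OF this mc_entry_derivative[OF f(1) w]], of u] show ?thesis by simp
      qed
      have "cnj (coeff_c h w) * coeff_c h w = cnj (coeff_p h w) * coeff_p h w"
        using structure_equations(4)[OF J tr h(1) w] Z[of 1] Z[of \<i>] a11 by simp
      then have "(cmod (coeff_c h w))\<^sup>2 = (cmod (coeff_p h w))\<^sup>2"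
        unfolding mult_cnj_eq_cmod by (simp only: of_real_eq_iff)
      then show ?thesis by (rule power2_eq_imp_eq) auto
    qed
    have "x = 1"
    proof -
      have "sqrt x * cmod (P z) = cmod (P z)"
        using cp[OF h(2)] x0 by (simp add: h(4)[OF h(2)] h(5)[OF h(2)] C_def norm_mult)
      moreover have "P z \<noteq> 0" using e(2)[of z] by (simp add: P_def)
      ultimately show ?thesis by simp
    qed
    have c: "coeff_c h w = \<i> / of_real (sqrt 2) * cnj (e w)" if "w \<in> V" for w
      using h(5)[OF that] by (simp add: C_def P_def \<open>x = 1\<close>)
    have t: "coeff_t h w = - \<i> / of_real (sqrt 2) * e w" if w: "w \<in> V" for w
    proof -
      have "(cmod (coeff_t h w))\<^sup>2 = (cmod (coeff_p h w))\<^sup>2"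
        using flat_identity[OF J tr flat h(1) w] cp[OF w] by simp
      then have tp: "cmod (coeff_t h w) = cmod (coeff_p h w)" by (rule power2_eq_imp_eq) auto
      \<comment> \<open>With all three moduli equal, the modulus of the quartic differential forces
        \<open>K = 1/4\<close>.\<close>
      have "cmod (quartic \<phi> w) = ((cmod (coeff_p h w))\<^sup>2)\<^sup>2"
        by (simp add: quartic_eq[OF J tr h(1) w] norm_mult norm_power cp[OF w] tp power2_eq_square)
      also have "\<dots> = ((cmod (e w))\<^sup>2)\<^sup>2 / 4" using e2[OF h(1) w] by (simp add: power_mult_distrib)
      finally have "K * (cmod (e w)) ^ 4 = (cmod (e w)) ^ 4 / 4"
        using e(4) by (simp add: e(5) norm_mult norm_power flip: power_mult)
      then have K: "K = 1 / 4" using e(2)[of w] by simp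
      have s2: "complex_of_real (sqrt 2) * of_real (sqrt 2) = 2" by (simp flip: of_real_mult)
      have "of_real K * (e w) ^ 4 = (P w)\<^sup>2 * cnj (coeff_c h w) * coeff_t h w"
        using quartic_eq[OF J tr h(1) w] by (simp add: e(5) h(4)[OF w])
      then have "(e w) ^ 4 / 4 = (\<i> / of_real (sqrt 2) * e w)\<^sup>2 * (- \<i> / of_real (sqrt 2) * e w) * coeff_t h w"
        by (simp add: K P_def c[OF w])
      then show ?thesis by (rule quartic_root[OF s2 e(2)])
    qed
    have "mc h w v = model_form (e w * v)" if w: "w \<in> V" for w v
    proof (rule lie_eqI[OF mc_lie[OF f(1) w] model_form_lie])
      note a = adapted_coeffs(3-5)[OF J tr h(1) w, of v]
      show "mc h w v $ 2 $ 1 = model_form (e w * v) $ 2 $ 1" unfolding a(3) by (simp add: model_form_entries c[OF w])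
      show "mc h w v $ 3 $ 1 = model_form (e w * v) $ 3 $ 1" unfolding a(2) by (simp add: model_form_entries h(4)[OF w] P_def)
      show "mc h w v $ 4 $ 1 = model_form (e w * v) $ 4 $ 1" unfolding a(1) by (simp add: model_form_entries)
      show "mc h w v $ 1 $ 1 = model_form (e w * v) $ 1 $ 1"
        using mc_combination[OF f(1) w, of v 1 1] a11[OF w] by (simp add: model_form_entries)
      show "mc h w v $ 3 $ 3 = model_form (e w * v) $ 3 $ 3"
        using mc_combination[OF f(1) w, of v 3 3] a33[OF w] by (simp add: model_form_entries)
      have "v = of_real (Re v) + \<i> * of_real (Im v)" by (simp add: complex_eq_iff)
      moreover have "mc h w v $ 4 $ 3 = (of_real (Re v) + \<i> * of_real (Im v)) * coeff_t h w"
        using mc_combination[OF f(1) w, of v 4 3] tau_type[OF J tr h(1) w] by (simp add: algebra_simps)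
      ultimately show "mc h w v $ 4 $ 3 = model_form (e w * v) $ 4 $ 3"
        by (simp add: model_form_entries t[OF w])
    qed
    then show ?thesis using h(1,2) by blast
  qed
  have G: "g_H \<phi> z v = (cmod (e z * v))\<^sup>2" for z v
  proof -
    obtain U g where g: "adapted_frame \<phi> U g" "z \<in> U" using adapted_frame_exists[OF J tr] .
    show ?thesis using g_H_adapted[OF J tr g, of v] e2[OF g] by (simp add: norm_mult power_mult_distrib)
  qed
  show ?thesis by (rule that[OF e(1,2) G main])
qed

end

section \<open>The homogeneous model\<close>

abbreviation rcos :: "real \<Rightarrow> complex" where "rcos x \<equiv> of_real (cos x)"
abbreviation rsin :: "real \<Rightarrow> complex" where "rsin x \<equiv> of_real (sin x)"

text \<open>
  The first column of \<open>model_frame\<close> is the orbit of \<open>(1, 1, sqrt 2, 0) / 2\<close> under a maximal torus of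
  \<open>Sp2\<close>; the third column is the direction of \<open>\<omega>\<^sub>1\<close>.
\<close>

definition model_vec :: "complex \<Rightarrow> complex^4" where
  "model_vec \<zeta> = (let X = sqrt 2 * Re \<zeta>; Y = sqrt 2 * Im \<zeta>; r = of_real (sqrt 2) in
     vector [(rcos X - \<i> * rsin X) / 2, (rcos X + \<i> * rsin X) / 2, r * rcos Y / 2, r * rsin Y / 2])"

definition model_vec' :: "complex \<Rightarrow> complex^4" where
  "model_vec' \<zeta> = (let X = sqrt 2 * Re \<zeta>; Y = sqrt 2 * Im \<zeta>; r = of_real (sqrt 2) in
     vector [- (rcos X - \<i> * rsin X) / 2, (rcos X + \<i> * rsin X) / 2, r * rsin Y / 2, - r * rcos Y / 2])"

definition model_frame :: "complex \<Rightarrow> complex^4^4" where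
  "model_frame \<zeta> = quat_columns (model_vec \<zeta>) (model_vec' \<zeta>)"

definition model_curve :: "complex \<Rightarrow> cp3" where
  "model_curve \<zeta> = line (model_vec \<zeta>)"

lemma sqrt2_sqrt2: "complex_of_real (sqrt 2) * of_real (sqrt 2) = 2"
  by (simp flip: of_real_mult)

lemma rcos_rsin: "rcos x * rcos x + rsin x * rsin x = 1"
  using arg_cong[OF sin_cos_squared_add3[of x], of complex_of_real] by (simp only: of_real_add of_real_mult of_real_1)

lemma model_frame_Sp2: "model_frame \<zeta> \<in> Sp2"
proof -
  define X Y and r :: complex where XY: "X = sqrt 2 * Re \<zeta>" "Y = sqrt 2 * Im \<zeta>" "r = of_real (sqrt 2)"
  have r: "r * r = 2" "cnj r = r" using sqrt2_sqrt2 by (simp_all add: XY)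
  have rr: "r * (r * x) = 2 * x" for x using r(1) by (simp flip: mult.assoc)
  have X: "rsin X * rsin X = 1 - rcos X * rcos X" and Y: "rsin Y * rsin Y = 1 - rcos Y * rcos Y"
    using rcos_rsin[of X] rcos_rsin[of Y] by (simp_all add: algebra_simps)
  have X': "rsin X * (rsin X * z) = z - rcos X * (rcos X * z)" and Y': "rsin Y * (rsin Y * z) = z - rcos Y * (rcos Y * z)" for z
    using X Y by (simp_all add: left_diff_distrib flip: mult.assoc)
  note v = model_vec_def[of \<zeta>, unfolded Let_def, folded XY] model_vec'_def[of \<zeta>, unfolded Let_def, folded XY]
  show ?thesis
    unfolding model_frame_def
    by (rule quat_columns_Sp2)
      (simp_all add: v herm_def vector_4 right_j_nth r rr X Y X' Y' field_simps)
qed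

lemma smooth_on_rcos_rsin:
  assumes "bounded_linear L"
  shows "smooth_on UNIV (\<lambda>\<zeta>. rcos (L \<zeta>))" "smooth_on UNIV (\<lambda>\<zeta>. rsin (L \<zeta>))"
proof -
  have "smooth_on UNIV (\<lambda>\<zeta>. complex_of_real (L \<zeta>))"
    by (rule smooth_on_bounded_linear[OF bounded_linear_compose[OF bounded_linear_of_real assms]])
      (simp_all add: smooth_on_id)
  then have "smooth_on UNIV (\<lambda>\<zeta>. cos (complex_of_real (L \<zeta>)))" "smooth_on UNIV (\<lambda>\<zeta>. sin (complex_of_real (L \<zeta>)))"
    by (auto intro: smooth_on_holomorphic_compose[where V=UNIV and h=cos]
        smooth_on_holomorphic_compose[where V=UNIV and h=sin] holomorphic_on_cos holomorphic_on_sin holomorphic_on_ident)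
  then show "smooth_on UNIV (\<lambda>\<zeta>. rcos (L \<zeta>))" "smooth_on UNIV (\<lambda>\<zeta>. rsin (L \<zeta>))"
    by (simp_all add: cos_of_real sin_of_real)
qed

lemma smooth_on_model_frame: "smooth_on UNIV model_frame"
proof -
  have L: "bounded_linear (\<lambda>\<zeta>. sqrt 2 * Re \<zeta>)" "bounded_linear (\<lambda>\<zeta>. sqrt 2 * Im \<zeta>)"
    using bounded_linear_compose[OF bounded_linear_mult_right bounded_linear_Re]
      bounded_linear_compose[OF bounded_linear_mult_right bounded_linear_Im] by blast+
  note s = smooth_on_rcos_rsin[OF L(1)] smooth_on_rcos_rsin[OF L(2)]
  show ?thesis
    unfolding model_frame_def[abs_def] model_vec_def[abs_def] model_vec'_def[abs_def] Let_def
    by (intro smooth_on_quat_columns smooth_on_vector4 smooth_on_divide smooth_on_add smooth_on_diff smooth_on_mult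
        smooth_on_minus smooth_on_const s open_UNIV) simp_all
qed

text \<open>Columns 2 and 4 are conjugates of columns 1 and 3 up to sign, so only half of the
  entries call for an explicit derivative.\<close>

lemma quat_has_derivativeI:
  assumes "open U" "x \<in> U" "smooth_on U M" "\<And>y. quat (M y)" "\<And>v. quat (D v)"
    "\<And>r. ((\<lambda>y. M y $ r $ 1) has_derivative (\<lambda>v. D v $ r $ 1)) (at x)"
    "\<And>r. ((\<lambda>y. M y $ r $ 3) has_derivative (\<lambda>v. D v $ r $ 3)) (at x)"
  shows "(M has_derivative D) (at x)"
proof -
  define E where "E = frechet_derivative M (at x)"
  have E: "(M has_derivative E) (at x)" unfolding E_def by (rule smooth_on_has_derivative[OF assms(1,3,2)])
  have en: "((\<lambda>y. M y $ r $ c) has_derivative (\<lambda>v. E v $ r $ c)) (at x)" for r c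
    by (rule bounded_linear.has_derivative[OF bounded_linear_entry E])
  have c13: "E v $ r $ 1 = D v $ r $ 1" "E v $ r $ 3 = D v $ r $ 3" for v r
    using fun_cong[OF has_derivative_unique[OF en assms(6)], of v r] fun_cong[OF has_derivative_unique[OF en assms(7)], of v r]
    by simp_all
  have cn: "((\<lambda>y. cnj (M y $ r $ c)) has_derivative (\<lambda>v. cnj (E v $ r $ c))) (at x)" for r c
    by (rule bounded_linear.has_derivative[OF bounded_linear_cnj en])
  have p: "E v $ r $ c = cnj (E v $ r' $ c')" if "\<And>y. M y $ r $ c = cnj (M y $ r' $ c')" for v r c r' c'
    using fun_cong[OF has_derivative_unique[OF en[of r c, unfolded that] cn[of r' c']], of v] by simp
  have m: "E v $ r $ c = - cnj (E v $ r' $ c')" if "\<And>y. M y $ r $ c = - cnj (M y $ r' $ c')" for v r c r' c'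
    using fun_cong[OF has_derivative_unique[OF en[of r c, unfolded that] has_derivative_minus[OF cn[of r' c']]], of v] by simp
  note q = assms(4)[unfolded quat_iff]
  have "quat (E v)" for v
    unfolding quat_iff by (intro conjI p m) (use q in blast)+
  then have "E v = D v" for v
    using assms(5)[of v] c13[of v] unfolding quat_iff by (simp add: vec_eq_iff forall_4)
  then have "E = D" by (rule ext)
  then show ?thesis using E by simp
qed

text \<open>The values of \<open>model_form\<close> commute, so its integral is a translate of a
  two-parameter subgroup, and \<open>model_frame\<close> writes that subgroup as a standard maximal
  torus. The frequency sqrt 2 comes from the eigenvalues of \<open>model_form 1\<close> and
  \<open>model_form \<i>\<close>, which are 0 (twice) and plus or minus i sqrt 2.\<close>

lemma model_frame_derivative: "(model_frame has_derivative (\<lambda>u. model_frame \<zeta> ** model_form u)) (at \<zeta>)"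
proof (rule quat_has_derivativeI[OF open_UNIV UNIV_I smooth_on_model_frame])
  show "quat (model_frame y)" for y using model_frame_Sp2 by (simp add: Sp2_iff)
  then show "quat (model_frame \<zeta> ** model_form u)" for u
    using model_form_lie by (intro quat_mult) (auto simp: lie_sp2_iff)
  define X Y and r :: complex where XY: "X = sqrt 2 * Re \<zeta>" "Y = sqrt 2 * Im \<zeta>" "r = of_real (sqrt 2)"
  have r: "r * r = 2" "cnj r = r" "r \<noteq> 0" using sqrt2_sqrt2 by (auto simp: XY)
  have rr: "r * (r * x) = 2 * x" for x using r(1) by (simp flip: mult.assoc)
  have r2: "x / r = r * x / 2" for x using r by (simp add: field_simps rr)
  have dX: "((\<lambda>y. rcos (sqrt 2 * Re y)) has_derivative (\<lambda>u. - r * rsin X * of_real (Re u))) (at \<zeta>)"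
    "((\<lambda>y. rsin (sqrt 2 * Re y)) has_derivative (\<lambda>u. r * rcos X * of_real (Re u))) (at \<zeta>)"
    "((\<lambda>y. rcos (sqrt 2 * Im y)) has_derivative (\<lambda>u. - r * rsin Y * of_real (Im u))) (at \<zeta>)"
    "((\<lambda>y. rsin (sqrt 2 * Im y)) has_derivative (\<lambda>u. r * rcos Y * of_real (Im u))) (at \<zeta>)"
    unfolding XY by (rule has_derivative_eq_rhs, (rule derivative_intros)+, simp add: fun_eq_iff algebra_simps)+
  have u: "u = of_real (Re u) + \<i> * of_real (Im u)" "cnj u = of_real (Re u) - \<i> * of_real (Im u)" for u
    by (simp_all add: complex_eq_iff)
  note v = model_vec_def[of \<zeta>, unfolded Let_def, folded XY] model_vec'_def[of \<zeta>, unfolded Let_def, folded XY]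
  have F: "(model_frame \<zeta> ** model_form u) $ 1 $ 1 = (- r * rsin X * of_real (Re u) - \<i> * (r * rcos X * of_real (Re u))) / 2"
    "(model_frame \<zeta> ** model_form u) $ 2 $ 1 = (- r * rsin X * of_real (Re u) + \<i> * (r * rcos X * of_real (Re u))) / 2"
    "(model_frame \<zeta> ** model_form u) $ 3 $ 1 = r * (- r * rsin Y * of_real (Im u)) / 2"
    "(model_frame \<zeta> ** model_form u) $ 4 $ 1 = r * (r * rcos Y * of_real (Im u)) / 2"
    "(model_frame \<zeta> ** model_form u) $ 1 $ 3 = - (- r * rsin X * of_real (Re u) - \<i> * (r * rcos X * of_real (Re u))) / 2"
    "(model_frame \<zeta> ** model_form u) $ 2 $ 3 = (- r * rsin X * of_real (Re u) + \<i> * (r * rcos X * of_real (Re u))) / 2"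
    "(model_frame \<zeta> ** model_form u) $ 3 $ 3 = r * (r * rcos Y * of_real (Im u)) / 2"
    "(model_frame \<zeta> ** model_form u) $ 4 $ 3 = - r * (- r * rsin Y * of_real (Im u)) / 2" for u
  proof -
    define a b where "a = complex_of_real (Re u)" and "b = complex_of_real (Im u)"
    have u': "u = a + \<i> * b" "cnj u = a - \<i> * b" unfolding a_def b_def by (fact u)+
    have ab: "cnj a = a" "cnj b = b" by (simp_all add: a_def b_def)
    show "(model_frame \<zeta> ** model_form u) $ 1 $ 1 = (- r * rsin X * of_real (Re u) - \<i> * (r * rcos X * of_real (Re u))) / 2"
      "(model_frame \<zeta> ** model_form u) $ 2 $ 1 = (- r * rsin X * of_real (Re u) + \<i> * (r * rcos X * of_real (Re u))) / 2"
      "(model_frame \<zeta> ** model_form u) $ 3 $ 1 = r * (- r * rsin Y * of_real (Im u)) / 2"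
      "(model_frame \<zeta> ** model_form u) $ 4 $ 1 = r * (r * rcos Y * of_real (Im u)) / 2"
      "(model_frame \<zeta> ** model_form u) $ 1 $ 3 = - (- r * rsin X * of_real (Re u) - \<i> * (r * rcos X * of_real (Re u))) / 2"
      "(model_frame \<zeta> ** model_form u) $ 2 $ 3 = (- r * rsin X * of_real (Re u) + \<i> * (r * rcos X * of_real (Re u))) / 2"
      "(model_frame \<zeta> ** model_form u) $ 3 $ 3 = r * (r * rcos Y * of_real (Im u)) / 2"
      "(model_frame \<zeta> ** model_form u) $ 4 $ 3 = - r * (- r * rsin Y * of_real (Im u)) / 2"
      unfolding matrix_mult_nth model_frame_def quat_columns_nth right_j_nth v model_form_def Let_def vector_4
        XY(3)[symmetric] r2 a_def[symmetric] b_def[symmetric]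
      by (simp_all add: r rr u' ab field_simps)
  qed
  have d: "((\<lambda>y. model_vec y $ 1) has_derivative (\<lambda>u. (model_frame \<zeta> ** model_form u) $ 1 $ 1)) (at \<zeta>)"
    "((\<lambda>y. model_vec y $ 2) has_derivative (\<lambda>u. (model_frame \<zeta> ** model_form u) $ 2 $ 1)) (at \<zeta>)"
    "((\<lambda>y. model_vec y $ 3) has_derivative (\<lambda>u. (model_frame \<zeta> ** model_form u) $ 3 $ 1)) (at \<zeta>)"
    "((\<lambda>y. model_vec y $ 4) has_derivative (\<lambda>u. (model_frame \<zeta> ** model_form u) $ 4 $ 1)) (at \<zeta>)"
    "((\<lambda>y. model_vec' y $ 1) has_derivative (\<lambda>u. (model_frame \<zeta> ** model_form u) $ 1 $ 3)) (at \<zeta>)"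
    "((\<lambda>y. model_vec' y $ 2) has_derivative (\<lambda>u. (model_frame \<zeta> ** model_form u) $ 2 $ 3)) (at \<zeta>)"
    "((\<lambda>y. model_vec' y $ 3) has_derivative (\<lambda>u. (model_frame \<zeta> ** model_form u) $ 3 $ 3)) (at \<zeta>)"
    "((\<lambda>y. model_vec' y $ 4) has_derivative (\<lambda>u. (model_frame \<zeta> ** model_form u) $ 4 $ 3)) (at \<zeta>)"
    unfolding F model_vec_def model_vec'_def Let_def vector_4 XY(3)[symmetric]
    by (intro bounded_linear.has_derivative[OF bounded_linear_divide] has_derivative_add has_derivative_diff has_derivative_minus
        bounded_linear.has_derivative[OF bounded_linear_mult_right] dX)+
  have D: "((\<lambda>y. model_vec y $ k) has_derivative (\<lambda>u. (model_frame \<zeta> ** model_form u) $ k $ 1)) (at \<zeta>)"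
    "((\<lambda>y. model_vec' y $ k) has_derivative (\<lambda>u. (model_frame \<zeta> ** model_form u) $ k $ 3)) (at \<zeta>)" for k :: 4
    using exhaust_4[of k] d by (elim disjE; simp only:)+
  then show "((\<lambda>y. model_frame y $ k $ 1) has_derivative (\<lambda>u. (model_frame \<zeta> ** model_form u) $ k $ 1)) (at \<zeta>)"
    "((\<lambda>y. model_frame y $ k $ 3) has_derivative (\<lambda>u. (model_frame \<zeta> ** model_form u) $ k $ 3)) (at \<zeta>)" for k
    by (simp_all add: model_frame_def quat_columns_nth)
qed

lemma model_vec_axis: "model_frame \<zeta> *v axis 1 1 = model_vec \<zeta>"
  by (simp add: vec_eq_iff matrix_vector_axis_nth model_frame_def quat_columns_nth)

lemma base_point_model_frame: "base_point (model_frame \<zeta>) = model_curve \<zeta>"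
  by (simp add: base_point_def model_curve_def model_vec_axis)

lemma model_vec_nonzero: "model_vec \<zeta> \<noteq> 0"
  using frame_nonzero[OF model_frame_Sp2] by (simp add: model_vec_axis)

lemma frame_model:
  assumes "g \<in> Sp2"
  shows "frame (\<lambda>\<zeta>. act g (model_curve \<zeta>)) UNIV (\<lambda>\<zeta>. g ** model_frame \<zeta>)"
  unfolding frame_def
  by (intro conjI ballI open_UNIV smooth_on_matrix_mult smooth_on_const smooth_on_model_frame Sp2_mult assms model_frame_Sp2)
    (simp add: base_point_mult model_frame_Sp2 base_point_model_frame)

lemma mc_model:
  assumes "g \<in> Sp2"
  shows "mc (\<lambda>\<zeta>. g ** model_frame \<zeta>) \<zeta> u = model_form u"
proof -
  have "((\<lambda>\<zeta>. g ** model_frame \<zeta>) has_derivative (\<lambda>u. g ** (model_frame \<zeta> ** model_form u))) (at \<zeta>)"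
    by (rule bounded_linear.has_derivative[OF bounded_bilinear.bounded_linear_right[OF bounded_bilinear_matrix_mult] model_frame_derivative])
  then have "mc (\<lambda>\<zeta>. g ** model_frame \<zeta>) \<zeta> u = adj (g ** model_frame \<zeta>) ** (g ** (model_frame \<zeta> ** model_form u))"
    by (intro mc_eq[of UNIV]) (auto intro: Sp2_mult assms model_frame_Sp2)
  also have "\<dots> = adj (model_frame \<zeta>) ** (adj g ** (g ** (model_frame \<zeta> ** model_form u)))"
    by (simp add: adj_mult matrix_mul_assoc)
  finally show ?thesis by (simp add: Sp2_cancel(1)[OF assms] Sp2_cancel(1)[OF model_frame_Sp2])
qed

text \<open>An arbitrary frame is compared with the global one by \<open>frame_change\<close>, whose
  constants do not depend on \<open>v\<close>; so the type of the forms can be read off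
  \<open>model_form\<close>.\<close>

lemma J_holomorphic_model:
  assumes "g \<in> Sp2"
  shows "J_holomorphic (\<lambda>\<zeta>. act g (model_curve \<zeta>))"
  unfolding J_holomorphic_def
proof (intro conjI allI impI)
  show "smooth_curve (\<lambda>\<zeta>. act g (model_curve \<zeta>))"
    unfolding smooth_curve_def
  proof (intro allI exI conjI ballI)
    show "smooth_on UNIV (\<lambda>\<zeta>. \<chi> r. (g ** model_frame \<zeta>) $ r $ 1)"
      by (intro smooth_on_vec_lambda open_UNIV, simp, intro smooth_on_vec_nth smooth_on_matrix_mult smooth_on_const smooth_on_model_frame open_UNIV)
    fix \<zeta>
    have "(\<chi> r. (g ** model_frame \<zeta>) $ r $ 1) = g *v model_vec \<zeta>"
      by (simp add: vec_eq_iff matrix_mult_nth matrix_vector_nth model_frame_def quat_columns_nth)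
    then show "(\<chi> r. (g ** model_frame \<zeta>) $ r $ 1) \<noteq> 0" "line (\<chi> r. (g ** model_frame \<zeta>) $ r $ 1) = act g (model_curve \<zeta>)"
      by (simp_all add: Sp2_nonzero[OF assms model_vec_nonzero] model_curve_def act_line model_vec_nonzero)
  qed auto
  fix U h z v
  assume h: "frame (\<lambda>\<zeta>. act g (model_curve \<zeta>)) U h" "z \<in> U"
  obtain l a b where lab: 
    "\<And>v. mc h z v $ 2 $ 1 = l\<^sup>2 * model_form v $ 2 $ 1"
    "\<And>v. mc h z v $ 3 $ 1 = l * (cnj a * model_form v $ 3 $ 1 + cnj b * model_form v $ 4 $ 1)"
    "\<And>v. mc h z v $ 4 $ 1 = l * (- b * model_form v $ 3 $ 1 + a * model_form v $ 4 $ 1)"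
    using frame_change[OF frame_model[OF assms] h(1) UNIV_I h(2)] unfolding mc_model[OF assms] by metis
  show "is_J (mc h z v) (mc h z (\<i> * v))"
    by (simp add: is_J_def \<omega>1_def \<omega>2_def \<omega>3_def lab model_form_entries algebra_simps)
qed

section \<open>Flat transverse curves cover the model\<close>

text \<open>Fixing \<open>c\<close> leaves a sign for the first phase, and fixing \<open>p\<close>
  makes the second phase equal to it.\<close>

lemma adapted_frame_normalised_unique:
  assumes J: "J_holomorphic \<phi>" and tr: "transverse \<phi>" and k: "adapted_frame \<phi> U k" "adapted_frame \<phi> V k'" "z \<in> U" "z \<in> V"
    and m: "mc k z 1 = model_form x" "mc k' z 1 = model_form x" "x \<noteq> 0"
  shows "k' z = k z \<or> k' z = - k z"
proof -
  obtain s where s: "stab s" "s $ 4 $ 3 = 0" "k' z = k z ** s"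
    "coeff_p k' z = cnj (s$3$3) * s$1$1 * coeff_p k z" "coeff_c k' z = (s$1$1)\<^sup>2 * coeff_c k z"
    using adapted_change[OF J tr k] by metis
  note e = stab_entries[OF s(1)]
  have "(s$1$1)\<^sup>2 = 1" and l: "cnj (s$3$3) * s$1$1 = 1"
    using s(4,5) m by (simp_all add: model_form_entries)
  then have "s$1$1 = 1 \<or> s$1$1 = -1" by (simp add: power2_eq_1_iff)
  then have "s$1$1 = 1 \<and> s$3$3 = 1 \<or> s$1$1 = -1 \<and> s$3$3 = -1"
    using arg_cong[OF l, of cnj] by (elim disjE) (simp_all add: minus_equation_iff)
  then have "s = mat 1 \<or> s = - mat 1"
    using e(1-13) s(2) by (auto simp: vec_eq_iff forall_4 mat_def)
  moreover have "k z ** (- mat 1) = - k z" 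
    by (simp add: vec_eq_iff matrix_matrix_mult_def mat_def sum_negf if_distrib sum.delta cong: if_cong)
  ultimately show ?thesis using s(3) by auto
qed

text \<open>A normal frame and \<open>model_frame\<close> composed with a primitive \<open>h\<close>
  of \<open>e\<close> have the same Maurer-Cartan form, so their quotient is locally constant in
  \<open>Sp2\<close>. Globally it is controlled up to sign, which suffices since opposite matrices
  act alike.\<close>

lemma flat_transverse_factors:
  assumes J: "J_holomorphic \<phi>" and tr: "transverse \<phi>" and flat: "flat_metric (g_H \<phi>)"
  obtains h g where "h holomorphic_on UNIV" "\<And>z. deriv h z \<noteq> 0" "g \<in> Sp2"
    "\<And>z. \<phi> z = act g (model_curve (h z))" "\<And>z v. g_H \<phi> z v = (cmod (deriv h z * v))\<^sup>2"
proof -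
  obtain e where e: "e holomorphic_on UNIV" "\<And>z. e z \<noteq> 0" "\<And>z v. g_H \<phi> z v = (cmod (e z * v))\<^sup>2"
    "\<And>z. \<exists>V k. adapted_frame \<phi> V k \<and> z \<in> V \<and> (\<forall>w\<in>V. \<forall>v. mc k w v = model_form (e w * v))"
    using normal_frames[OF J tr flat] by metis
  obtain h where h: "\<And>z. (h has_field_derivative e z) (at z)"
    using holomorphic_convex_primitive'[OF convex_UNIV open_UNIV e(1)] by auto
  define nf where "nf V k \<longleftrightarrow> adapted_frame \<phi> V k \<and> (\<forall>w\<in>V. \<forall>v. mc k w v = model_form (e w * v))" for V k
  \<comment> \<open>All group elements that some normal frame yields at \<open>z\<close>; by
    \<open>uniq\<close> any two of them agree up to sign.\<close>
  define G where "G z = {k z ** adj (model_frame (h z)) | V k. nf V k \<and> z \<in> V}" for z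
  have loc: "\<exists>r>0. \<exists>g\<in>Sp2. \<forall>w\<in>ball z r. g \<in> G w \<and> \<phi> w = act g (model_curve (h w))" for z
  proof -
    obtain V k where k: "nf V k" "z \<in> V" using e(4)[of z] unfolding nf_def by blast
    have f: "frame \<phi> V k" "open V" using k by (auto simp: nf_def adapted_frame_def frame_def)
    obtain r where r: "r > 0" "ball z r \<subseteq> V" using f(2) k(2) open_contains_ball by blast
    define R where "R w = k w ** adj (model_frame (h w))" for w
    have "(R has_derivative (\<lambda>v. 0)) (at w within ball z r)" if "w \<in> ball z r" for w
    proof -
      have w: "w \<in> V" using that r by blast
      have kd: "(k has_derivative (\<lambda>v. k w ** model_form (e w * v))) (at w)"
        using frame_derivative[OF f(1) w] k(1) w by (simp add: nf_def)
      have "((\<lambda>w. model_frame (h w)) has_derivative (\<lambda>v. model_frame (h w) ** model_form (e w * v))) (at w)"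
        by (rule has_derivative_compose[where g=model_frame, OF has_field_derivative_imp_has_derivative[OF h] model_frame_derivative])
      then have "((\<lambda>w. adj (model_frame (h w))) has_derivative (\<lambda>v. adj (model_frame (h w) ** model_form (e w * v)))) (at w)"
        by (rule bounded_linear.has_derivative[OF bounded_linear_adj])
      from bounded_bilinear.FDERIV[OF bounded_bilinear_matrix_mult kd this]
      have "(R has_derivative (\<lambda>v. k w ** adj (model_frame (h w) ** model_form (e w * v)) +
          (k w ** model_form (e w * v)) ** adj (model_frame (h w)))) (at w)" unfolding R_def .
      moreover have "k w ** adj (model_frame (h w) ** model_form (e w * v)) +
          (k w ** model_form (e w * v)) ** adj (model_frame (h w)) = 0" for v
      proof -
        have a: "adj (model_form (e w * v)) = - model_form (e w * v)" using model_form_lie by (simp add: lie_sp2_iff)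
        have n: "(- A) ** B = - (A ** B)" "A ** (- B) = - (A ** B)" for A B :: "complex^4^4"
          by (simp_all add: vec_eq_iff matrix_matrix_mult_def sum_negf)
        show ?thesis by (simp add: adj_mult a n matrix_mul_assoc)
      qed
      ultimately show ?thesis by (simp add: has_derivative_at_withinI)
    qed
    then have "\<exists>c. \<forall>w\<in>ball z r. R w = c" by (intro has_derivative_zero_constant convex_ball)
    then obtain g where g: "\<And>w. w \<in> ball z r \<Longrightarrow> R w = g" by blast
    have kS: "k w \<in> Sp2" "base_point (k w) = \<phi> w" if "w \<in> V" for w using f(1) that by (auto simp: frame_def)
    have "R z \<in> Sp2" unfolding R_def by (intro Sp2_mult Sp2_adj kS(1) k(2) model_frame_Sp2)
    then have gS: "g \<in> Sp2" using g[of z] r(1) by simp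
    have "g \<in> G w \<and> \<phi> w = act g (model_curve (h w))" if w: "w \<in> ball z r" for w
    proof
      have wV: "w \<in> V" using w r by blast
      show "g \<in> G w" using g[OF w] k(1) wV unfolding G_def R_def by blast
      have "g ** model_frame (h w) = k w ** (adj (model_frame (h w)) ** model_frame (h w))"
        using g[OF w] by (simp add: R_def matrix_mul_assoc)
      also have "\<dots> = k w" using model_frame_Sp2[of "h w"] by (simp add: Sp2_iff)
      finally show "\<phi> w = act g (model_curve (h w))"
        using base_point_mult[OF model_frame_Sp2, of g "h w"] kS(2)[OF wV] by (simp add: base_point_model_frame)
    qed
    then show ?thesis using r(1) gS by blast
  qed
  have uniq: "g' = g \<or> g' = - g" if G: "g \<in> G z" "g' \<in> G z" for g g' z
  proof -
    obtain V k where k: "nf V k" "z \<in> V" "g = k z ** adj (model_frame (h z))"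
      using G(1) unfolding G_def by blast
    obtain V' k' where k': "nf V' k'" "z \<in> V'" "g' = k' z ** adj (model_frame (h z))"
      using G(2) unfolding G_def by blast
    note k = k k'
    have "mc k z 1 = model_form (e z)" "mc k' z 1 = model_form (e z)" using k by (auto simp: nf_def)
    then have "k' z = k z \<or> k' z = - k z"
      using adapted_frame_normalised_unique[OF J tr] k e(2)[of z] unfolding nf_def by blast
    moreover have "(- A) ** B = - (A ** B)" for A B :: "complex^4^4"
      by (simp add: vec_eq_iff matrix_matrix_mult_def sum_negf)
    ultimately show ?thesis using k by auto
  qed
  have act_neg: "act (- g) p = act g p" if "g \<in> Sp2" for g p
  proof -
    obtain v where v: "v \<noteq> 0" "line v = p" using ex_line by metis
    have "(- g) *v v = (-1) *s (g *v v)" by (simp add: vec_eq_iff matrix_vector_nth)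
    then show ?thesis using act_line[OF v(1), of g] act_line[OF v(1), of "- g"] line_scale[of "-1" "g *v v"] v(2) by simp
  qed
  obtain g0 where g0: "g0 \<in> Sp2" "g0 \<in> G 0" using loc[of 0] by (metis centre_in_ball)
  \<comment> \<open>Continuation up to sign stands in for a global choice of frame: \<open>T\<close>
    is open and closed and contains 0.\<close>
  define T where "T = {z. g0 \<in> G z \<or> - g0 \<in> G z}"
  have T1: "\<exists>r>0. (\<forall>w\<in>ball z r. w \<in> T \<longleftrightarrow> z \<in> T) \<and> (z \<in> T \<longrightarrow> \<phi> z = act g0 (model_curve (h z)))" for z
  proof -
    obtain r g where g: "r > 0" "g \<in> Sp2" "\<And>w. w \<in> ball z r \<Longrightarrow> g \<in> G w \<and> \<phi> w = act g (model_curve (h w))"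
      using loc[of z] by metis
    have *: "w \<in> T \<longleftrightarrow> g = g0 \<or> g = - g0" if "w \<in> ball z r" for w
      using uniq[of g w g0] uniq[of g w "- g0"] g(3)[OF that] unfolding T_def by auto
    have "z \<in> ball z r" using g(1) by simp
    then have "z \<in> T \<longrightarrow> \<phi> z = act g0 (model_curve (h z))" using * g(3) act_neg[OF g0(1)] by metis
    then show ?thesis using * \<open>z \<in> ball z r\<close> g(1) by blast
  qed
  have "open T" "open (- T)" unfolding open_contains_ball using T1 by (meson subsetI ComplI ComplD)+
  moreover have "0 \<in> T" using g0 by (simp add: T_def)
  ultimately have "T = UNIV" using clopen[of T] by (auto simp: closed_def)
  then have "\<phi> z = act g0 (model_curve (h z))" for z using T1[of z] by blast
  moreover have "deriv h z = e z" for z using h DERIV_imp_deriv by blast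
  moreover have "h holomorphic_on UNIV" using h by (auto simp: holomorphic_on_def field_differentiable_def)
  ultimately show ?thesis using that[of h g0] e(2,3) g0(1) by simp
qed

section \<open>Covering spaces\<close>

text \<open>Balls of radius \<open>d / 2\<close> about the points of a fibre serve as sheets. The
  delicate point is that \<open>p\<close> is open onto its range, and there compactness of
  \<open>K\<close> enters.\<close>

lemma covering_space_periods:
  fixes p :: "complex \<Rightarrow> 'b::t2_space"
  assumes cont: "continuous_on UNIV p" and per: "\<And>x y. p x = p y \<longleftrightarrow> x - y \<in> L"
    and d: "d > 0" "\<And>l. l \<in> L \<Longrightarrow> cmod l < d \<Longrightarrow> l = 0"
    and K: "compact K" "p ` K = range p"
  shows "covering_space UNIV p (range p)"
proof (rule covering_spaceI[OF cont refl])
  have om: "openin (top_of_set (range p)) (p ` U)" if "open U" for U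
  proof -
    have "p -` (p ` U) = (\<Union>l\<in>L. (\<lambda>x. l + x) ` U)"
    proof (intro equalityI subsetI)
      fix x assume "x \<in> p -` (p ` U)"
      then obtain u where "u \<in> U" "p x = p u" by auto
      then show "x \<in> (\<Union>l\<in>L. (\<lambda>x. l + x) ` U)" using per by (intro UN_I[of "x - u"]) (auto simp: image_iff)
    next
      fix x assume "x \<in> (\<Union>l\<in>L. (\<lambda>x. l + x) ` U)"
      then obtain l u where "l \<in> L" "u \<in> U" "x = l + u" by auto
      then show "x \<in> p -` (p ` U)" using per[of "l + u" u] by auto
    qed
    then have W: "open (p -` (p ` U))" using that by (auto intro!: open_UN open_translation)
    \<comment> \<open>The complement of the image of \<open>U\<close> in the range is the image of
      this compact set, hence closed.\<close>
    have "compact (K \<inter> - (p -` (p ` U)))" using K(1) W by (intro compact_Int_closed) (auto simp: closed_def)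
    then have "closed (p ` (K \<inter> - (p -` (p ` U))))"
      using cont continuous_on_subset compact_continuous_image compact_imp_closed by blast
    then have "openin (top_of_set (range p)) (range p \<inter> - (p ` (K \<inter> - (p -` (p ` U)))))"
      by (intro openin_open_Int) (simp add: open_Compl)
    moreover have "range p \<inter> - (p ` (K \<inter> - (p -` (p ` U)))) = p ` U"
    proof (intro equalityI subsetI)
      fix y assume y: "y \<in> range p \<inter> - (p ` (K \<inter> - (p -` (p ` U))))"
      then obtain k where "k \<in> K" "y = p k" using K(2) by (metis IntD1 imageE)
      then show "y \<in> p ` U" using y by auto
    next
      fix y assume y: "y \<in> p ` U"
      then have "y \<in> range p" by blast
      then show "y \<in> range p \<inter> - (p ` (K \<inter> - (p -` (p ` U))))" using y by blast
    qed
    ultimately show ?thesis by simp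
  qed
  fix y assume "y \<in> range p"
  then obtain x0 where x0: "y = p x0" by auto
  define B where "B l = ball (x0 + l) (d / 2)" for l
  have img: "p ` B l = p ` B 0" if l: "l \<in> L" for l
  proof (intro equalityI subsetI)
    fix z assume "z \<in> p ` B l"
    then obtain x where x: "x \<in> B l" "z = p x" by auto
    have "x - l \<in> B 0" using x by (simp add: B_def dist_norm algebra_simps)
    moreover have "p x = p (x - l)" using per[of x "x - l"] l by simp
    ultimately show "z \<in> p ` B 0" using x by auto
  next
    fix z assume "z \<in> p ` B 0"
    then obtain x where x: "x \<in> B 0" "z = p x" by auto
    have "x + l \<in> B l" using x by (simp add: B_def dist_norm algebra_simps)
    moreover have "p (x + l) = p x" using per[of "x + l" x] l by simp
    ultimately show "z \<in> p ` B l" using x by (metis imageI)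
  qed
  have dB: "dist u w < d" if "u \<in> B l" "w \<in> B l" for u w l
    using that dist_triangle_half_r[of "x0 + l" u d w] by (simp add: B_def)
  show "\<exists>T. y \<in> T \<and> openin (top_of_set (range p)) T \<and>
     (\<exists>v. \<Union>v = UNIV \<inter> p -` T \<and> (\<forall>u\<in>v. openin (top_of_set UNIV) u) \<and> pairwise disjnt v \<and>
       (\<forall>u\<in>v. \<exists>q. homeomorphism u T p q))"
  proof (intro exI[of _ "p ` B 0"] exI[of _ "B ` L"] conjI ballI)
    show "y \<in> p ` B 0" using d(1) x0 by (auto simp: B_def)
    show "openin (top_of_set (range p)) (p ` B 0)" by (rule om) (simp add: B_def)
    show "\<Union> (B ` L) = UNIV \<inter> p -` (p ` B 0)"
    proof (intro equalityI subsetI)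
      fix x assume "x \<in> \<Union> (B ` L)"
      then show "x \<in> UNIV \<inter> p -` (p ` B 0)" using img by blast
    next
      fix x assume "x \<in> UNIV \<inter> p -` (p ` B 0)"
      then obtain w where w: "w \<in> B 0" "p x = p w" by auto
      then have "x - w \<in> L" "x \<in> B (x - w)" using per by (auto simp: B_def dist_norm algebra_simps)
      then show "x \<in> \<Union> (B ` L)" by blast
    qed
    show "openin (top_of_set UNIV) u" if "u \<in> B ` L" for u using that by (auto simp: B_def)
    show "pairwise disjnt (B ` L)"
    proof (rule pairwise_imageI)
      fix l m assume lm: "l \<in> L" "m \<in> L" "l \<noteq> m"
      have "p (x0 + l) = p (x0 + m)" using per[of "x0 + l" x0] per[of "x0 + m" x0] lm by simp
      then have "l - m \<in> L" using per[of "x0 + l" "x0 + m"] by simp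
      show "disjnt (B l) (B m)"
      proof (rule ccontr)
        assume "\<not> disjnt (B l) (B m)"
        then obtain x where "x \<in> B l" "x \<in> B m" by (auto simp: disjnt_def)
        then have "dist (x0 + l) (x0 + m) < d"
          using dist_triangle_half_l[of "x0 + l" x d "x0 + m"] by (simp add: B_def)
        then have "l - m = 0" using d(2)[OF \<open>l - m \<in> L\<close>] by (simp add: dist_norm)
        then show False using lm by simp
      qed
    qed
    fix u assume "u \<in> B ` L"
    then obtain l where l: "l \<in> L" "u = B l" by auto
    have inj: "inj_on p (B l)"
    proof (rule inj_onI)
      fix a b assume ab: "a \<in> B l" "b \<in> B l" "p a = p b"
      have "cmod (a - b) < d" using dB[OF ab(1,2)] by (simp add: dist_norm)
      then show "a = b" using d(2)[of "a - b"] per ab(3) by simp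
    qed
    have "\<exists>q. homeomorphism (B l) (p ` B 0) p q"
    proof (rule homeomorphism_injective_open_map[OF _ img[OF l(1)] inj])
      show "continuous_on (B l) p" using cont continuous_on_subset by blast
      fix U assume U: "openin (top_of_set (B l)) U"
      then have "open U" "U \<subseteq> B l" by (auto simp: B_def openin_open_eq)
      then have "p ` U \<subseteq> p ` B 0" using img[OF l(1)] by blast
      with om[OF \<open>open U\<close>] show "openin (top_of_set (p ` B 0)) (p ` U)"
        by (rule openin_subset_trans) auto
    qed blast
    then show "\<exists>q. homeomorphism u (p ` B 0) p q" using l by simp
  qed
qed

lemma covering_space_compose_homeomorphism:
  assumes "covering_space c p S" "homeomorphism S T r r'"
  shows "covering_space c (r \<circ> p) T"
proof (rule covering_spaceI)
  note p = covering_space_imp_continuous[OF assms(1)] covering_space_imp_surjective[OF assms(1)]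
  have r: "continuous_on S r" "r ` S = T" "\<And>x. x \<in> S \<Longrightarrow> r' (r x) = x" "\<And>y. y \<in> T \<Longrightarrow> r (r' y) = y"
    "continuous_on T r'" "r' ` T = S"
    using assms(2) by (auto simp: homeomorphism_def)
  show "continuous_on c (r \<circ> p)" using p r by (intro continuous_on_compose) auto
  show "(r \<circ> p) ` c = T" using p r by (auto simp: image_comp[symmetric])
  fix y assume y: "y \<in> T"
  then have "r' y \<in> S" using r by blast
  then obtain V v where V: "r' y \<in> V" "openin (top_of_set S) V" "\<Union>v = c \<inter> p -` V"
    "\<forall>u\<in>v. openin (top_of_set c) u" "pairwise disjnt v" "\<forall>u\<in>v. \<exists>q. homeomorphism u V p q"
    using assms(1) unfolding covering_space_def by metis
  have VS: "V \<subseteq> S" using V(2) openin_imp_subset by blast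
  show "\<exists>W. y \<in> W \<and> openin (top_of_set T) W \<and> (\<exists>v. \<Union>v = c \<inter> (r \<circ> p) -` W \<and> (\<forall>u\<in>v. openin (top_of_set c) u) \<and>
     pairwise disjnt v \<and> (\<forall>u\<in>v. \<exists>q. homeomorphism u W (r \<circ> p) q))"
  proof (intro exI[of _ "r ` V"] exI[of _ v] conjI ballI)
    show "y \<in> r ` V" using V(1) r(4)[OF y] by (metis imageI)
    show "openin (top_of_set T) (r ` V)" using homeomorphism_imp_open_map[OF assms(2) V(2)] .
    show "\<Union>v = c \<inter> (r \<circ> p) -` (r ` V)"
    proof (intro equalityI subsetI)
      fix x assume "x \<in> \<Union>v" then show "x \<in> c \<inter> (r \<circ> p) -` (r ` V)" using V(3) by auto
    next
      fix x assume x: "x \<in> c \<inter> (r \<circ> p) -` (r ` V)"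
      then obtain w where w: "w \<in> V" "r (p x) = r w" by auto
      have "p x \<in> S" "w \<in> S" using x p(2) w VS by auto
      then have "p x = w" using w(2) r(3) by metis
      then show "x \<in> \<Union>v" using x w V(3) by auto
    qed
    show "openin (top_of_set c) u" if "u \<in> v" for u using V(4) that by blast
    show "pairwise disjnt v" by (rule V(5))
    fix u assume "u \<in> v"
    then obtain q where q: "homeomorphism u V p q" using V(6) by blast
    have "homeomorphism V (r ` V) r r'" by (rule homeomorphism_of_subsets[OF assms(2) VS]) (use VS r in auto)
    then show "\<exists>q. homeomorphism u (r ` V) (r \<circ> p) q" using homeomorphism_compose[OF q] by blast
  qed
qed

lemma covering_space_precompose_homeomorphism:
  fixes h :: "'a::topological_space \<Rightarrow> 'a"
  assumes "covering_space UNIV p S" "homeomorphism UNIV UNIV h h'"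
  shows "covering_space UNIV (p \<circ> h) S"
proof (rule covering_spaceI)
  note p = covering_space_imp_continuous[OF assms(1)] covering_space_imp_surjective[OF assms(1)]
  have h: "continuous_on UNIV h" "range h = UNIV" "\<And>x. h' (h x) = x" "\<And>x. h (h' x) = x" "continuous_on UNIV h'"
    using assms(2) by (auto simp: homeomorphism_def)
  show "continuous_on UNIV (p \<circ> h)" using p h by (intro continuous_on_compose) auto
  show "range (p \<circ> h) = S" by (simp only: image_comp[symmetric] h(2) p(2))
  fix y assume "y \<in> S"
  then obtain V v where V: "y \<in> V" "openin (top_of_set S) V" "\<Union>v = UNIV \<inter> p -` V"
    "\<forall>u\<in>v. openin (top_of_set UNIV) u" "pairwise disjnt v" "\<forall>u\<in>v. \<exists>q. homeomorphism u V p q"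
    using assms(1) unfolding covering_space_def by metis
  show "\<exists>W. y \<in> W \<and> openin (top_of_set S) W \<and> (\<exists>v. \<Union>v = UNIV \<inter> (p \<circ> h) -` W \<and> (\<forall>u\<in>v. openin (top_of_set UNIV) u) \<and>
     pairwise disjnt v \<and> (\<forall>u\<in>v. \<exists>q. homeomorphism u W (p \<circ> h) q))"
  proof (intro exI[of _ V] exI[of _ "(\<lambda>u. h -` u) ` v"] conjI ballI V)
    show "\<Union> ((\<lambda>u. h -` u) ` v) = UNIV \<inter> (p \<circ> h) -` V"
    proof -
      have "\<Union> ((\<lambda>u. h -` u) ` v) = h -` \<Union>v" by (simp add: vimage_Union)
      then show ?thesis unfolding V(3) by auto
    qed
    show "pairwise disjnt ((\<lambda>u. h -` u) ` v)"
      using V(5) by (auto simp: pairwise_def disjnt_def)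
    fix u assume "u \<in> (\<lambda>u. h -` u) ` v"
    then obtain w where w: "w \<in> v" "u = h -` w" by auto
    then have "open w" using V(4) by simp
    then show "openin (top_of_set UNIV) u" using w h(1) by (simp add: continuous_on_open_vimage)
    obtain q where q: "homeomorphism w V p q" using V(6) w by blast
    have "h ` u = w" using w(2) h(4) by (auto simp: image_iff) (metis h(4))
    then have "homeomorphism u w h h'" by (intro homeomorphism_of_subsets[OF assms(2)]) auto
    then show "\<exists>q. homeomorphism u V (p \<circ> h) q" using homeomorphism_compose q by blast
  qed
qed

section \<open>The twistor projection of the model\<close>

text \<open>Polarisation of the numerator of \<open>twistor_vec\<close>, scaled to give twice that
  numerator on the diagonal.\<close>

definition twistor_form :: "complex^4 \<Rightarrow> complex^4 \<Rightarrow> R5" where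
  "twistor_form v w =
     (2 * (w$3 * cnj (v$1) + v$3 * cnj (w$1) + cnj (w$4) * v$2 + cnj (v$4) * w$2),
      2 * (w$4 * cnj (v$1) + v$4 * cnj (w$1) - cnj (w$3) * v$2 - cnj (v$3) * w$2),
      2 * Re (cnj (v$1) * w$1 + cnj (v$2) * w$2 - cnj (v$3) * w$3 - cnj (v$4) * w$4))"

lemma twistor_form_bilinear: "bounded_bilinear twistor_form"
proof -
  have "bilinear twistor_form"
    unfolding bilinear_def
    by (auto intro!: linearI simp: twistor_form_def algebra_simps scaleR_conv_of_real[where 'a=complex])
  then show ?thesis by (simp add: bilinear_conv_bounded_bilinear)
qed

lemma twistor_vec_eq: "twistor_vec v = inverse (2 * (norm v)\<^sup>2) *\<^sub>R twistor_form v v"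
proof -
  have "twistor_form v v = 2 *\<^sub>R (2 * (v$3 * cnj (v$1) + cnj (v$4) * v$2),
      2 * (v$4 * cnj (v$1) - cnj (v$3) * v$2),
      (cmod (v$1))\<^sup>2 + (cmod (v$2))\<^sup>2 - (cmod (v$3))\<^sup>2 - (cmod (v$4))\<^sup>2)"
    by (simp add: twistor_form_def scaleR_conv_of_real cmod_power2; simp add: power2_eq_square algebra_simps)
  then show ?thesis by (simp add: twistor_vec_def)
qed

lemma norm_smult: "norm (c *s v) = cmod c * norm (v :: complex^4)"
proof -
  have "herm (c *s v) (c *s v) = (cnj c * c) * herm v v" by (simp add: herm_smult mult_ac)
  then have "(norm (c *s v))\<^sup>2 = (cmod c * norm v)\<^sup>2"
    unfolding herm_self mult_cnj_eq_cmod of_real_mult[symmetric] of_real_eq_iff power_mult_distrib .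
  then show ?thesis by (rule power2_eq_imp_eq) auto
qed

lemma twistor_form_smult: "twistor_form (c *s v) (c *s w) = (cmod c)\<^sup>2 *\<^sub>R twistor_form v w"
proof -
  have c: "c * (cnj c * x) = of_real ((cmod c)\<^sup>2) * x" for x
    using mult_cnj_eq_cmod[of c] by (metis mult.assoc mult.commute)
  have c': "Re (c * (cnj c * x)) = (cmod c)\<^sup>2 * Re x" for x unfolding c by simp
  have "2 * Re (cnj (c * v$1) * (c * w$1) + cnj (c * v$2) * (c * w$2) - cnj (c * v$3) * (c * w$3) - cnj (c * v$4) * (c * w$4))
     = 2 * Re (c * (cnj c * (cnj (v$1) * w$1 + cnj (v$2) * w$2 - cnj (v$3) * w$3 - cnj (v$4) * w$4)))"
    by (simp only: complex_cnj_mult) (simp add: algebra_simps)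
  moreover have "2 * (c * w$3 * cnj (c * v$1) + c * v$3 * cnj (c * w$1) + cnj (c * w$4) * (c * v$2) + cnj (c * v$4) * (c * w$2))
     = c * (cnj c * (2 * (w$3 * cnj (v$1) + v$3 * cnj (w$1) + cnj (w$4) * v$2 + cnj (v$4) * w$2)))"
    by (simp add: algebra_simps)
  moreover have "2 * (c * w$4 * cnj (c * v$1) + c * v$4 * cnj (c * w$1) - cnj (c * w$3) * (c * v$2) - cnj (c * v$3) * (c * w$2))
     = c * (cnj c * (2 * (w$4 * cnj (v$1) + v$4 * cnj (w$1) - cnj (w$3) * v$2 - cnj (v$3) * w$2)))"
    by (simp add: algebra_simps)
  ultimately show ?thesis
    unfolding twistor_form_def vector_smult_component c c' by (simp add: scaleR_conv_of_real)
qed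

lemma twistor_proj_line:
  assumes "v \<noteq> 0"
  shows "twistor_proj (line v) = twistor_vec v"
proof -
  define w where "w = (SOME u. u \<noteq> 0 \<and> line u = line v)"
  have "w \<noteq> 0 \<and> line w = line v" unfolding w_def by (rule someI[of _ v]) (use assms in simp)
  then obtain c where c: "c \<noteq> 0" "w = c *s v" using line_eqD assms by metis
  have "twistor_vec w = twistor_vec v"
    using c(1) by (simp add: twistor_vec_eq c(2) norm_smult twistor_form_smult power_mult_distrib)
  then show ?thesis by (simp add: twistor_proj_def w_def)
qed

lemma twistor_vec_derivative:
  assumes "norm v = 1"
  shows "(twistor_vec has_derivative (\<lambda>w. twistor_form v w - (2 * Re (herm v w)) *\<^sub>R twistor_vec v)) (at v)"
proof -
  have sym: "twistor_form w v = twistor_form v w" for v w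
    by (simp add: twistor_form_def algebra_simps)
  have inn: "v \<bullet> w = Re (herm v w)" for w
    by (simp add: herm_def inner_vec_def sum_4 inner_complex_def algebra_simps)
  have N: "((\<lambda>x. twistor_form x x) has_derivative (\<lambda>w. 2 *\<^sub>R twistor_form v w)) (at v)"
    by (rule has_derivative_eq_rhs[OF bounded_bilinear.FDERIV[OF twistor_form_bilinear has_derivative_ident has_derivative_ident]])
      (simp add: sym[of _ v] fun_eq_iff scaleR_2)
  have n: "((\<lambda>x. inverse (2 * (x \<bullet> x))) has_derivative (\<lambda>w. - Re (herm v w))) (at v)"
  proof -
    have "((\<lambda>x. x \<bullet> x) has_derivative (\<lambda>w. 2 * (v \<bullet> w))) (at v)"
      by (rule has_derivative_eq_rhs[OF has_derivative_inner[OF has_derivative_ident has_derivative_ident]])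
        (simp add: fun_eq_iff inner_commute)
    then have "((\<lambda>x. 2 * (x \<bullet> x)) has_derivative (\<lambda>w. 2 * (2 * (v \<bullet> w)))) (at v)"
      by (rule bounded_linear.has_derivative[OF bounded_linear_mult_right])
    from Deriv.has_derivative_inverse[OF _ this] show ?thesis
      using assms by (simp add: inn dot_square_norm)
  qed
  have "((\<lambda>x. inverse (2 * (x \<bullet> x)) *\<^sub>R twistor_form x x) has_derivative
     (\<lambda>w. inverse (2 * (v \<bullet> v)) *\<^sub>R (2 *\<^sub>R twistor_form v w) + (- Re (herm v w)) *\<^sub>R twistor_form v v)) (at v)"
    by (rule has_derivative_scaleR[OF n N])
  moreover have "inverse (2 * (v \<bullet> v)) *\<^sub>R (2 *\<^sub>R twistor_form v w) + (- Re (herm v w)) *\<^sub>R twistor_form v v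
     = twistor_form v w - (2 * Re (herm v w)) *\<^sub>R twistor_vec v" for w
    using assms by (simp add: dot_square_norm twistor_vec_eq)
  ultimately show ?thesis by (simp add: twistor_vec_eq[abs_def] dot_square_norm)
qed

text \<open>\<open>right_j v\<close> points along the twistor fibre and an imaginary multiple of
  \<open>v\<close> stays on the complex line of \<open>v\<close>; the projection sees
  neither.\<close>

lemma twistor_form_vertical: "twistor_form v (c *s right_j v) = 0" "cnj c = - c \<Longrightarrow> twistor_form v (c *s v) = 0"
proof -
  show "twistor_form v (c *s right_j v) = 0"
    by (simp add: twistor_form_def right_j_nth zero_prod_def algebra_simps)
  assume c: "cnj c = - c"
  then have "Re c = 0" by (simp add: complex_eq_iff)
  then show "twistor_form v (c *s v) = 0"
    using c by (simp add: twistor_form_def zero_prod_def algebra_simps)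
qed

text \<open>The identity in the proof computes the squared norm of \<open>twistor_form v u\<close>
  as \<open>4 |u|^2 |v|^2\<close> minus \<open>4 (Im h)^2\<close> and \<open>4 |k|^2\<close>, the
  parts belonging to vertical directions. On horizontal vectors nothing is lost.\<close>

lemma twistor_form_horizontal_inj:
  assumes "twistor_form v u = 0" "herm v u = 0" "herm (right_j v) u = 0" "v \<noteq> 0"
  shows "u = 0"
proof -
  define h k where "h = herm v u" and "k = herm (right_j v) u"
  define n1 n2 n3 where "n1 = u$3 * cnj (v$1) + v$3 * cnj (u$1) + cnj (u$4) * v$2 + cnj (v$4) * u$2"
    and "n2 = u$4 * cnj (v$1) + v$4 * cnj (u$1) - cnj (u$3) * v$2 - cnj (v$3) * u$2"
    and "n3 = cnj (v$1) * u$1 + cnj (v$2) * u$2 - cnj (v$3) * u$3 - cnj (v$4) * u$4"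
  have "twistor_form v u = (2 * n1, 2 * n2, 2 * Re n3)"
    by (simp only: twistor_form_def n1_def n2_def n3_def)
  then have "n1 = 0" "n2 = 0" "Re n3 = 0" using assms(1) by (simp_all add: zero_prod_def)
  then have z: "n1 = 0" "n2 = 0" "n3 + cnj n3 = 0" by (simp_all add: complex_eq_iff)
  have "4 * (n1 * cnj n1) + 4 * (n2 * cnj n2) + (n3 + cnj n3) * (n3 + cnj n3) =
      4 * (herm u u * herm v v) + (h - cnj h) * (h - cnj h) - 4 * (k * cnj k)"
    unfolding n1_def n2_def n3_def h_def k_def herm_def right_j_nth
    by (simp add: algebra_simps)
  then have "herm u u * herm v v = 0" using z assms(2,3) by (simp add: h_def k_def)
  then have "(norm u)\<^sup>2 * (norm v)\<^sup>2 = 0" unfolding herm_self of_real_mult[symmetric] of_real_eq_0_iff .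
  then show ?thesis using assms(4) by simp
qed

text \<open>The twistor projection of \<open>model_curve\<close>. With \<open>E = exp (i X)\<close>
  it is the point \<open>(E cos (Y - pi/4), E sin (Y - pi/4), 0)\<close>.\<close>

definition torus_map :: "complex \<Rightarrow> R5" where
  "torus_map \<zeta> = (let X = sqrt 2 * Re \<zeta>; Y = sqrt 2 * Im \<zeta>; r = complex_of_real (sqrt 2) in
     ((rcos X + \<i> * rsin X) * (rcos Y + rsin Y) / r, (rcos X + \<i> * rsin X) * (rsin Y - rcos Y) / r, 0))"

lemma norm_Sp2_column: "g \<in> Sp2 \<Longrightarrow> norm (g *v axis 1 1) = 1"
proof -
  assume g: "g \<in> Sp2"
  then have "(adj g ** g) $ 1 $ 1 = 1" by (simp add: Sp2_iff mat1_entries)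
  then have "herm (g *v axis 1 1) (g *v axis 1 1) = 1"
    by (simp add: herm_def matrix_vector_axis_nth matrix_mult_nth adj_nth)
  then have "(norm (g *v axis 1 1))\<^sup>2 = 1" unfolding herm_self by (simp only: of_real_eq_1_iff)
  then show ?thesis using power2_eq_1_iff[of "norm (g *v axis 1 1)"] norm_ge_zero[of "g *v axis 1 1"] by linarith
qed

lemma norm_model_vec: "norm (model_vec \<zeta>) = 1"
  using norm_Sp2_column[OF model_frame_Sp2] by (simp add: model_vec_axis)

lemma twistor_vec_model_vec: "twistor_vec (model_vec \<zeta>) = torus_map \<zeta>"
proof -
  define X Y and r :: complex where XY: "X = sqrt 2 * Re \<zeta>" "Y = sqrt 2 * Im \<zeta>" "r = of_real (sqrt 2)"
  have r: "r * r = 2" "cnj r = r" "r \<noteq> 0" using sqrt2_sqrt2 by (auto simp: XY)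
  have r2: "x / r = r * x / 2" for x using r by (simp add: field_simps flip: mult.assoc)
  note v = model_vec_def[of \<zeta>, unfolded Let_def, folded XY]
  have c4: "(cmod (r * complex_of_real a / 2))\<^sup>2 = a\<^sup>2 / 2" for a
    by (simp add: XY(3) norm_mult norm_divide power_mult_distrib power_divide)
  have c1: "(cmod ((rcos X - \<i> * rsin X) / 2))\<^sup>2 = 1 / 4" "(cmod ((rcos X + \<i> * rsin X) / 2))\<^sup>2 = 1 / 4"
    by (simp_all add: norm_divide power_divide cmod_power2)
  have t: "(cmod (model_vec \<zeta> $ 1))\<^sup>2 + (cmod (model_vec \<zeta> $ 2))\<^sup>2 - (cmod (model_vec \<zeta> $ 3))\<^sup>2 - (cmod (model_vec \<zeta> $ 4))\<^sup>2 = 0"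
    unfolding v vector_4 c1 c4 by (simp add: sin_squared_eq)
  show ?thesis
    unfolding twistor_vec_def t norm_model_vec torus_map_def Let_def XY[symmetric] r2
    by (simp add: v vector_4 r field_simps)
qed

lemma twistor_proj_model: "twistor_proj (model_curve \<zeta>) = torus_map \<zeta>"
  by (simp add: model_curve_def twistor_proj_line model_vec_nonzero twistor_vec_model_vec)

lemma model_frame_has_vec_derivative:
  "(model_vec has_derivative (\<lambda>u. (model_frame \<zeta> ** model_form u) *v axis 1 1)) (at \<zeta>)"
proof -
  have "bounded_linear (\<lambda>A :: complex^4^4. A *v axis 1 1)"
    by (rule linear_conv_bounded_linear[THEN iffD1]) 
      (auto intro!: linearI simp: vec_eq_iff matrix_vector_axis_nth)
  from bounded_linear.has_derivative[OF this model_frame_derivative]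
  show ?thesis by (simp add: model_vec_axis)
qed

lemma continuous_on_model_vec: "continuous_on S model_vec"
  using model_frame_has_vec_derivative has_derivative_continuous continuous_at_imp_continuous_on by blast

lemma continuous_on_model_curve: "continuous_on S model_curve"
  unfolding model_curve_def[abs_def]
  by (rule continuous_on_compose2[OF continuous_on_line continuous_on_model_vec]) (use model_vec_nonzero in auto)

text \<open>The derivative of \<open>torus_map\<close>; the factor sqrt 2 from the angles cancels
  against its denominator.\<close>

definition torus_velocity :: "complex \<Rightarrow> complex \<Rightarrow> R5" where
  "torus_velocity \<zeta> u = (let X = sqrt 2 * Re \<zeta>; Y = sqrt 2 * Im \<zeta> in
     ((rcos X + \<i> * rsin X) * (\<i> * (rcos Y + rsin Y) * of_real (Re u) + (rcos Y - rsin Y) * of_real (Im u)),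
      (rcos X + \<i> * rsin X) * (\<i> * (rsin Y - rcos Y) * of_real (Re u) + (rcos Y + rsin Y) * of_real (Im u)), 0))"

lemma torus_map_derivative: "(torus_map has_derivative torus_velocity \<zeta>) (at \<zeta>)"
proof -
  define X Y and r :: complex where XY: "X = sqrt 2 * Re \<zeta>" "Y = sqrt 2 * Im \<zeta>" "r = of_real (sqrt 2)"
  have r: "r * r = 2" "cnj r = r" "r \<noteq> 0" using sqrt2_sqrt2 by (auto simp: XY)
  have dX: "((\<lambda>y. rcos (sqrt 2 * Re y)) has_derivative (\<lambda>u. - r * rsin X * of_real (Re u))) (at \<zeta>)"
    "((\<lambda>y. rsin (sqrt 2 * Re y)) has_derivative (\<lambda>u. r * rcos X * of_real (Re u))) (at \<zeta>)"
    "((\<lambda>y. rcos (sqrt 2 * Im y)) has_derivative (\<lambda>u. - r * rsin Y * of_real (Im u))) (at \<zeta>)"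
    "((\<lambda>y. rsin (sqrt 2 * Im y)) has_derivative (\<lambda>u. r * rcos Y * of_real (Im u))) (at \<zeta>)"
    unfolding XY by (rule has_derivative_eq_rhs, (rule derivative_intros)+, simp add: fun_eq_iff algebra_simps)+
  have E: "((\<lambda>y. rcos (sqrt 2 * Re y) + \<i> * rsin (sqrt 2 * Re y)) has_derivative
      (\<lambda>u. - r * rsin X * of_real (Re u) + \<i> * (r * rcos X * of_real (Re u)))) (at \<zeta>)"
    by (intro has_derivative_add bounded_linear.has_derivative[OF bounded_linear_mult_right] dX)
  have 1: "((\<lambda>y. (rcos (sqrt 2 * Re y) + \<i> * rsin (sqrt 2 * Re y)) * (rcos (sqrt 2 * Im y) + rsin (sqrt 2 * Im y)) / r)
      has_derivative (\<lambda>u. (rcos X + \<i> * rsin X) * (\<i> * (rcos Y + rsin Y) * of_real (Re u) + (rcos Y - rsin Y) * of_real (Im u)))) (at \<zeta>)"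
    by (rule has_derivative_eq_rhs[OF bounded_linear.has_derivative[OF bounded_linear_divide
          has_derivative_mult[OF E has_derivative_add[OF dX(3,4)]]]])
      (use r(3) in \<open>simp only: fun_eq_iff XY(1,2)[symmetric]; simp add: field_simps\<close>)
  have 2: "((\<lambda>y. (rcos (sqrt 2 * Re y) + \<i> * rsin (sqrt 2 * Re y)) * (rsin (sqrt 2 * Im y) - rcos (sqrt 2 * Im y)) / r)
      has_derivative (\<lambda>u. (rcos X + \<i> * rsin X) * (\<i> * (rsin Y - rcos Y) * of_real (Re u) + (rcos Y + rsin Y) * of_real (Im u)))) (at \<zeta>)"
    by (rule has_derivative_eq_rhs[OF bounded_linear.has_derivative[OF bounded_linear_divide
          has_derivative_mult[OF E has_derivative_diff[OF dX(4,3)]]]])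
      (use r(3) in \<open>simp only: fun_eq_iff XY(1,2)[symmetric]; simp add: field_simps\<close>)
  show ?thesis
    unfolding torus_map_def[abs_def] torus_velocity_def[abs_def] Let_def XY[symmetric]
    by (intro has_derivative_Pair 1 2 has_derivative_const)
qed

text \<open>Both sides differentiate \<open>torus_map\<close>, the right one through
  \<open>model_vec\<close> and the twistor projection. This ties the explicit velocity to the
  frame.\<close>

lemma torus_velocity_eq: "torus_velocity \<zeta> u = twistor_form (model_vec \<zeta>) ((model_frame \<zeta> ** model_form u) *v axis 1 1)
    - (2 * Re (herm (model_vec \<zeta>) ((model_frame \<zeta> ** model_form u) *v axis 1 1))) *\<^sub>R torus_map \<zeta>"
proof -
  have "((\<lambda>y. twistor_vec (model_vec y)) has_derivative
     (\<lambda>u. twistor_form (model_vec \<zeta>) ((model_frame \<zeta> ** model_form u) *v axis 1 1)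
    - (2 * Re (herm (model_vec \<zeta>) ((model_frame \<zeta> ** model_form u) *v axis 1 1))) *\<^sub>R twistor_vec (model_vec \<zeta>))) (at \<zeta>)"
    by (rule has_derivative_compose[OF model_frame_has_vec_derivative twistor_vec_derivative[OF norm_model_vec]])
  then have "(torus_map has_derivative
     (\<lambda>u. twistor_form (model_vec \<zeta>) ((model_frame \<zeta> ** model_form u) *v axis 1 1)
    - (2 * Re (herm (model_vec \<zeta>) ((model_frame \<zeta> ** model_form u) *v axis 1 1))) *\<^sub>R torus_map \<zeta>)) (at \<zeta>)"
    by (simp add: twistor_vec_model_vec)
  from fun_cong[OF has_derivative_unique[OF torus_map_derivative this], of u] show ?thesis .
qed

text \<open>In the first column of \<open>g ** A\<close> the corner entry contributes an imaginary
  multiple of the base vector and entry (2,1) is zero, so only the horizontal part reaches the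
  sphere.\<close>

lemma d_twistor_eq:
  assumes "g \<in> Sp2" "A \<in> lie_sp2" "\<omega>3 A = 0"
  shows "d_twistor g A = twistor_form (g *v axis 1 1) (A$3$1 *s (g *v axis 3 1) + A$4$1 *s (g *v axis 4 1))"
proof -
  define v where "v = g *v axis 1 1"
  have n: "norm v = 1" using norm_Sp2_column[OF assms(1)] by (simp add: v_def)
  define \<eta> where "\<eta> = A$3$1 *s (g *v axis 3 1) + A$4$1 *s (g *v axis 4 1)"
  have A21: "A$2$1 = 0" using assms(3) by (simp add: \<omega>3_def)
  have c: "cnj (A$1$1) = - A$1$1" using lie_entries(11)[OF assms(2)] .
  have dec: "(g ** A) *v axis 1 1 = A$1$1 *s v + \<eta>"
    by (simp add: vec_eq_iff matrix_vector_axis_nth matrix_mult_nth A21 v_def \<eta>_def mult.commute)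
  have u: "adj g ** g = mat 1" using assms(1) by (simp add: Sp2_iff)
  have "herm v (g *v axis k 1) = (adj g ** g) $ 1 $ k" for k
    by (simp add: v_def herm_def matrix_vector_axis_nth matrix_mult_nth adj_nth)
  then have "herm v \<eta> = 0" by (simp add: \<eta>_def herm_add herm_smult u mat_def)
  moreover have "Re (A$1$1) = 0" using c by (simp add: complex_eq_iff)
  ultimately have h: "Re (herm v (A$1$1 *s v + \<eta>)) = 0" using n by (simp add: herm_add herm_smult herm_self)
  have "d_twistor g A = twistor_form v (A$1$1 *s v + \<eta>) - (2 * Re (herm v (A$1$1 *s v + \<eta>))) *\<^sub>R twistor_vec v"
    using fun_cong[OF frechet_derivative_at[OF twistor_vec_derivative[OF n]], of "A$1$1 *s v + \<eta>"]
    by (simp add: d_twistor_def dec v_def[symmetric])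
  also have "\<dots> = twistor_form v (A$1$1 *s v + \<eta>)" unfolding h by simp
  also have "\<dots> = twistor_form v (A$1$1 *s v) + twistor_form v \<eta>"
    by (rule bounded_bilinear.add_right[OF twistor_form_bilinear])
  finally show ?thesis using twistor_form_vertical(2)[OF c, of v] by (simp add: v_def \<eta>_def)
qed

text \<open>Makes the \<open>THE\<close> in \<open>twistor_acs\<close> meaningful. The first columns
  of the frames differ by a unit \<open>l\<close>; after rescaling by it, the two horizontal lifts
  have the same image and coincide by \<open>twistor_form_horizontal_inj\<close>, and J multiplies
  both by i.\<close>

lemma d_twistor_J_unique:
  assumes g: "g \<in> Sp2" "A \<in> lie_sp2" "B \<in> lie_sp2" "\<omega>3 A = 0" "is_J A B"
    and g': "g' \<in> Sp2" "A' \<in> lie_sp2" "B' \<in> lie_sp2" "\<omega>3 A' = 0" "is_J A' B'"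
    and eq: "base_point g = base_point g'" "d_twistor g A = d_twistor g' A'"
  shows "d_twistor g B = d_twistor g' B'"
proof -
  define v where "v = g *v axis 1 1"
  define h where "h g A = A$3$1 *s (g *v axis 3 1) + A$4$1 *s (g *v axis 4 1)" for g A :: "complex^4^4"
  have B: "\<omega>3 B = 0" "h g B = \<i> *s h g A" "\<omega>3 B' = 0" "h g' B' = \<i> *s h g' A'"
  proof -
    have "B$3$1 = \<i> * A$3$1" "B$4$1 = \<i> * A$4$1" "B'$3$1 = \<i> * A'$3$1" "B'$4$1 = \<i> * A'$4$1"
      using g(5) g'(5) by (simp_all add: is_J_def \<omega>1_def \<omega>2_def)
    then show "h g B = \<i> *s h g A" "h g' B' = \<i> *s h g' A'" by (simp_all add: h_def vec_eq_iff algebra_simps)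
    show "\<omega>3 B = 0" "\<omega>3 B' = 0" using g(4,5) g'(4,5) by (simp_all add: is_J_def)
  qed
  have st: "stab (adj g ** g')" by (rule same_base_point[OF g(1) g'(1) eq(1)])
  define s where "s = adj g ** g'"
  note e = stab_entries[OF st, folded s_def]
  have gs: "g' = g ** s" by (simp add: s_def Sp2_cancel(2)[OF g(1)])
  define l where "l = s$1$1"
  have l: "cnj l * l = 1" using e(14) by (simp add: l_def)
  have l1: "cmod l = 1" using arg_cong[OF l, of cmod] norm_ge_zero[of l] by (simp add: norm_mult square_eq_1_iff)
  have v': "g' *v axis 1 1 = l *s v"
    by (simp add: vec_eq_iff gs matrix_vector_axis_nth matrix_mult_nth e(11-13) v_def l_def mult.commute)
  have d: "d_twistor g A = twistor_form v (h g A)" "d_twistor g B = twistor_form v (h g B)"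
    unfolding v_def h_def by (rule d_twistor_eq[OF g(1,2,4)], rule d_twistor_eq[OF g(1,3) B(1)])
  have resc: "twistor_form (l *s v) x = twistor_form v (cnj l *s x)" for x
  proof -
    have "x = l *s (cnj l *s x)" using l by (simp add: vector_smult_assoc mult.commute)
    then have "twistor_form (l *s v) x = twistor_form (l *s v) (l *s (cnj l *s x))" by simp
    then show ?thesis unfolding twistor_form_smult l1 by simp
  qed
  have d': "d_twistor g' A' = twistor_form v (cnj l *s h g' A')" "d_twistor g' B' = twistor_form v (cnj l *s h g' B')"
    unfolding resc[symmetric] v'[symmetric] h_def
    by (rule d_twistor_eq[OF g'(1,2,4)], rule d_twistor_eq[OF g'(1,3) B(3)])
  have orth: "herm v (h g A) = 0" "herm (right_j v) (h g A) = 0" "herm v (h g' A') = 0" "herm (right_j v) (h g' A') = 0"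
  proof -
    have u: "adj g ** g = mat 1" "quat g" using g(1) by (auto simp: Sp2_iff)
    have rj: "right_j v = g *v axis 2 1"
    proof -
      have "right_j (axis 1 1) = axis 2 1" by (simp add: vec_eq_iff forall_4 right_j_nth axis_def)
      then show ?thesis using u(2) by (simp add: v_def quat_def flip: \<open>right_j (axis 1 1) = axis 2 1\<close>)
    qed
    have a: "herm (g *v axis i 1) (g *v axis k 1) = (adj g ** g) $ i $ k" for i k
      by (simp add: herm_def matrix_vector_axis_nth matrix_mult_nth adj_nth)
    have b: "herm (g *v axis i 1) (g' *v axis k 1) = s $ i $ k" for i k
      by (simp add: s_def herm_def matrix_vector_axis_nth matrix_mult_nth adj_nth)
    show "herm v (h g A) = 0" "herm (right_j v) (h g A) = 0"
      unfolding rj by (simp_all add: v_def h_def herm_add herm_smult a u mat_def)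
    show "herm v (h g' A') = 0" "herm (right_j v) (h g' A') = 0"
      unfolding rj by (simp_all add: v_def h_def herm_add herm_smult b e)
  qed
  have "h g A - cnj l *s h g' A' = 0"
  proof (rule twistor_form_horizontal_inj[of v])
    show "twistor_form v (h g A - cnj l *s h g' A') = 0"
      using eq(2) unfolding d d' bounded_bilinear.diff_right[OF twistor_form_bilinear] by simp
    show "v \<noteq> 0" using frame_nonzero[OF g(1)] by (simp add: v_def)
  qed (simp_all add: herm_diff herm_smult orth)
  then have "h g A = cnj l *s h g' A'" by simp
  then have "h g B = cnj l *s h g' B'" unfolding B by (simp add: vector_smult_assoc mult.commute)
  then show ?thesis by (simp add: d d')
qed

section \<open>The Clifford torus\<close>

text \<open>These are the \<open>l\<close> with \<open>sqrt 2 * l = pi * (m + i n)\<close> for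
  integers m, n of equal parity. The common value \<open>k\<close> is the sign that
  \<open>model_vec\<close> acquires under translation by \<open>l\<close>.\<close>

definition torus_periods :: "complex set" where
  "torus_periods = {l. \<exists>k. (k = 1 \<or> k = -1) \<and> cos (sqrt 2 * Re l) = k \<and> sin (sqrt 2 * Re l) = 0 \<and>
     cos (sqrt 2 * Im l) = k \<and> sin (sqrt 2 * Im l) = 0}"

lemma cos_sin_sign:
  fixes a b k :: real
  assumes "k = 1 \<or> k = -1"
  shows "cos a = k * cos b \<and> sin a = k * sin b \<longleftrightarrow> cos (a - b) = k \<and> sin (a - b) = 0"
proof
  assume *: "cos a = k * cos b \<and> sin a = k * sin b"
  have "cos (a - b) = k * (cos b * cos b) + k * (sin b * sin b)" "sin (a - b) = 0"
    using * by (simp_all add: cos_diff sin_diff mult_ac)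
  then show "cos (a - b) = k \<and> sin (a - b) = 0"
    by (simp only: distrib_left[symmetric] sin_cos_squared_add3 mult_1_right)
next
  assume *: "cos (a - b) = k \<and> sin (a - b) = 0"
  have "cos a = cos ((a - b) + b)" "sin a = sin ((a - b) + b)" by simp_all
  then show "cos a = k * cos b \<and> sin a = k * sin b" unfolding cos_add sin_add using * by simp
qed

lemma torus_periods_iff:
  "x - y \<in> torus_periods \<longleftrightarrow> (\<exists>k. (k = 1 \<or> k = -1) \<and>
     cos (sqrt 2 * Re x) = k * cos (sqrt 2 * Re y) \<and> sin (sqrt 2 * Re x) = k * sin (sqrt 2 * Re y) \<and>
     cos (sqrt 2 * Im x) = k * cos (sqrt 2 * Im y) \<and> sin (sqrt 2 * Im x) = k * sin (sqrt 2 * Im y))"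
proof -
  have e: "sqrt 2 * Re (x - y) = sqrt 2 * Re x - sqrt 2 * Re y" "sqrt 2 * Im (x - y) = sqrt 2 * Im x - sqrt 2 * Im y"
    by (simp_all add: algebra_simps)
  show ?thesis
    unfolding torus_periods_def mem_Collect_eq e
    using cos_sin_sign[of _ "sqrt 2 * Re x" "sqrt 2 * Re y"] cos_sin_sign[of _ "sqrt 2 * Im x" "sqrt 2 * Im y"] by metis
qed

text \<open>A point of the torus determines the four products of \<open>cos X\<close>,
  \<open>sin X\<close> with \<open>cos Y\<close>, \<open>sin Y\<close>, that is, two unit vectors up
  to a common sign. This sign is recovered as \<open>cos (X - X')\<close>.\<close>

lemma torus_map_eq_iff: "torus_map x = torus_map y \<longleftrightarrow> x - y \<in> torus_periods"
proof
  define X Y X' Y' where XY: "X = sqrt 2 * Re x" "Y = sqrt 2 * Im x" "X' = sqrt 2 * Re y" "Y' = sqrt 2 * Im y"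
  assume "torus_map x = torus_map y"
  then have "(rcos X + \<i> * rsin X) * (rcos Y + rsin Y) = (rcos X' + \<i> * rsin X') * (rcos Y' + rsin Y')"
    "(rcos X + \<i> * rsin X) * (rsin Y - rcos Y) = (rcos X' + \<i> * rsin X') * (rsin Y' - rcos Y')"
    by (simp_all add: torus_map_def Let_def XY)
  then have e: "cos X * (cos Y + sin Y) = cos X' * (cos Y' + sin Y')" "sin X * (cos Y + sin Y) = sin X' * (cos Y' + sin Y')"
    "cos X * (sin Y - cos Y) = cos X' * (sin Y' - cos Y')" "sin X * (sin Y - cos Y) = sin X' * (sin Y' - cos Y')"
    by (simp_all add: complex_eq_iff)
  have c: "cos X * cos Y = cos X' * cos Y'" "sin X * cos Y = sin X' * cos Y'"
    "cos X * sin Y = cos X' * sin Y'" "sin X * sin Y = sin X' * sin Y'"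
    using e by (simp_all add: algebra_simps)
  define k where "k = cos (X - X')"
  have "sin (X - X') * cos Y = (sin X * cos Y) * cos X' - (cos X * cos Y) * sin X'"
    "sin (X - X') * sin Y = (sin X * sin Y) * cos X' - (cos X * sin Y) * sin X'"
    by (simp_all add: sin_diff algebra_simps)
  then have "sin (X - X') * cos Y = 0" "sin (X - X') * sin Y = 0" unfolding c by (simp_all add: algebra_simps)
  then have s0: "sin (X - X') = 0" using sin_zero_iff_int2 sin_cos_squared_add3[of Y] by fastforce
  have k1: "k = 1 \<or> k = -1"
    using sin_cos_squared_add[of "X - X'"] s0 by (simp add: k_def power2_eq_1_iff)
  have "k * cos Y = (cos X * cos Y) * cos X' + (sin X * cos Y) * sin X'"
    "k * sin Y = (cos X * sin Y) * cos X' + (sin X * sin Y) * sin X'"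
    by (simp_all add: k_def cos_diff algebra_simps)
  then have "k * cos Y = cos Y' * (cos X' * cos X' + sin X' * sin X')" "k * sin Y = sin Y' * (cos X' * cos X' + sin X' * sin X')"
    unfolding c by (simp_all only: algebra_simps)
  then have "k * cos Y = cos Y'" "k * sin Y = sin Y'" by (simp_all add: sin_cos_squared_add3)
  then have "cos Y = k * cos Y'" "sin Y = k * sin Y'" using k1 by auto
  moreover have "cos X = k * cos X' \<and> sin X = k * sin X'" using cos_sin_sign[OF k1, of X X'] s0 by (simp add: k_def)
  ultimately show "x - y \<in> torus_periods" unfolding torus_periods_iff XY[symmetric] using k1 by blast
next
  assume "x - y \<in> torus_periods"
  then obtain k where "k = 1 \<or> k = -1"
     "cos (sqrt 2 * Re x) = k * cos (sqrt 2 * Re y)" "sin (sqrt 2 * Re x) = k * sin (sqrt 2 * Re y)"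
     "cos (sqrt 2 * Im x) = k * cos (sqrt 2 * Im y)" "sin (sqrt 2 * Im x) = k * sin (sqrt 2 * Im y)"
    unfolding torus_periods_iff by blast
  then show "torus_map x = torus_map y"
    by (elim disjE) (simp_all add: torus_map_def Let_def algebra_simps)
qed

lemma model_curve_periodic:
  assumes "x - y \<in> torus_periods"
  shows "model_curve x = model_curve y"
proof -
  obtain k where k: "k = 1 \<or> k = -1"
     "cos (sqrt 2 * Re x) = k * cos (sqrt 2 * Re y)" "sin (sqrt 2 * Re x) = k * sin (sqrt 2 * Re y)"
     "cos (sqrt 2 * Im x) = k * cos (sqrt 2 * Im y)" "sin (sqrt 2 * Im x) = k * sin (sqrt 2 * Im y)"
    using assms unfolding torus_periods_iff by blast
  have "model_vec x = of_real k *s model_vec y"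
    unfolding vec_eq_iff forall_4 model_vec_def Let_def vector_smult_component vector_4 k(2-5)
    by (simp add: algebra_simps)
  then show ?thesis using k(1) line_scale[of "of_real k" "model_vec y"] by (auto simp: model_curve_def)
qed

text \<open>The twistor projection separates the points of the model curve, which is what makes
  \<open>torus_lift\<close> well defined.\<close>

lemma torus_map_eq_imp: "torus_map x = torus_map y \<Longrightarrow> model_curve x = model_curve y"
  using torus_map_eq_iff model_curve_periodic by blast

lemma torus_periods_discrete:
  assumes "l \<in> torus_periods" "cmod l < 1"
  shows "l = 0"
proof -
  \<comment> \<open>In the open unit disc both angles then lie strictly between -pi and pi, where 0
    is the only zero of the sine.\<close>
  have "sqrt 2 < pi" using pi_gt3 sqrt2_less_2 by linarith
  have b: "- pi < sqrt 2 * x \<and> sqrt 2 * x < pi" if "\<bar>x\<bar> \<le> cmod l" for x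
  proof -
    have "\<bar>sqrt 2 * x\<bar> < sqrt 2 * 1" using that assms(2) by (simp add: abs_mult)
    then show ?thesis using \<open>sqrt 2 < pi\<close> by linarith
  qed
  have "sin (sqrt 2 * Re l) = 0" "sin (sqrt 2 * Im l) = 0" using assms(1) by (auto simp: torus_periods_def)
  then have "sqrt 2 * Re l = 0" "sqrt 2 * Im l = 0"
    using b[of "Re l"] b[of "Im l"] abs_Re_le_cmod[of l] abs_Im_le_cmod[of l] sin_eq_0_pi by blast+
  then show ?thesis by (simp add: complex_eq_iff)
qed

text \<open>Both angles can be taken in \<open>[0, 2 pi)\<close>, and dividing by sqrt 2 keeps the
  point in the box. The box is the compact set for \<open>covering_space_periods\<close>.\<close>

lemma ex_fundamental:
  obtains \<zeta> where "cos (sqrt 2 * Re \<zeta>) = cos X" "sin (sqrt 2 * Re \<zeta>) = sin X"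
    "cos (sqrt 2 * Im \<zeta>) = cos Y" "sin (sqrt 2 * Im \<zeta>) = sin Y" "\<zeta> \<in> cbox 0 (Complex (2 * pi) (2 * pi))"
proof -
  obtain X' where X: "0 \<le> X'" "X' < 2 * pi" "cos X = cos X'" "sin X = sin X'"
    using sincos_total_2pi[of "cos X" "sin X"] sin_cos_squared_add2[of X] by metis
  obtain Y' where Y: "0 \<le> Y'" "Y' < 2 * pi" "cos Y = cos Y'" "sin Y = sin Y'"
    using sincos_total_2pi[of "cos Y" "sin Y"] sin_cos_squared_add2[of Y] by metis
  have "x / sqrt 2 \<le> x" if "0 \<le> x" for x :: real
    using that by (simp add: divide_le_eq mult_le_cancel_left1)
  then have b: "X' / sqrt 2 \<le> 2 * pi" "Y' / sqrt 2 \<le> 2 * pi" using X Y by (meson less_imp_le order_trans)+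
  show ?thesis
    by (rule that[of "Complex (X' / sqrt 2) (Y' / sqrt 2)"]) (simp_all add: b X Y in_cbox_complex_iff)
qed

lemma torus_map_compact: "torus_map ` cbox 0 (Complex (2 * pi) (2 * pi)) = range torus_map"
proof (intro equalityI subsetI)
  fix y assume "y \<in> range torus_map"
  then obtain x where x: "y = torus_map x" by blast
  obtain \<zeta> where "cos (sqrt 2 * Re \<zeta>) = cos (sqrt 2 * Re x)" "sin (sqrt 2 * Re \<zeta>) = sin (sqrt 2 * Re x)"
    "cos (sqrt 2 * Im \<zeta>) = cos (sqrt 2 * Im x)" "sin (sqrt 2 * Im \<zeta>) = sin (sqrt 2 * Im x)"
    "\<zeta> \<in> cbox 0 (Complex (2 * pi) (2 * pi))" using ex_fundamental .
  moreover from this have "torus_map \<zeta> = y" unfolding x torus_map_def Let_def by simp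
  ultimately show "y \<in> torus_map ` cbox 0 (Complex (2 * pi) (2 * pi))" by blast
qed auto

lemma torus_map_range: "range torus_map = T11"
proof (intro equalityI subsetI)
  fix y assume "y \<in> range torus_map"
  then obtain x where x: "y = torus_map x" by blast
  define X Y where XY: "X = sqrt 2 * Re x" "Y = sqrt 2 * Im x"
  define E a b where "E = rcos X + \<i> * rsin X" and "a = (cos Y + sin Y) / sqrt 2" and "b = (sin Y - cos Y) / sqrt 2"
  have y: "y = (E * of_real a, E * of_real b, 0)"
    by (simp add: x torus_map_def Let_def XY[symmetric] E_def a_def b_def)
  have E: "cmod E = 1" by (simp add: E_def cmod_def)
  have "a\<^sup>2 + b\<^sup>2 = ((cos Y)\<^sup>2 + (sin Y)\<^sup>2)"
    by (simp add: a_def b_def power_divide power2_sum power2_diff flip: add_divide_distrib)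
  then have "(cmod (E * of_real a))\<^sup>2 + (cmod (E * of_real b))\<^sup>2 = 1"
    using E by (simp add: norm_mult)
  moreover have "E * of_real a * cnj (E * of_real b) = of_real (a * b)"
    using mult_cnj_eq_cmod[of E] E by (simp add: mult_ac)
  then have "Im (E * of_real a * cnj (E * of_real b)) = 0" by (metis Im_complex_of_real)
  ultimately show "y \<in> T11" unfolding T11_def y by blast
next
  fix y assume "y \<in> T11"
  then obtain z w where zw: "y = (z, w, 0)" "(cmod z)\<^sup>2 + (cmod w)\<^sup>2 = 1" "Im (z * cnj w) = 0"
    unfolding T11_def by blast
  \<comment> \<open>Vanishing of the imaginary part means that \<open>z\<close> and \<open>w\<close>
    are real multiples of a common unit.\<close>
  obtain E a b where E: "cmod E = 1" "z = E * of_real a" "w = E * of_real b"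
  proof (cases "w = 0")
    case True
    then have "cmod z = 1" using zw(2) norm_ge_zero[of z] by (simp add: power2_eq_1_iff)
    then show ?thesis using that[of z 1 0] True by simp
  next
    case False
    have "z * cnj w = of_real (Re (z * cnj w))" using zw(3) by (simp add: complex_eq_iff)
    then have "z * (cnj w * w) = of_real (Re (z * cnj w)) * w" by (metis mult.assoc)
    then have "z = w / of_real (cmod w) * of_real (Re (z * cnj w) / cmod w)"
      using False unfolding mult_cnj_eq_cmod by (simp add: field_simps power2_eq_square)
    moreover have "w = w / of_real (cmod w) * of_real (cmod w)" "cmod (w / of_real (cmod w)) = 1"
      using False by (simp_all add: norm_divide)
    ultimately show ?thesis using that by blast
  qed
  have ab: "a\<^sup>2 + b\<^sup>2 = 1" using zw(2) E by (simp add: norm_mult)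
  obtain X where X: "cos X = Re E" "sin X = Im E"
    using sincos_total_2pi[of "Re E" "Im E"] E(1) by (metis cmod_power2 one_power2)
  have "((a - b) / sqrt 2)\<^sup>2 + ((a + b) / sqrt 2)\<^sup>2 = 1"
    using ab by (simp add: power_divide power2_sum power2_diff flip: add_divide_distrib)
  \<comment> \<open>This undoes the rotation by pi/4 between \<open>(a, b)\<close> and
    \<open>(cos Y, sin Y)\<close>.\<close>
  then obtain Y where Y: "cos Y = (a - b) / sqrt 2" "sin Y = (a + b) / sqrt 2"
    using sincos_total_2pi by metis
  obtain \<zeta> where \<zeta>: "cos (sqrt 2 * Re \<zeta>) = cos X" "sin (sqrt 2 * Re \<zeta>) = sin X"
    "cos (sqrt 2 * Im \<zeta>) = cos Y" "sin (sqrt 2 * Im \<zeta>) = sin Y" using ex_fundamental by metis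
  have s: "cos Y + sin Y = sqrt 2 * a" "sin Y - cos Y = sqrt 2 * b"
    unfolding Y by (simp_all add: field_simps flip: add_divide_distrib diff_divide_distrib)
  have EE: "rcos X + \<i> * rsin X = E" by (simp add: X complex_eq_iff)
  have "rcos Y + rsin Y = of_real (sqrt 2 * a)" "rsin Y - rcos Y = of_real (sqrt 2 * b)"
    using s by (metis of_real_add, metis of_real_diff)
  then have "torus_map \<zeta> = (E * of_real a, E * of_real b, 0)"
    unfolding torus_map_def Let_def \<zeta> EE by simp
  then show "y \<in> range torus_map" using zw(1) E by (metis rangeI)
qed

lemma continuous_on_torus_map: "continuous_on S torus_map"
  using torus_map_derivative has_derivative_continuous continuous_at_imp_continuous_on by blast

lemma covering_space_torus_map: "covering_space UNIV torus_map T11"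
  unfolding torus_map_range[symmetric]
  by (rule covering_space_periods[OF continuous_on_torus_map torus_map_eq_iff zero_less_one torus_periods_discrete compact_cbox torus_map_compact])

section \<open>The twistor lift of \<open>T11\<close>\<close>

definition torus_lift :: "R5 \<Rightarrow> cp3" where
  "torus_lift y = model_curve (SOME \<zeta>. torus_map \<zeta> = y)"

lemma torus_lift_eq: "torus_lift (torus_map \<zeta>) = model_curve \<zeta>"
  unfolding torus_lift_def by (rule torus_map_eq_imp, rule someI[of _ \<zeta>]) simp

lemma torus_lift_image: "torus_lift ` T11 = range model_curve"
  unfolding torus_map_range[symmetric] by (auto simp: torus_lift_eq image_image)

text \<open>A covering is an open map, so continuity of \<open>model_curve\<close> descends along
  \<open>torus_map\<close>.\<close>

lemma continuous_on_torus_lift: "continuous_on T11 torus_lift"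
proof -
  have "openin (top_of_set T11) (T11 \<inter> torus_lift -` B)" if "open B" for B
  proof -
    have "T11 \<inter> torus_lift -` B = torus_map ` (model_curve -` B)"
      unfolding torus_map_range[symmetric] by (auto simp: torus_lift_eq)
    moreover have "open (model_curve -` B)"
      using continuous_on_model_curve[of UNIV] that by (simp add: continuous_on_open_vimage)
    ultimately show ?thesis using covering_space_open_map[OF covering_space_torus_map, of "model_curve -` B"] by simp
  qed
  then show ?thesis by (simp add: continuous_on_open_gen[where T=UNIV] continuous_openin_preimage_eq)
qed

text \<open>\<open>model_form\<close> with its diagonal 2 by 2 blocks removed, which leaves the
  horizontal part of the velocity of the model.\<close>

definition horizontal_form :: "complex \<Rightarrow> complex^4^4" where
  "horizontal_form u = (let k = \<i> / of_real (sqrt 2) in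
     vector [vector [0, 0, k * cnj u, 0],
             vector [0, 0, 0, - k * u],
             vector [k * u, 0, 0, 0],
             vector [0, - k * cnj u, 0, 0]])"

lemma horizontal_form_lie: "horizontal_form u \<in> lie_sp2"
  by (simp add: lie_sp2_iff quat_iff adj_def vec_eq_iff forall_4 horizontal_form_def Let_def vector_4)

lemma horizontal_form_entries:
  "horizontal_form u $ 2 $ 1 = 0" "horizontal_form u $ 3 $ 1 = \<i> / of_real (sqrt 2) * u" "horizontal_form u $ 4 $ 1 = 0"
  by (simp_all add: horizontal_form_def Let_def vector_4)

text \<open>The velocity of the model is a multiple of \<open>right_j v\<close>, which the
  projection kills, plus the vector represented by \<open>horizontal_form u\<close>.\<close>

lemma d_twistor_horizontal_form: "d_twistor (model_frame \<zeta>) (horizontal_form u) = torus_velocity \<zeta> u"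
proof -
  define v where "v = model_vec \<zeta>"
  define w where "w = model_frame \<zeta> *v axis 3 1"
  define k where "k = \<i> / complex_of_real (sqrt 2)"
  have dec: "(model_frame \<zeta> ** model_form u) *v axis 1 1 = (k * cnj u) *s right_j v + (k * u) *s w"
    by (simp add: vec_eq_iff matrix_vector_axis_nth matrix_mult_nth model_form_entries v_def w_def k_def
        model_frame_def quat_columns_nth mult.commute)
  have "herm v w = (adj (model_frame \<zeta>) ** model_frame \<zeta>) $ 1 $ 3"
    by (simp add: v_def w_def herm_def matrix_vector_axis_nth matrix_mult_nth adj_nth model_frame_def quat_columns_nth)
  then have "herm v w = 0" using model_frame_Sp2[of \<zeta>] by (simp add: Sp2_iff mat1_entries)
  then have h: "herm v ((k * cnj u) *s right_j v + (k * u) *s w) = 0"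
    by (simp add: herm_add herm_smult herm_right_j)
  have "torus_velocity \<zeta> u = twistor_form v ((k * cnj u) *s right_j v + (k * u) *s w)"
    unfolding torus_velocity_eq dec v_def[symmetric] h by simp
  also have "\<dots> = twistor_form v ((k * u) *s w)"
    by (simp add: bounded_bilinear.add_right[OF twistor_form_bilinear] twistor_form_vertical(1))
  also have "\<dots> = d_twistor (model_frame \<zeta>) (horizontal_form u)"
    using d_twistor_eq[OF model_frame_Sp2 horizontal_form_lie, of u \<zeta>]
    by (simp add: \<omega>3_def horizontal_form_entries model_vec_axis v_def w_def k_def)
  finally show ?thesis by simp
qed

text \<open>\<open>horizontal_form u\<close> is a horizontal lift of the torus velocity, and J
  multiplies its parameter by i. Consequently the tangent planes of the torus are preserved.\<close>

lemma twistor_acs_model: "twistor_acs (model_curve \<zeta>) (torus_velocity \<zeta> u) = torus_velocity \<zeta> (\<i> * u)"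
proof -
  have J: "is_J (horizontal_form u) (horizontal_form (\<i> * u))"
    by (simp add: is_J_def \<omega>1_def \<omega>2_def \<omega>3_def horizontal_form_entries)
  have o: "\<omega>3 (horizontal_form u) = 0" by (simp add: \<omega>3_def horizontal_form_entries)
  show ?thesis
    unfolding twistor_acs_def
  proof (rule the_equality)
    show "\<exists>g\<in>Sp2. \<exists>A\<in>lie_sp2. \<exists>B\<in>lie_sp2. base_point g = model_curve \<zeta> \<and> \<omega>3 A = 0 \<and> is_J A B \<and>
        torus_velocity \<zeta> u = d_twistor g A \<and> torus_velocity \<zeta> (\<i> * u) = d_twistor g B"
      using J o model_frame_Sp2 horizontal_form_lie base_point_model_frame d_twistor_horizontal_form by metis
    fix Y assume "\<exists>g\<in>Sp2. \<exists>A\<in>lie_sp2. \<exists>B\<in>lie_sp2. base_point g = model_curve \<zeta> \<and> \<omega>3 A = 0 \<and> is_J A B \<and>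
        torus_velocity \<zeta> u = d_twistor g A \<and> Y = d_twistor g B"
    then obtain g A B where gAB: "g \<in> Sp2" "A \<in> lie_sp2" "B \<in> lie_sp2" "base_point g = model_curve \<zeta>" "\<omega>3 A = 0" "is_J A B"
      "torus_velocity \<zeta> u = d_twistor g A" "Y = d_twistor g B" by blast
    have "d_twistor g B = d_twistor (model_frame \<zeta>) (horizontal_form (\<i> * u))"
      by (rule d_twistor_J_unique[OF gAB(1,2,3,5,6) model_frame_Sp2 horizontal_form_lie horizontal_form_lie o J])
        (use gAB in \<open>simp_all add: base_point_model_frame d_twistor_horizontal_form\<close>)
    then show "Y = torus_velocity \<zeta> (\<i> * u)" by (simp add: gAB d_twistor_horizontal_form)
  qed
qed

lemma torus_velocity_tangent: "torus_velocity \<zeta> u \<in> tangent_space T11 (torus_map \<zeta>)"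
proof -
  have L: "torus_velocity \<zeta> (of_real s * u) = s *\<^sub>R torus_velocity \<zeta> u" for s
    by (simp add: torus_velocity_def Let_def scaleR_conv_of_real algebra_simps)
  have "((\<lambda>t. torus_map (\<zeta> + of_real t * u)) has_derivative (\<lambda>s. torus_velocity \<zeta> (of_real s * u))) (at 0)"
  proof (rule has_derivative_compose[where g=torus_map and f="\<lambda>t. \<zeta> + of_real t * u"])
    show "((\<lambda>t. \<zeta> + of_real t * u) has_derivative (\<lambda>s. of_real s * u)) (at 0)"
      by (auto intro!: derivative_eq_intros)
    show "(torus_map has_derivative torus_velocity \<zeta>) (at (\<zeta> + of_real 0 * u))" by (simp add: torus_map_derivative)
  qed
  then have "((\<lambda>t. torus_map (\<zeta> + of_real t * u)) has_vector_derivative torus_velocity \<zeta> u) (at 0)"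
    by (simp add: has_vector_derivative_def L)
  moreover have "range (\<lambda>t. torus_map (\<zeta> + of_real t * u)) \<subseteq> T11" using torus_map_range by blast
  ultimately show ?thesis
    unfolding tangent_space_def by (intro CollectI exI[of _ "\<lambda>t. torus_map (\<zeta> + of_real t * u)"]) simp
qed

text \<open>The torus is cut out of 5-space by one linear and two quadratic equations;
  differentiating them along a curve leaves exactly the plane of torus velocities.\<close>

lemma tangent_T11:
  assumes "Y \<in> tangent_space T11 (torus_map \<zeta>)"
  obtains u where "Y = torus_velocity \<zeta> u"
proof -
  obtain c where c: "range c \<subseteq> T11" "c 0 = torus_map \<zeta>" "(c has_vector_derivative Y) (at 0)"
    using assms unfolding tangent_space_def by blast
  obtain Y1 Y2 Y3 where Y: "Y = (Y1, Y2, Y3)" by (metis prod_cases3)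
  define z w r where "z = (\<lambda>t. fst (c t))" and "w = (\<lambda>t. fst (snd (c t)))" and "r = (\<lambda>t. snd (snd (c t)))"
  have d: "(c has_derivative (\<lambda>s. s *\<^sub>R Y)) (at 0)" using c(3) by (simp add: has_vector_derivative_def)
  have dz: "(z has_derivative (\<lambda>s. s *\<^sub>R Y1)) (at 0)" and dw: "(w has_derivative (\<lambda>s. s *\<^sub>R Y2)) (at 0)"
    and dr: "(r has_derivative (\<lambda>s. s *\<^sub>R Y3)) (at 0)"
    using has_derivative_fst[OF d] has_derivative_fst[OF has_derivative_snd[OF d]] has_derivative_snd[OF has_derivative_snd[OF d]]
    by (simp_all add: Y z_def w_def r_def)
  have T: "z t \<bullet> z t + w t \<bullet> w t = 1" "Im (z t * cnj (w t)) = 0" "r t = 0" for t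
  proof -
    have "c t \<in> T11" using c(1) by blast
    then show "z t \<bullet> z t + w t \<bullet> w t = 1" "Im (z t * cnj (w t)) = 0" "r t = 0"
      by (auto simp: T11_def z_def w_def r_def dot_square_norm)
  qed
  have "r = (\<lambda>t. 0)" using T(3) by auto
  then have "(r has_derivative (\<lambda>s. 0)) (at 0)" by simp
  with dr have "(\<lambda>s. s *\<^sub>R Y3) = (\<lambda>s. 0)" by (rule has_derivative_unique)
  then have Y3: "Y3 = 0" using fun_cong[of "\<lambda>s. s *\<^sub>R Y3" "\<lambda>s. 0" 1] by simp
  have "((\<lambda>t. z t \<bullet> z t + w t \<bullet> w t) has_derivative (\<lambda>s. (z 0 \<bullet> s *\<^sub>R Y1 + s *\<^sub>R Y1 \<bullet> z 0) + (w 0 \<bullet> s *\<^sub>R Y2 + s *\<^sub>R Y2 \<bullet> w 0))) (at 0)"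
    by (intro has_derivative_add has_derivative_inner dz dw)
  then have "((\<lambda>t. 1) has_derivative (\<lambda>s. (z 0 \<bullet> s *\<^sub>R Y1 + s *\<^sub>R Y1 \<bullet> z 0) + (w 0 \<bullet> s *\<^sub>R Y2 + s *\<^sub>R Y2 \<bullet> w 0))) (at (0::real))"
    by (simp only: T(1))
  from fun_cong[OF has_derivative_unique[OF this has_derivative_const], of 1]
  have e1: "z 0 \<bullet> Y1 + w 0 \<bullet> Y2 = 0" by (simp add: inner_commute)
  have "((\<lambda>t. Im (z t * cnj (w t))) has_derivative (\<lambda>s. Im (z 0 * cnj (s *\<^sub>R Y2) + s *\<^sub>R Y1 * cnj (w 0)))) (at 0)"
    by (intro bounded_linear.has_derivative[OF bounded_linear_Im] has_derivative_mult dz bounded_linear.has_derivative[OF bounded_linear_cnj] dw)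
  then have "((\<lambda>t. 0) has_derivative (\<lambda>s. Im (z 0 * cnj (s *\<^sub>R Y2) + s *\<^sub>R Y1 * cnj (w 0)))) (at (0::real))"
    by (simp only: T(2))
  from fun_cong[OF has_derivative_unique[OF this has_derivative_const], of 1]
  have e2: "Im (z 0 * cnj Y2 + Y1 * cnj (w 0)) = 0" by simp
  define X Yr where XY: "X = sqrt 2 * Re \<zeta>" "Yr = sqrt 2 * Im \<zeta>"
  define E a b where "E = rcos X + \<i> * rsin X" and "a = cos Yr + sin Yr" and "b = sin Yr - cos Yr"
  have zw: "sqrt 2 *\<^sub>R z 0 = E * of_real a" "sqrt 2 *\<^sub>R w 0 = E * of_real b"
    using c(2) by (simp_all add: z_def w_def torus_map_def Let_def XY[symmetric] E_def a_def b_def scaleR_conv_of_real)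
  have ab: "a * a + b * b = 2" using sin_cos_squared_add3[of Yr] by (simp add: a_def b_def algebra_simps)
  have EE: "cnj E * E = 1" using rcos_rsin[of X] by (simp add: E_def algebra_simps)
  define P Q where "P = cnj E * Y1" and "Q = cnj E * Y2"
  have EP: "E * P = Y1" "E * Q = Y2" using EE by (simp_all add: P_def Q_def flip: mult.assoc) (simp_all add: mult.commute)
  have "sqrt 2 * (z 0 \<bullet> Y1 + w 0 \<bullet> Y2) = (sqrt 2 *\<^sub>R z 0) \<bullet> Y1 + (sqrt 2 *\<^sub>R w 0) \<bullet> Y2"
    by (simp add: algebra_simps)
  also have "\<dots> = a * Re P + b * Re Q"
    unfolding zw by (simp add: inner_complex_def P_def Q_def algebra_simps)
  finally have f1: "a * Re P + b * Re Q = 0" using e1 by simp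
  have "sqrt 2 * Im (z 0 * cnj Y2 + Y1 * cnj (w 0)) = Im ((sqrt 2 *\<^sub>R z 0) * cnj Y2 + Y1 * cnj (sqrt 2 *\<^sub>R w 0))"
    by (simp add: algebra_simps)
  also have "\<dots> = b * Im P - a * Im Q"
    unfolding zw by (simp add: P_def Q_def algebra_simps)
  finally have f2: "b * Im P - a * Im Q = 0" using e2 by simp
  \<comment> \<open>The solution of \<open>P = i a Re u - b Im u\<close> and
    \<open>Q = i b Re u + a Im u\<close>; the divisor 2 is \<open>a^2 + b^2\<close>.\<close>
  define u where "u = Complex ((a * Im P + b * Im Q) / 2) ((a * Re Q - b * Re P) / 2)"
  have "2 * Re P = (a * a + b * b) * Re P" unfolding ab ..
  also have "\<dots> = a * (a * Re P) + b * (b * Re P)" by (simp add: algebra_simps)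
  also have "a * Re P = - (b * Re Q)" using f1 by simp
  finally have p1: "Re P = - b * Im u" by (simp add: u_def algebra_simps)
  have "2 * Re Q = (a * a + b * b) * Re Q" unfolding ab ..
  also have "\<dots> = a * (a * Re Q) + b * (b * Re Q)" by (simp add: algebra_simps)
  also have "b * Re Q = - (a * Re P)" using f1 by simp
  finally have q1: "Re Q = a * Im u" by (simp add: u_def algebra_simps)
  have "2 * Im P = (a * a + b * b) * Im P" unfolding ab ..
  also have "\<dots> = a * (a * Im P) + b * (b * Im P)" by (simp add: algebra_simps)
  also have "b * Im P = a * Im Q" using f2 by simp
  finally have p2: "Im P = a * Re u" by (simp add: u_def algebra_simps)
  have "2 * Im Q = (a * a + b * b) * Im Q" unfolding ab ..
  also have "\<dots> = a * (a * Im Q) + b * (b * Im Q)" by (simp add: algebra_simps)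
  also have "a * Im Q = b * Im P" using f2 by simp
  finally have q2: "Im Q = b * Re u" by (simp add: u_def algebra_simps)
  have "P = \<i> * of_real a * of_real (Re u) + of_real (- b) * of_real (Im u)" "Q = \<i> * of_real b * of_real (Re u) + of_real a * of_real (Im u)"
    by (simp_all add: complex_eq_iff p1 p2 q1 q2)
  then have "Y = torus_velocity \<zeta> u"
    unfolding Y torus_velocity_def Let_def XY[symmetric] E_def[symmetric] EP[symmetric]
    by (simp add: Y3 a_def b_def)
  then show ?thesis by (rule that)
qed

lemma twistor_lift_torus_lift: "twistor_lift T11 torus_lift"
  unfolding twistor_lift_def
proof (intro conjI ballI continuous_on_torus_lift)
  fix y assume "y \<in> T11"
  then obtain \<zeta> where y: "y = torus_map \<zeta>" unfolding torus_map_range[symmetric] by blast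
  show "twistor_proj (torus_lift y) = y" by (simp add: y torus_lift_eq twistor_proj_model)
  show "twistor_acs (torus_lift y) ` tangent_space T11 y \<subseteq> tangent_space T11 y"
  proof (rule image_subsetI)
    fix Y assume "Y \<in> tangent_space T11 y"
    then obtain u where "Y = torus_velocity \<zeta> u" unfolding y by (rule tangent_T11)
    then show "twistor_acs (torus_lift y) Y \<in> tangent_space T11 y"
      by (simp add: y torus_lift_eq twistor_acs_model torus_velocity_tangent)
  qed
qed

lemma clifford_torus_model: "g \<in> Sp2 \<Longrightarrow> clifford_torus (range (\<lambda>\<zeta>. act g (model_curve \<zeta>)))"
  unfolding clifford_torus_def
  by (intro exI[of _ torus_lift] bexI[of _ g] conjI twistor_lift_torus_lift) (simp_all add: torus_lift_image image_image)

lemma continuous_on_twistor_proj: "continuous_on S twistor_proj"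
proof (rule continuous_on_cp3)
  have "continuous_on {v. v \<noteq> 0} twistor_vec"
  proof -
    have "continuous_on UNIV (\<lambda>v. twistor_form v v)"
      using bounded_bilinear.continuous_on[OF twistor_form_bilinear continuous_on_id continuous_on_id] by simp
    then show ?thesis unfolding twistor_vec_eq[abs_def]
      by (intro continuous_intros) (auto intro: continuous_on_subset)
  qed
  then show "continuous_on {v. v \<noteq> 0} (\<lambda>v. twistor_proj (line v))"
    by (rule continuous_on_eq) (simp add: twistor_proj_line)
qed

text \<open>Lifting and then acting by \<open>g\<close> is a homeomorphism from \<open>T11\<close>
  to the image, inverted by undoing \<open>g\<close> and projecting. The covering
  \<open>torus_map\<close> is carried along it.\<close>

lemma universal_cover_model:
  assumes g: "g \<in> Sp2"
  shows "universal_cover (\<lambda>\<zeta>. act g (model_curve \<zeta>)) (range (\<lambda>\<zeta>. act g (model_curve \<zeta>)))"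
proof -
  let ?T = "range (\<lambda>\<zeta>. act g (model_curve \<zeta>))"
  have inv: "twistor_proj (act (adj g) (act g (model_curve \<zeta>))) = torus_map \<zeta>" for \<zeta>
    using g by (simp add: act_act Sp2_iff[of g] act_mat1 twistor_proj_model)
  have "homeomorphism T11 ?T (\<lambda>y. act g (torus_lift y)) (\<lambda>q. twistor_proj (act (adj g) q))"
  proof (rule homeomorphismI)
    show "continuous_on T11 (\<lambda>y. act g (torus_lift y))"
      by (rule continuous_on_compose2[OF continuous_on_act[OF g, of UNIV] continuous_on_torus_lift]) simp
    show "continuous_on ?T (\<lambda>q. twistor_proj (act (adj g) q))"
      by (rule continuous_on_compose2[OF continuous_on_twistor_proj[of UNIV] continuous_on_act[OF Sp2_adj[OF g]]]) simp
    show "(\<lambda>y. act g (torus_lift y)) ` T11 \<subseteq> ?T" unfolding torus_map_range[symmetric] by (auto simp: torus_lift_eq)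
    show "(\<lambda>q. twistor_proj (act (adj g) q)) ` ?T \<subseteq> T11" unfolding torus_map_range[symmetric] by (auto simp: inv)
    show "twistor_proj (act (adj g) (act g (torus_lift y))) = y" if "y \<in> T11" for y
      using that unfolding torus_map_range[symmetric] by (auto simp: inv torus_lift_eq)
    show "act g (torus_lift (twistor_proj (act (adj g) q))) = q" if "q \<in> ?T" for q
      using that by (auto simp: inv torus_lift_eq)
  qed
  from covering_space_compose_homeomorphism[OF covering_space_torus_map this]
  have "covering_space UNIV (\<lambda>\<zeta>. act g (model_curve \<zeta>)) ?T" by (simp add: o_def torus_lift_eq)
  then show ?thesis using J_holomorphic_model[OF g] by (simp add: universal_cover_def)
qed

section \<open>Completeness\<close>

context
  fixes h :: "complex \<Rightarrow> complex"
  assumes hol: "h holomorphic_on UNIV" and dh: "\<And>z. deriv h z \<noteq> 0"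
begin

lemma local_section:
  obtains r q where "r > 0" "q holomorphic_on ball (h z) r" "q (h z) = z" "\<And>w. w \<in> ball (h z) r \<Longrightarrow> h (q w) = w"
proof -
  obtain s where s: "s > 0" "inj_on h (ball z s)"
    using has_complex_derivative_locally_injective[OF hol UNIV_I open_UNIV dh] by metis
  have hs: "h holomorphic_on ball z s" using hol by (rule holomorphic_on_subset) simp
  obtain q where q: "q holomorphic_on (h ` ball z s)" "\<And>x. x \<in> ball z s \<Longrightarrow> q (h x) = x"
    using holomorphic_has_inverse[OF hs open_ball s(2)] by metis
  have "open (h ` ball z s)"
    by (rule invariance_of_domain[OF holomorphic_on_imp_continuous_on[OF hs] open_ball s(2)])
  moreover have "h z \<in> h ` ball z s" using s(1) by simp
  ultimately obtain r where r: "r > 0" "ball (h z) r \<subseteq> h ` ball z s" using open_contains_ball by blast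
  show ?thesis
  proof (rule that[OF r(1) holomorphic_on_subset[OF q(1) r(2)]])
    show "q (h z) = z" using q(2) s(1) by simp
    fix w assume "w \<in> ball (h z) r"
    then obtain x where "x \<in> ball z s" "w = h x" using r(2) by blast
    then show "h (q w) = w" using q(2) by simp
  qed
qed

text \<open>Agreement at one point spreads to a neighbourhood by local injectivity of
  \<open>h\<close>, and to all of \<open>C\<close> by the identity theorem.\<close>

lemma section_unique:
  assumes "open C" "connected C" "k1 holomorphic_on C" "k2 holomorphic_on C"
    "\<And>w. w \<in> C \<Longrightarrow> h (k1 w) = w" "\<And>w. w \<in> C \<Longrightarrow> h (k2 w) = w" "a \<in> C" "k1 a = k2 a" "w \<in> C"
  shows "k1 w = k2 w"
proof -
  obtain s where s: "s > 0" "inj_on h (ball (k1 a) s)"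
    using has_complex_derivative_locally_injective[OF hol UNIV_I open_UNIV dh] by metis
  have c: "continuous_on C k1" "continuous_on C k2" using assms holomorphic_on_imp_continuous_on by blast+
  define N where "N = (C \<inter> k1 -` ball (k1 a) s) \<inter> (C \<inter> k2 -` ball (k1 a) s)"
  have N: "open N" unfolding N_def
    by (intro open_Int continuous_open_preimage c assms(1) open_ball)
  have "a \<in> N" using assms s by (simp add: N_def)
  show ?thesis
  proof (rule analytic_continuation_open[OF N assms(1) _ assms(2) _ assms(3,4) _ assms(9)])
    show "N \<noteq> {}" using \<open>a \<in> N\<close> by blast
    show "N \<subseteq> C" by (auto simp: N_def)
    fix x assume "x \<in> N"
    then have "h (k1 x) = h (k2 x)" "k1 x \<in> ball (k1 a) s" "k2 x \<in> ball (k1 a) s"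
      using assms(5,6) by (auto simp: N_def)
    then show "k1 x = k2 x" using s(2) by (meson inj_onD)
  qed
qed

text \<open>A section of \<open>h\<close> pulls \<open>|h' dz|^2\<close> back to the Euclidean
  metric, so the image of the straight segment has length \<open>|b - a|\<close>.\<close>

lemma riem_dist_section:
  assumes k: "k holomorphic_on B" "\<And>w. w \<in> B \<Longrightarrow> h (k w) = w" and B: "open B" "convex B" "a \<in> B" "b \<in> B"
  shows "riem_dist (\<lambda>z v. (cmod (deriv h z * v))\<^sup>2) (k a) (k b) \<le> cmod (b - a)"
proof -
  let ?G = "\<lambda>z v. (cmod (deriv h z * v))\<^sup>2"
  define \<gamma> where "\<gamma> = k \<circ> linepath a b"
  have seg: "closed_segment a b \<subseteq> B" using B by (simp add: closed_segment_subset)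
  have v: "valid_path \<gamma>" unfolding \<gamma>_def
    by (rule valid_path_compose_holomorphic[OF valid_path_linepath k(1) B(1)]) (use seg in simp)
  have ends: "pathstart \<gamma> = k a" "pathfinish \<gamma> = k b"
    by (simp_all add: \<gamma>_def pathstart_def pathfinish_def linepath_def)
  have int: "sqrt (?G (\<gamma> t) (vector_derivative \<gamma> (at t))) = cmod (b - a)" if t: "t \<in> {0..1}" for t
  proof -
    define w where "w = linepath a b t"
    have w: "w \<in> B" unfolding w_def using linepath_in_path[OF t, of a b] seg by blast
    have k': "(k has_field_derivative deriv k w) (at w)" by (rule holomorphic_derivI[OF k(1) B(1) w])
    have h': "(h has_field_derivative deriv h (k w)) (at (k w))" by (rule holomorphic_derivI[OF hol open_UNIV UNIV_I])
    have "((\<lambda>x. h (k x)) has_field_derivative deriv h (k w) * deriv k w) (at w)" by (rule DERIV_chain2[OF h' k'])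
    moreover have "((\<lambda>x. h (k x)) has_field_derivative 1) (at w)"
      by (rule has_field_derivative_transform_within_open[OF DERIV_ident B(1) w]) (simp add: k(2))
    ultimately have one: "deriv h (k w) * deriv k w = 1" by (rule DERIV_unique)
    have "(\<gamma> has_vector_derivative (b - a) * deriv k w) (at t)"
      unfolding \<gamma>_def by (rule field_vector_diff_chain_at[OF has_vector_derivative_linepath_within]) (use k' in \<open>simp add: w_def\<close>)
    then have "vector_derivative \<gamma> (at t) = (b - a) * deriv k w" by (rule vector_derivative_at)
    then have "deriv h (\<gamma> t) * vector_derivative \<gamma> (at t) = (deriv h (k w) * deriv k w) * (b - a)"
      by (simp add: \<gamma>_def w_def mult_ac)
    then show ?thesis using one by simp
  qed
  have "riem_length ?G \<gamma> = integral {0..1::real} (\<lambda>t. cmod (b - a))"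
    unfolding riem_length_def by (rule integral_cong) (rule int)
  then have len: "riem_length ?G \<gamma> = cmod (b - a)" by simp
  \<comment> \<open>For a speed that is not integrable, \<open>integral\<close> takes the default
    value 0, so lengths stay bounded below.\<close>
  have nonneg: "0 \<le> riem_length ?G \<delta>" for \<delta>
  proof (cases "(\<lambda>t. sqrt (?G (\<delta> t) (vector_derivative \<delta> (at t)))) integrable_on {0..1}")
    case True
    then show ?thesis unfolding riem_length_def by (intro integral_nonneg) auto
  next
    case False
    then show ?thesis unfolding riem_length_def by (simp add: not_integrable_integral)
  qed
  show ?thesis
    unfolding riem_dist_def
  proof (rule cInf_lower2)
    show "riem_length ?G \<gamma> \<in> {riem_length ?G \<gamma> |\<gamma>. valid_path \<gamma> \<and> pathstart \<gamma> = k a \<and> pathfinish \<gamma> = k b}"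
      using v ends by blast
    show "bdd_below {riem_length ?G \<gamma> |\<gamma>. valid_path \<gamma> \<and> pathstart \<gamma> = k a \<and> pathfinish \<gamma> = k b}"
      by (rule bdd_belowI[of _ 0]) (use nonneg in blast)
  qed (simp add: len)
qed

text \<open>Points tending radially to \<open>a\<close> have images under \<open>k\<close> that are
  Cauchy for the metric. Completeness gives them a limit over \<open>a\<close>, and the local
  section through that limit continues \<open>k\<close>.\<close>

lemma section_boundary:
  assumes complete: "complete_metric (\<lambda>z v. (cmod (deriv h z * v))\<^sup>2)" and S: "S > 0"
    and k: "k holomorphic_on ball w0 S" "\<And>w. w \<in> ball w0 S \<Longrightarrow> h (k w) = w" and a: "a \<in> cball w0 S"
  shows "\<exists>r q. r > 0 \<and> q holomorphic_on ball a r \<and> (\<forall>w\<in>ball a r. h (q w) = w) \<and> (\<forall>w\<in>ball a r \<inter> ball w0 S. q w = k w)"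
proof -
  define t where "t n = 1 - 1 / real (n + 2)" for n
  define p where "p n = w0 + of_real (t n) * (a - w0)" for n
  have t01: "0 \<le> t n" "t n < 1" for n by (auto simp: t_def)
  have pB: "p n \<in> ball w0 S" for n
  proof -
    have "dist w0 (p n) = t n * dist w0 a" using t01[of n] by (simp add: p_def dist_norm norm_mult norm_minus_commute)
    also have "\<dots> < S"
    proof (cases "dist w0 a = 0")
      case False
      then have "t n * dist w0 a < 1 * dist w0 a" using t01(2)[of n] by (intro mult_strict_right_mono) auto
      then show ?thesis using a by simp
    qed (use S in simp)
    finally show ?thesis by simp
  qed
  have "(\<lambda>n. 1 / real (n + 2)) \<longlonglongrightarrow> 0"
    using LIMSEQ_ignore_initial_segment[OF lim_1_over_n, of 2] by simp
  from tendsto_diff[OF tendsto_const[of 1] this] have tl: "t \<longlonglongrightarrow> 1" by (simp add: t_def[abs_def])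
  have pl: "p \<longlonglongrightarrow> a"
  proof -
    have "p \<longlonglongrightarrow> w0 + of_real 1 * (a - w0)"
      unfolding p_def[abs_def] by (intro tendsto_intros tl)
    then show ?thesis by simp
  qed
  have "convergent (\<lambda>n. k (p n))"
  proof -
    have "\<exists>N. \<forall>m\<ge>N. \<forall>n\<ge>N. riem_dist (\<lambda>z v. (cmod (deriv h z * v))\<^sup>2) (k (p m)) (k (p n)) < e" if e: "e > 0" for e
    proof -
      have "Cauchy p" using pl LIMSEQ_imp_Cauchy by blast
      then obtain N where N: "\<And>m n. m \<ge> N \<Longrightarrow> n \<ge> N \<Longrightarrow> dist (p m) (p n) < e" using e unfolding Cauchy_def by metis
      have "riem_dist (\<lambda>z v. (cmod (deriv h z * v))\<^sup>2) (k (p m)) (k (p n)) < e" if "m \<ge> N" "n \<ge> N" for m n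
        using riem_dist_section[OF k open_ball convex_ball pB[of m] pB[of n]] N[OF that]
        by (simp add: dist_norm norm_minus_commute)
      then show ?thesis by blast
    qed
    then show ?thesis
      using complete[unfolded complete_metric_def, THEN spec, of "\<lambda>n. k (p n)"] by simp
  qed
  then obtain z where z: "(\<lambda>n. k (p n)) \<longlonglongrightarrow> z" unfolding convergent_def by blast
  have ch: "isCont h x" for x
    using hol holomorphic_on_imp_continuous_on continuous_on_eq_continuous_at by blast
  have "(\<lambda>n. h (k (p n))) \<longlonglongrightarrow> h z" using isCont_tendsto_compose[OF ch z] .
  then have hz: "h z = a" using pl by (simp add: k(2)[OF pB]) (metis LIMSEQ_unique)
  obtain r q where q: "r > 0" "q holomorphic_on ball a r" "q a = z" "\<And>w. w \<in> ball a r \<Longrightarrow> h (q w) = w"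
    using local_section[of z] unfolding hz by metis
  obtain s where s: "s > 0" "inj_on h (ball z s)"
    using has_complex_derivative_locally_injective[OF hol UNIV_I open_UNIV dh] by metis
  have "isCont q a" using q(1,2) holomorphic_on_imp_continuous_on continuous_on_eq_continuous_at[of "ball a r" q] by auto
  then have "(\<lambda>n. q (p n)) \<longlonglongrightarrow> q a" using isCont_tendsto_compose[OF _ pl] by blast
  then have "eventually (\<lambda>n. q (p n) \<in> ball z s) sequentially"
    using s(1) by (intro topological_tendstoD) (auto simp: q(3))
  moreover have "eventually (\<lambda>n. k (p n) \<in> ball z s) sequentially"
    using s(1) z by (intro topological_tendstoD) auto
  moreover have "eventually (\<lambda>n. p n \<in> ball a r) sequentially"
    using q(1) pl by (intro topological_tendstoD) auto
  ultimately have "eventually (\<lambda>n. q (p n) \<in> ball z s \<and> k (p n) \<in> ball z s \<and> p n \<in> ball a r) sequentially"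
    by eventually_elim blast
  then obtain n where n: "q (p n) \<in> ball z s" "k (p n) \<in> ball z s" "p n \<in> ball a r"
    by (auto simp: eventually_sequentially)
  have eq: "q (p n) = k (p n)"
    by (rule inj_onD[OF s(2) _ n(1,2)]) (simp add: q(4)[OF n(3)] k(2)[OF pB])
  have "q w = k w" if "w \<in> ball a r \<inter> ball w0 S" for w
  proof (rule section_unique[where C="ball a r \<inter> ball w0 S" and a="p n" and ?k1.0=q and ?k2.0=k])
    show "open (ball a r \<inter> ball w0 S)" by auto
    show "connected (ball a r \<inter> ball w0 S)" by (intro convex_connected convex_Int convex_ball)
    show "q holomorphic_on ball a r \<inter> ball w0 S" "k holomorphic_on ball a r \<inter> ball w0 S"
      using q(2) k(1) holomorphic_on_subset by blast+
    show "p n \<in> ball a r \<inter> ball w0 S" using n(3) pB by blast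
  qed (use q(4) k(2) eq that in auto)
  then show ?thesis using q by blast
qed

text \<open>The continuations at the points of the closed disc agree wherever they overlap, so they
  glue to a section-valued map on a neighbourhood, which by compactness contains a larger
  disc.\<close>

lemma section_extends:
  assumes complete: "complete_metric (\<lambda>z v. (cmod (deriv h z * v))\<^sup>2)" and S: "S > 0"
    and k: "k holomorphic_on ball w0 S" "\<And>w. w \<in> ball w0 S \<Longrightarrow> h (k w) = w"
  obtains d K where "d > 0" "K holomorphic_on ball w0 (S + d)" "\<And>w. w \<in> ball w0 S \<Longrightarrow> K w = k w"
proof -
  have "\<forall>a\<in>cball w0 S. \<exists>r q. r > 0 \<and> q holomorphic_on ball a r \<and> (\<forall>w\<in>ball a r. h (q w) = w) \<and> (\<forall>w\<in>ball a r \<inter> ball w0 S. q w = k w)"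
    using section_boundary[OF complete S k] by blast
  from bchoice[OF this] obtain r where "\<forall>a\<in>cball w0 S. \<exists>q. r a > 0 \<and> q holomorphic_on ball a (r a) \<and>
      (\<forall>w\<in>ball a (r a). h (q w) = w) \<and> (\<forall>w\<in>ball a (r a) \<inter> ball w0 S. q w = k w)" ..
  from bchoice[OF this] obtain q where q: "\<forall>a\<in>cball w0 S. r a > 0 \<and> q a holomorphic_on ball a (r a) \<and>
      (\<forall>w\<in>ball a (r a). h (q a w) = w) \<and> (\<forall>w\<in>ball a (r a) \<inter> ball w0 S. q a w = k w)" ..
  have rq: "\<And>a. a \<in> cball w0 S \<Longrightarrow> r a > 0" "\<And>a. a \<in> cball w0 S \<Longrightarrow> q a holomorphic_on ball a (r a)"
    "\<And>a w. a \<in> cball w0 S \<Longrightarrow> w \<in> ball a (r a) \<Longrightarrow> h (q a w) = w"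
    "\<And>a w. a \<in> cball w0 S \<Longrightarrow> w \<in> ball a (r a) \<Longrightarrow> w \<in> ball w0 S \<Longrightarrow> q a w = k w"
    using q by blast+
  have agree: "q a w = q b w" if ab: "a \<in> cball w0 S" "b \<in> cball w0 S" and w: "w \<in> ball a (r a)" "w \<in> ball b (r b)" for a b w
  proof -
    define Q where "Q = ball a (r a) \<inter> ball b (r b)"
    \<comment> \<open>The point \<open>x\<close> below divides the segment of the centres in the
      ratio of the radii, so it lies in both discs; by convexity it lies in the closed disc too. The
      overlap therefore meets the open disc, where both continuations equal
      \<open>k\<close>.\<close>
    define c where "c = r a / (r a + r b)"
    define x where "x = (1 - c) *\<^sub>R a + c *\<^sub>R b"
    have pos: "r a > 0" "r b > 0" using rq(1) ab by blast+
    have c: "0 \<le> c" "0 \<le> 1 - c" "c * (r a + r b) = r a" "(1 - c) * (r a + r b) = r b" "0 < c" "0 < 1 - c"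
      using pos by (auto simp: c_def field_simps)
    have "dist a b < r a + r b" using w dist_triangle_less_add[of a w "r a" b "r b"] by (simp add: dist_commute)
    then have "c * dist a b < c * (r a + r b)" "(1 - c) * dist a b < (1 - c) * (r a + r b)"
      using c(5,6) by (auto intro: mult_strict_left_mono simp del: mult_less_cancel_left_pos)
    moreover have "x - a = c *\<^sub>R (b - a)" "b - x = (1 - c) *\<^sub>R (b - a)" by (simp_all add: x_def algebra_simps)
    moreover have "dist a x = norm (x - a)" "dist b x = norm (b - x)" "dist a b = norm (b - a)"
      by (simp_all add: dist_norm norm_minus_commute)
    ultimately have "dist a x < r a" "dist b x < r b" using c by simp_all
    then have "x \<in> Q" by (simp add: Q_def)
    moreover have "x \<in> cball w0 S"
      unfolding x_def using convexD[OF convex_cball ab, of "1 - c" c] c by simp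
    then have "x \<in> closure (ball w0 S)" using S by simp
    moreover have "open Q" by (auto simp: Q_def)
    ultimately have "Q \<inter> ball w0 S \<noteq> {}" using open_Int_closure_eq_empty by blast
    then obtain y where y: "y \<in> Q" "y \<in> ball w0 S" by blast
    show ?thesis
    proof (rule section_unique[where C=Q and a=y and ?k1.0="q a" and ?k2.0="q b"])
      show "connected Q" unfolding Q_def by (intro convex_connected convex_Int convex_ball)
      show "q a holomorphic_on Q" "q b holomorphic_on Q" using rq(2) ab holomorphic_on_subset unfolding Q_def by blast+
      show "q a y = q b y" using rq(4) ab y unfolding Q_def by (metis IntD1 IntD2)
    qed (use rq(3) ab y w \<open>open Q\<close> in \<open>auto simp: Q_def\<close>)
  qed
  define W where "W = (\<Union>a\<in>cball w0 S. ball a (r a))"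
  have "cball w0 S \<subseteq> W" using rq(1) unfolding W_def by (meson UN_I centre_in_ball subsetI)
  moreover have "open W" by (auto simp: W_def)
  ultimately obtain d where d: "d > 0" "(\<Union>x\<in>cball w0 S. cball x d) \<subseteq> W"
    using compact_subset_open_imp_cball_epsilon_subset[OF compact_cball] by metis
  have big: "ball w0 (S + d) \<subseteq> W"
  proof
    fix x assume x: "x \<in> ball w0 (S + d)"
    show "x \<in> W"
    proof (cases "x \<in> cball w0 S")
      case True then show ?thesis using \<open>cball w0 S \<subseteq> W\<close> by blast
    next
      case False
      \<comment> \<open>\<open>y\<close> is the radial projection of \<open>x\<close> to the circle
        of radius \<open>S\<close>, at distance \<open>n - S\<close> less than \<open>d\<close> from
        \<open>x\<close>.\<close>
      define n y where "n = dist w0 x" and "y = w0 + (S / n) *\<^sub>R (x - w0)"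
      have n: "S < n" "n < S + d" using False x by (auto simp: n_def)
      have nn: "norm (x - w0) = n" by (simp add: n_def dist_norm norm_minus_commute)
      have "y - w0 = (S / n) *\<^sub>R (x - w0)" "x - y = (1 - S / n) *\<^sub>R (x - w0)"
        by (simp_all add: y_def scaleR_left_diff_distrib)
      then have "norm (y - w0) = S" "norm (x - y) = (1 - S / n) * n" using n S by (simp_all add: nn)
      moreover have "(1 - S / n) * n = n - S" using n S by (simp add: left_diff_distrib)
      moreover have "dist w0 y = norm (y - w0)" "dist y x = norm (x - y)" by (simp_all add: dist_norm norm_minus_commute)
      ultimately have "y \<in> cball w0 S" "x \<in> cball y d" using n by auto
      then show ?thesis using d(2) by blast
    qed
  qed
  define c where "c w = (SOME a. a \<in> cball w0 S \<and> w \<in> ball a (r a))" for w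
  have c: "c w \<in> cball w0 S" "w \<in> ball (c w) (r (c w))" if "w \<in> W" for w
    using someI_ex[of "\<lambda>a. a \<in> cball w0 S \<and> w \<in> ball a (r a)"] that unfolding W_def c_def by blast+
  define K where "K w = q (c w) w" for w
  have Kq: "K w = q a w" if "a \<in> cball w0 S" "w \<in> ball a (r a)" for a w
  proof -
    have "w \<in> W" using that by (auto simp: W_def)
    then show ?thesis unfolding K_def using agree c that by blast
  qed
  have "K holomorphic_on ball a (r a)" if "a \<in> cball w0 S" for a
    using rq(2)[OF that] by (rule holomorphic_transform) (use Kq that in auto)
  then have "K holomorphic_on W" unfolding W_def by (intro holomorphic_on_UN_open) auto
  then have "K holomorphic_on ball w0 (S + d)" using big by (rule holomorphic_on_subset)
  moreover have "K w = k w" if "w \<in> ball w0 S" for w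
  proof -
    have "w \<in> W" using that \<open>cball w0 S \<subseteq> W\<close> by auto
    show ?thesis unfolding K_def by (rule rq(4)[OF c[OF \<open>w \<in> W\<close>] that])
  qed
  ultimately show ?thesis using that d(1) by blast
qed

text \<open>
  The power series of a local inverse of \<open>h\<close> has infinite radius of convergence, because by
  completeness the inverse extends beyond every disc.
\<close>

lemma entire_section:
  assumes complete: "complete_metric (\<lambda>z v. (cmod (deriv h z * v))\<^sup>2)"
  obtains k where "k holomorphic_on UNIV" "\<And>w. h (k w) = w"
proof -
  define w0 where "w0 = h 0"
  obtain r q where q: "r > 0" "q holomorphic_on ball w0 r" "\<And>w. w \<in> ball w0 r \<Longrightarrow> h (q w) = w"
    using local_section[of 0] unfolding w0_def by metis
  define F where "F = fps_expansion q w0"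
  define R where "R = fps_conv_radius F"
  define k where "k w = eval_fps F (w - w0)" for w
  have qe: "q holomorphic_on eball w0 (ereal r)" using q(2) by simp
  have Rr: "R \<ge> ereal r" unfolding R_def F_def by (rule conv_radius_fps_expansion[OF qe])
  have kq: "k w = q w" if "w \<in> ball w0 r" for w
    unfolding k_def F_def using eval_fps_expansion[OF qe, of w] that by simp
  have kh: "k holomorphic_on eball w0 R"
  proof -
    have "eval_fps F \<circ> (\<lambda>w. w - w0) holomorphic_on eball w0 R"
    proof (rule holomorphic_on_compose)
      show "eval_fps F holomorphic_on (\<lambda>w. w - w0) ` eball w0 R"
        by (rule holomorphic_on_eval_fps) (auto simp: R_def dist_norm norm_minus_commute)
    qed (intro holomorphic_intros)
    then show ?thesis by (simp add: k_def[abs_def] o_def)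
  qed
  have sec: "h (k w) = w" if "ball w0 S \<subseteq> eball w0 R" "r \<le> S" "w \<in> ball w0 S" for w S
  proof (rule analytic_continuation_open[of "ball w0 r" "ball w0 S" "\<lambda>w. h (k w)" "\<lambda>w. w"])
    show "(\<lambda>w. h (k w)) holomorphic_on ball w0 S"
      using holomorphic_on_compose_gen[OF holomorphic_on_subset[OF kh that(1)] hol] by (simp add: o_def)
    show "h (k z) = z" if "z \<in> ball w0 r" for z using kq q(3) that by simp
  qed (use q(1) that in \<open>auto intro: holomorphic_on_ident\<close>)
  show ?thesis
  proof (cases "R = \<infinity>")
    case True
    have "h (k w) = w" for w
      by (rule sec[of "max r (dist w0 w + 1)"]) (auto simp: True)
    then show ?thesis using that kh True by simp
  next
    case False
    then obtain S where S: "R = ereal S" using Rr by (cases R) auto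
    have rS: "r \<le> S" "S > 0" using Rr q(1) S by auto
    have kS: "k holomorphic_on ball w0 S" using kh S by simp
    obtain d K where K: "d > 0" "K holomorphic_on ball w0 (S + d)" "\<And>w. w \<in> ball w0 S \<Longrightarrow> K w = k w"
      using section_extends[OF complete rS(2) kS] sec[of S] S rS by (metis eball_ereal order_refl)
    \<comment> \<open>The extension has the same power series at \<open>w0\<close> as
      \<open>q\<close>, but a radius of convergence of at least \<open>S + d\<close>: a
      contradiction.\<close>
    have "eventually (\<lambda>w. K w = q w) (nhds w0)"
      unfolding eventually_nhds
      by (rule exI[of _ "ball w0 r"]) (use q(1) K(3) kq rS in auto)
    then have "fps_expansion K w0 = F" unfolding F_def by (rule fps_expansion_cong)
    moreover have "fps_conv_radius (fps_expansion K w0) \<ge> ereal (S + d)"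
      by (rule conv_radius_fps_expansion) (use K(2) in simp)
    ultimately have "ereal (S + d) \<le> ereal S" using S R_def by simp
    then show ?thesis using K(1) by simp
  qed
qed

text \<open>An entire section \<open>k\<close> is injective, so its range is open; the range is also
  closed, being the fixed point set of \<open>k\<close> after \<open>h\<close>. Hence
  \<open>k\<close> is onto and a two-sided inverse.\<close>

lemma complete_imp_homeomorphism:
  assumes complete: "complete_metric (\<lambda>z v. (cmod (deriv h z * v))\<^sup>2)"
  obtains k where "homeomorphism UNIV UNIV h k"
proof -
  obtain k where k: "k holomorphic_on UNIV" "\<And>w. h (k w) = w" using entire_section[OF complete] by metis
  have ck: "continuous_on UNIV k" and ch: "continuous_on UNIV h"
    using k(1) hol holomorphic_on_imp_continuous_on by blast+
  have inj: "inj k" by (rule inj_on_inverseI[of _ h]) (rule k(2))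
  have "open (range k)" by (rule invariance_of_domain[OF ck open_UNIV inj])
  moreover have "closed (range k)"
  proof -
    have "range k = {z. k (h z) = z}" using k(2) by (auto intro: range_eqI[OF sym])
    moreover have "continuous_on UNIV (\<lambda>z. k (h z))" by (rule continuous_on_compose2[OF ck ch]) simp
    ultimately show ?thesis using closed_Collect_eq[of "\<lambda>z. k (h z)" "\<lambda>z. z"] by (simp add: continuous_on_id)
  qed
  ultimately have surj: "range k = UNIV" using clopen[of "range k"] by blast
  have "k (h z) = z" for z using surj k(2) by (metis rangeE UNIV_I)
  then have "homeomorphism UNIV UNIV h k" using k(2) ck ch by (intro homeomorphismI) auto
  then show ?thesis by (rule that)
qed

lemma range_omits_at_most_one: "a \<in> range h \<or> b \<in> range h" if ab: "a \<noteq> b"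
proof (rule ccontr)
  assume "\<not> ?thesis"
  then have "range h \<inter> {a, b} = {}" by blast
  then obtain c where "h = (\<lambda>x. c)" using little_Picard[OF hol ab] by blast
  then have "deriv h 0 = 0" by simp
  then show False using dh by blast
qed

end

section \<open>Flat transverse curves are Clifford tori\<close>

text \<open>The whole torus is reached although \<open>h\<close> may omit a value: of a point and
  its translate by a period at least one is a value of \<open>h\<close>, and \<open>F\<close> agrees
  on the two.\<close>

lemma transverse_curve_plane:
  assumes J: "J_holomorphic \<phi>" and tr: "transverse \<phi>" and flat: "flat_metric (g_H \<phi>)"
  obtains F T h where "clifford_torus T" "range \<phi> = T" "universal_cover F T" "h holomorphic_on UNIV"
    "\<And>z. deriv h z \<noteq> 0" "\<phi> = F \<circ> h" "\<And>z v. g_H \<phi> z v = (cmod (deriv h z * v))\<^sup>2"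
proof -
  obtain h g where h: "h holomorphic_on UNIV" "\<And>z. deriv h z \<noteq> 0" "g \<in> Sp2"
    "\<And>z. \<phi> z = act g (model_curve (h z))" "\<And>z v. g_H \<phi> z v = (cmod (deriv h z * v))\<^sup>2"
    using flat_transverse_factors[OF J tr flat] by metis
  define F where "F \<zeta> = act g (model_curve \<zeta>)" for \<zeta>
  \<comment> \<open>Real with \<open>sqrt 2 * Re p = 2 pi\<close>: an element of
    \<open>torus_periods\<close> for the sign 1.\<close>
  define p where "p = Complex (2 * pi / sqrt 2) 0"
  have p: "p \<noteq> 0" by (simp add: p_def complex_eq_iff)
  have per: "F (\<zeta> + p) = F \<zeta>" for \<zeta>
  proof -
    have "p \<in> torus_periods" by (simp add: torus_periods_def p_def)
    then show ?thesis using model_curve_periodic[of "\<zeta> + p" \<zeta>] by (simp add: F_def)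
  qed
  have "F \<zeta> \<in> range \<phi>" for \<zeta>
  proof -
    have "\<zeta> \<in> range h \<or> \<zeta> + p \<in> range h" using range_omits_at_most_one[OF h(1,2), of \<zeta> "\<zeta> + p"] p by simp
    then obtain z where "h z = \<zeta> \<or> h z = \<zeta> + p" by (metis rangeE)
    then have "\<phi> z = F \<zeta>" using h(4)[of z] per by (auto simp: F_def)
    then show ?thesis by (metis rangeI)
  qed
  then have "range \<phi> = range F" using h(4) by (auto simp: F_def)
  moreover have "\<phi> = F \<circ> h" using h(4) by (auto simp: F_def)
  moreover have "clifford_torus (range F)" "universal_cover F (range F)"
    using clifford_torus_model[OF h(3)] universal_cover_model[OF h(3)] by (simp_all add: F_def[abs_def])
  ultimately show ?thesis using that h by metis
qed

section \<open>Periodic curves and complex tori\<close>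

lemma frame_shift:
  assumes "frame \<psi> U g"
  shows "frame (\<lambda>z. \<psi> (z + l)) ((\<lambda>z. z - l) ` U) (\<lambda>z. g (z + l))"
    "z + l \<in> U \<Longrightarrow> mc (\<lambda>z. g (z + l)) z v = mc g (z + l) v"
proof -
  have U: "open U" and g: "smooth_on U g" using assms by (auto simp: frame_def)
  show "frame (\<lambda>z. \<psi> (z + l)) ((\<lambda>z. z - l) ` U) (\<lambda>z. g (z + l))"
    using assms Ck_on_shift[OF U] by (auto simp: frame_def smooth_on_def open_translation_subtract)
  assume z: "z + l \<in> U"
  have "((\<lambda>z. z + l) has_derivative (\<lambda>v. v)) (at z)" by (auto intro!: derivative_eq_intros)
  then have "((\<lambda>z. g (z + l)) has_derivative frechet_derivative g (at (z + l))) (at z)"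
    by (rule has_derivative_compose[where g=g and f="\<lambda>z. z + l", OF _ smooth_on_has_derivative[OF U g z]])
  from fun_cong[OF frechet_derivative_at[OF this], of v]
  show "mc (\<lambda>z. g (z + l)) z v = mc g (z + l) v" by (simp add: mc_def)
qed

lemma g_H_periodic:
  assumes J: "J_holomorphic \<psi>" and per: "\<And>z. \<psi> (z + l) = \<psi> z"
  shows "g_H \<psi> (z + l) v = g_H \<psi> z v"
proof -
  obtain U g where g: "frame \<psi> U g" "z + l \<in> U" using frame_exists J unfolding J_holomorphic_def by blast
  have f: "frame \<psi> ((\<lambda>z. z - l) ` U) (\<lambda>z. g (z + l))" using frame_shift(1)[OF g(1), of l] by (simp add: per)
  have "z \<in> (\<lambda>z. z - l) ` U" using g(2) by (auto intro: image_eqI[of _ _ "z + l"])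
  then show ?thesis using g_H_frame[OF g] g_H_frame[OF f] frame_shift(2)[OF g(1,2)] by simp
qed

lemma lattice_fundamental:
  assumes "lattice L"
  obtains K where "compact K" "\<And>z. \<exists>l\<in>L. z + l \<in> K"
proof -
  obtain a b where ab: "Im (cnj a * b) \<noteq> 0" "L = {of_int m * a + of_int n * b | m n. True}"
    using assms unfolding lattice_def by blast
  define K where "K = (\<lambda>(s, t). of_real s * a + of_real t * b) ` ({0..1::real} \<times> {0..1::real})"
  have "compact K" unfolding K_def
    by (intro compact_continuous_image compact_Times compact_Icc) (auto intro!: continuous_intros simp: case_prod_unfold)
  moreover have "\<exists>l\<in>L. z + l \<in> K" for z
  proof -
    \<comment> \<open>Cramer's rule for the real coordinates of \<open>z\<close> in the basis
      \<open>a\<close>, \<open>b\<close>; subtracting their integer parts moves \<open>z\<close>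
      into the fundamental parallelogram.\<close>
    define D s t where "D = Im (cnj a * b)" and "s = Im (cnj z * b) / D" and "t = Im (cnj a * z) / D"
    have D: "D \<noteq> 0" using ab by (simp add: D_def)
    have "of_real D * z = of_real (Im (cnj z * b)) * a + of_real (Im (cnj a * z)) * b"
      by (simp add: D_def complex_eq_iff algebra_simps)
    then have "z = (of_real (Im (cnj z * b)) * a + of_real (Im (cnj a * z)) * b) / of_real D"
      using D by (metis nonzero_mult_div_cancel_left of_real_eq_0_iff)
    then have z: "z = of_real s * a + of_real t * b" by (simp add: s_def t_def add_divide_distrib)
    have "z + (of_int (- \<lfloor>s\<rfloor>) * a + of_int (- \<lfloor>t\<rfloor>) * b) = of_real (frac s) * a + of_real (frac t) * b"
      by (simp add: z frac_def algebra_simps)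
    moreover have "frac s \<in> {0..1}" "frac t \<in> {0..1}" by (simp_all add: less_imp_le[OF frac_lt_1])
    ultimately have "z + (of_int (- \<lfloor>s\<rfloor>) * a + of_int (- \<lfloor>t\<rfloor>) * b) \<in> K"
      unfolding K_def by (intro image_eqI[of _ _ "(frac s, frac t)"]) auto
    then show ?thesis using ab(2) by blast
  qed
  ultimately show ?thesis using that by blast
qed

lemma lattice_coset_shift:
  assumes "lattice L" "l \<in> L"
  shows "coset L (z + l) = coset L z"
proof -
  obtain a b where ab: "L = {of_int m * a + of_int n * b | m n. True}" using assms unfolding lattice_def by blast
  have sum: "x + y \<in> L" "x - y \<in> L" if xy: "x \<in> L" "y \<in> L" for x y
  proof -
    obtain m n m' n' where e: "x = of_int m * a + of_int n * b" "y = of_int m' * a + of_int n' * b"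
      using xy unfolding ab by blast
    have "x + y = of_int (m + m') * a + of_int (n + n') * b" "x - y = of_int (m - m') * a + of_int (n - n') * b"
      by (simp_all add: e algebra_simps)
    then show "x + y \<in> L" "x - y \<in> L" unfolding ab by blast+
  qed
  show ?thesis
    unfolding coset_def
  proof (intro equalityI subsetI)
    fix x assume "x \<in> (\<lambda>l'. z + l + l') ` L"
    then obtain l' where "l' \<in> L" "x = z + (l + l')" by (auto simp: add.assoc)
    then show "x \<in> (\<lambda>l. z + l) ` L" using sum(1)[OF assms(2)] by blast
  next
    fix x assume "x \<in> (\<lambda>l. z + l) ` L"
    then obtain l' where l': "l' \<in> L" "x = z + l'" by auto
    then have "x = z + l + (l' - l)" by simp
    then show "x \<in> (\<lambda>l'. z + l + l') ` L" using sum(2)[OF l'(1) assms(2)] by blast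
  qed
qed

text \<open>The density of \<open>g_H\<close> is periodic, and hence so is the modulus of
  \<open>deriv h\<close>. It is therefore bounded on the plane, \<open>deriv h\<close> is constant
  by Liouville's theorem, and \<open>h\<close> is affine.\<close>

lemma transverse_curve_torus:
  assumes L: "lattice L" and J: "J_holomorphic (\<phi> \<circ> coset L)" and tr: "transverse (\<phi> \<circ> coset L)"
    and flat: "flat_metric (g_H (\<phi> \<circ> coset L))"
  shows "\<exists>T. clifford_torus T \<and> \<phi> ` complex_torus L = T \<and> universal_cover (\<phi> \<circ> coset L) T"
proof -
  define \<psi> where "\<psi> = \<phi> \<circ> coset L"
  obtain F T h where h: "clifford_torus T" "range \<psi> = T" "universal_cover F T" "h holomorphic_on UNIV"
    "\<And>z. deriv h z \<noteq> 0" "\<psi> = F \<circ> h" "\<And>z v. g_H \<psi> z v = (cmod (deriv h z * v))\<^sup>2"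
    using transverse_curve_plane[OF J tr flat, folded \<psi>_def] by metis
  obtain K where K: "compact K" "\<And>z. \<exists>l\<in>L. z + l \<in> K" using lattice_fundamental[OF L] by metis
  have dhol: "deriv h holomorphic_on UNIV" using h(4) by (intro holomorphic_deriv) auto
  have "bounded (range (deriv h))"
  proof -
    have "bounded (deriv h ` K)"
      using dhol holomorphic_on_imp_continuous_on continuous_on_subset K(1)
      by (blast intro: compact_imp_bounded compact_continuous_image)
    then obtain B where B: "\<And>w. w \<in> K \<Longrightarrow> cmod (deriv h w) \<le> B" unfolding bounded_iff by blast
    have "cmod (deriv h z) \<le> B" for z
    proof -
      obtain l where l: "l \<in> L" "z + l \<in> K" using K(2) by blast
      have "\<psi> (w + l) = \<psi> w" for w using lattice_coset_shift[OF L l(1)] by (simp add: \<psi>_def)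
      from g_H_periodic[OF J[folded \<psi>_def] this, of z 1]
      have "(cmod (deriv h (z + l)))\<^sup>2 = (cmod (deriv h z))\<^sup>2" by (simp add: h(7))
      then have "cmod (deriv h (z + l)) = cmod (deriv h z)" by (rule power2_eq_imp_eq) auto
      then show ?thesis using B[OF l(2)] by simp
    qed
    then show ?thesis unfolding bounded_iff by blast
  qed
  then have "deriv h constant_on UNIV" using Liouville_theorem[OF dhol] by blast
  then obtain c where c: "\<And>z. deriv h z = c" unfolding constant_on_def by blast
  have c0: "c \<noteq> 0" using h(5) c by metis
  have "((\<lambda>z. h z - c * z) has_field_derivative 0) (at z)" for z
  proof -
    have "((\<lambda>z. h z - c * z) has_field_derivative deriv h z - c * 1) (at z)"
      by (intro DERIV_diff holomorphic_derivI[OF h(4) open_UNIV UNIV_I] DERIV_cmult DERIV_ident)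
    then show ?thesis by (simp add: c)
  qed
  then have "((\<lambda>z. h z - c * z) has_derivative (\<lambda>v. 0)) (at z)" for z
    unfolding lambda_zero has_field_derivative_def .
  then have "h z - c * z = h 0 - c * 0" for z
    using has_derivative_zero_unique[OF convex_UNIV, of "\<lambda>z. h z - c * z" z 0] by auto
  then have ha: "h z = c * z + h 0" for z by (metis add.commute diff_add_cancel diff_zero mult_zero_right)
  have "homeomorphism UNIV UNIV h (\<lambda>w. (w - h 0) / c)"
  proof (rule homeomorphismI)
    show "continuous_on UNIV h" using h(4) by (rule holomorphic_on_imp_continuous_on)
    show "continuous_on UNIV (\<lambda>w. (w - h 0) / c)" using c0 by (intro continuous_intros) auto
    show "(h z - h 0) / c = z" for z using ha[of z] c0 by simp
    show "h ((w - h 0) / c) = w" for w using ha[of "(w - h 0) / c"] c0 by simp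
  qed auto
  then have "covering_space UNIV \<psi> T"
    unfolding h(6) using h(3) covering_space_precompose_homeomorphism unfolding universal_cover_def by blast
  then have "universal_cover \<psi> T" using J by (simp add: universal_cover_def \<psi>_def)
  moreover have "\<phi> ` complex_torus L = T" using h(2) by (simp add: \<psi>_def complex_torus_def image_image)
  ultimately show ?thesis using h(1) unfolding \<psi>_def by blast
qed

text \<open>Over the plane, \<open>F\<close> composed with \<open>exp\<close> is flat and covers
  every point of the torus, yet its metric is incomplete and it is not a covering map. The second
  half therefore gives the factorisation through a universal cover in general, and identifies the
  curve itself as one under completeness.\<close>

theorem theorem5p5:
  shows "(\<forall>(L :: complex set) (\<phi> :: complex set \<Rightarrow> cp3).
            lattice L \<and> J_holomorphic (\<phi> \<circ> coset L) \<and> transverse (\<phi> \<circ> coset L) \<and>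
            flat_metric (g_H (\<phi> \<circ> coset L)) \<longrightarrow>
            (\<exists>T. clifford_torus T \<and> \<phi> ` complex_torus L = T \<and>
                 universal_cover (\<phi> \<circ> coset L) T)) \<and>
         (\<forall>\<phi> :: complex \<Rightarrow> cp3.
            J_holomorphic \<phi> \<and> transverse \<phi> \<and> flat_metric (g_H \<phi>) \<longrightarrow>
            (\<exists>T. clifford_torus T \<and> \<phi> ` UNIV = T \<and>
                 (\<exists>F h. universal_cover F T \<and> h holomorphic_on UNIV \<and>
                        (\<forall>z. deriv h z \<noteq> 0) \<and> \<phi> = F \<circ> h) \<and>
                 (complete_metric (g_H \<phi>) \<longrightarrow> universal_cover \<phi> T)))"
proof (intro conjI allI impI; elim conjE)
  fix L :: "complex set" and \<phi> :: "complex set \<Rightarrow> cp3"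
  assume "lattice L" "J_holomorphic (\<phi> \<circ> coset L)" "transverse (\<phi> \<circ> coset L)" "flat_metric (g_H (\<phi> \<circ> coset L))"
  then show "\<exists>T. clifford_torus T \<and> \<phi> ` complex_torus L = T \<and> universal_cover (\<phi> \<circ> coset L) T"
    by (rule transverse_curve_torus)
next
  fix \<phi> :: "complex \<Rightarrow> cp3"
  assume J: "J_holomorphic \<phi>" and "transverse \<phi>" "flat_metric (g_H \<phi>)"
  then obtain F T h where h: "clifford_torus T" "range \<phi> = T" "universal_cover F T" "h holomorphic_on UNIV"
    "\<And>z. deriv h z \<noteq> 0" "\<phi> = F \<circ> h" "\<And>z v. g_H \<phi> z v = (cmod (deriv h z * v))\<^sup>2"
    using transverse_curve_plane by metis
  have "universal_cover \<phi> T" if C: "complete_metric (g_H \<phi>)"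
  proof -
    have "g_H \<phi> = (\<lambda>z v. (cmod (deriv h z * v))\<^sup>2)" by (intro ext h(7))
    then have "complete_metric (\<lambda>z v. (cmod (deriv h z * v))\<^sup>2)" using C by simp
    then obtain k where "homeomorphism UNIV UNIV h k"
      using complete_imp_homeomorphism[OF h(4,5)] by blast
    then have "covering_space UNIV \<phi> T"
      using h(3) unfolding h(6) universal_cover_def by (blast intro: covering_space_precompose_homeomorphism)
    then show ?thesis using J by (simp add: universal_cover_def)
  qed
  then show "\<exists>T. clifford_torus T \<and> range \<phi> = T \<and>
      (\<exists>F h. universal_cover F T \<and> h holomorphic_on UNIV \<and> (\<forall>z. deriv h z \<noteq> 0) \<and> \<phi> = F \<circ> h) \<and>
      (complete_metric (g_H \<phi>) \<longrightarrow> universal_cover \<phi> T)"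
    using h by blast
qed

end
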